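(* Let $n\geq 3$ be a natural number, $(R,\Lambda)$ a form ring with $R$ commutative, and $H$ a subgroup of $U_{2n}(R,\Lambda)$. Then $H$ is normalized by $EU_{2n}(R,\Lambda)$ if and only if $$EU_{2n}((R,\Lambda),(I,\Gamma))\subseteq H\subseteq CU_{2n}((R,\Lambda),(I,\Gamma))$$ for some form ideal $(I,\Gamma)$ of $(R,\Lambda)$.
   Context: Rings are associative with $1\neq 0$; ideals are two-sided. For group elements $g,h$ put $[g,h]:=ghg^{-1}h^{-1}$. Form rings: let $R$ be a ring with an involution $x\mapsto\bar x$, i.e. $\overline{x+y}=\bar x+\bar y$, $\overline{xy}=\bar y\bar x$, $\bar{\bar x}=x$. Let $\lambda\in \mathrm{center}(R)$ with $\lambda\bar\lambda=1$, and put $\Lambda_{min}:=\{x-\lambda\bar x\mid x\in R\}$ and $\Lambda_{max}:=\{x\in R\mid x=-\lambda\bar x\}$. A form parameter for $R$ is an additive subgroup $\Lambda$ of $R$ with $\Lambda_{min}\subseteq\Lambda\subseteq\Lambda_{max}$ and $x\Lambda\bar x\subseteq\Lambda$ for all $x\in R$. The pair $(R,\Lambda)$ is then called a form ring (the involution and $\lambda$ being part of the data). Form ideals: let $I$ be an ideal of $R$ with $\bar I=I$. Put $\Gamma_{max}:=I\cap\Lambda$ and $\Gamma_{min}:=\{x-\lambda\bar x\mid x\in I\}+\langle\{xy\bar x\mid x\in I,y\in\Lambda\}\rangle$ (where $\langle\cdot\rangle$ is the additive subgroup generated). A relative form parameter of level $I$ is an additive subgroup $\Gamma$ of $I$ with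 $\Gamma_{min}\subseteq\Gamma\subseteq\Gamma_{max}$ and $x\Gamma\bar x\subseteq\Gamma$ for all $x\in R$. The pair $(I,\Gamma)$ is then called a form ideal of $(R,\Lambda)$. Unitary group: let $\Omega_+:=\{1,\dots,n\}$, $\Omega_-:=\{-n,\dots,-1\}$, $\Omega:=\Omega_+\cup\Omega_-$, and $\epsilon(i):=1$ if $i\in\Omega_+$, $\epsilon(i):=-1$ if $i\in\Omega_-$. Rows and columns of $2n\times2n$ matrices and coordinates of columns in $V:=R^{2n}$ are indexed by $\Omega$ in the order $1,\dots,n,-n,\dots,-1$ (so for $-n\leq i\leq-1$ the index $i$ refers to position $2n+1+i$). Let $p\in M_n(R)$ be the matrix with ones on the skew diagonal and zeros elsewhere. For $v,w\in V$ put $f(v,w):=\bar v^t\begin{pmatrix}0&p\\0&0\end{pmatrix}w$, $h(v,w):=\bar v^t\begin{pmatrix}0&p\\\lambda p&0\end{pmatrix}w$ (where $\bar v$ is obtained by applying the involution to each entry) and $q(v):=f(v,v)+\Lambda\in R/\Lambda$. The hyperbolic unitary group is $U_{2n}(R,\Lambda):=\{\sigma\in GL_{2n}(R)\mid h(\sigma u,\sigma v)=h(u,v)\text{ and }q(\sigma v)=q(v)\ \forall u,v\in V\}$. Elementary subgroups: let $e$ be the identity matrix and $e^{ij}$ ($i,j\in\Omega$) the matrix with $1$ at position $(i,j)$ and zeros elsewhere. For $i,j\in\Omega$ with $i\neq\pm j$ and $x\in R$, put $T_{ij}(x):=e+xe^{ij}-\lambda^{(\epsilon(j)-\epsilon(i))/2}\bar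 x e^{-j,-i}\in U_{2n}(R,\Lambda)$ (short root). For $i\in\Omega$ and $y\in\lambda^{-(\epsilon(i)+1)/2}\Lambda$, put $T_{i,-i}(y):=e+ye^{i,-i}\in U_{2n}(R,\Lambda)$ (long root). $EU_{2n}(R,\Lambda)$ is the subgroup of $U_{2n}(R,\Lambda)$ generated by all these elementary transvections. An elementary transvection $T_{ij}(x)$ is $(I,\Gamma)$-elementary if either $i\neq-j$ and $x\in I$, or $i=-j$ and $x\in\lambda^{-(\epsilon(i)+1)/2}\Gamma$. $EU_{2n}(I,\Gamma)$ is the subgroup generated by all $(I,\Gamma)$-elementary transvections, and $EU_{2n}((R,\Lambda),(I,\Gamma))$ is its normal closure in $EU_{2n}(R,\Lambda)$. Congruence subgroups: $U_{2n}((R,\Lambda),(I,\Gamma))$ is the group of all $\sigma\in U_{2n}(R,\Lambda)$ such that $\sigma\equiv e \bmod I$ and $f(\sigma v,\sigma v)\equiv f(v,v)\bmod\Gamma$ for all $v\in V$; it is a normal subgroup of $U_{2n}(R,\Lambda)$. The full congruence subgroup of level $(I,\Gamma)$ is $CU_{2n}((R,\Lambda),(I,\Gamma)):=\{\sigma\in U_{2n}(R,\Lambda)\mid[\sigma,EU_{2n}(R,\Lambda)]\subseteq U_{2n}((R,\Lambda),(I,\Gamma))\}$, i.e. all $\sigma$ such that $[\sigma,\varepsilon]\in U_{2n}((R,\Lambda),(I,\Gamma))$ for all $\varepsilon\in EU_{2n}(R,\Lambda)$. *)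

theory Defs
  imports
    "Jordan_Normal_Form.Matrix"
    "HOL-Algebra.Generated_Groups"
    "HOL-Algebra.Group_Action"
    "HOL-Computational_Algebra.Group_Closure"
    "HOL.Hull"
begin

section \<open>Form rings and form ideals\<close>

definition add_subgroup :: "'a::ring_1 set \<Rightarrow> bool" where
  "add_subgroup A \<longleftrightarrow> 0 \<in> A \<and> (\<forall>x\<in>A. \<forall>y\<in>A. x + y \<in> A) \<and> (\<forall>x\<in>A. - x \<in> A)"

definition two_sided_ideal :: "'a::ring_1 set \<Rightarrow> bool" where
  "two_sided_ideal I \<longleftrightarrow> add_subgroup I \<and> (\<forall>r. \<forall>x\<in>I. r * x \<in> I \<and> x * r \<in> I)"

definition involution :: "('a::ring_1 \<Rightarrow> 'a) \<Rightarrow> bool" where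
  "involution bar \<longleftrightarrow>
     (\<forall>x y. bar (x + y) = bar x + bar y) \<and>
     (\<forall>x y. bar (x * y) = bar y * bar x) \<and>
     (\<forall>x. bar (bar x) = x)"

definition Lam_min :: "('a::ring_1 \<Rightarrow> 'a) \<Rightarrow> 'a \<Rightarrow> 'a set" where
  "Lam_min bar lam = {x - lam * bar x | x. True}"

definition Lam_max :: "('a::ring_1 \<Rightarrow> 'a) \<Rightarrow> 'a \<Rightarrow> 'a set" where
  "Lam_max bar lam = {x. x = - (lam * bar x)}"

text \<open>The ring is the universe of the type; its involution, the central element
  \<open>lam\<close> and the form parameter are the remaining data of a form ring.\<close>

definition form_ring :: "('a::ring_1 \<Rightarrow> 'a) \<Rightarrow> 'a \<Rightarrow> 'a set \<Rightarrow> bool" where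
  "form_ring bar lam \<Lambda> \<longleftrightarrow>
     involution bar \<and>
     (\<forall>x. lam * x = x * lam) \<and> lam * bar lam = 1 \<and>
     add_subgroup \<Lambda> \<and> Lam_min bar lam \<subseteq> \<Lambda> \<and> \<Lambda> \<subseteq> Lam_max bar lam \<and>
     (\<forall>x. \<forall>y\<in>\<Lambda>. x * y * bar x \<in> \<Lambda>)"

definition Gam_max :: "'a::ring_1 set \<Rightarrow> 'a set \<Rightarrow> 'a set" where
  "Gam_max \<Lambda> I = I \<inter> \<Lambda>"

definition Gam_min :: "('a::ring_1 \<Rightarrow> 'a) \<Rightarrow> 'a \<Rightarrow> 'a set \<Rightarrow> 'a set \<Rightarrow> 'a set" where
  "Gam_min bar lam \<Lambda> I =
     {a + b | a b. a \<in> {x - lam * bar x | x. x \<in> I} \<and>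
                   b \<in> group_closure {x * y * bar x | x y. x \<in> I \<and> y \<in> \<Lambda>}}"

definition form_ideal ::
  "('a::ring_1 \<Rightarrow> 'a) \<Rightarrow> 'a \<Rightarrow> 'a set \<Rightarrow> 'a set \<Rightarrow> 'a set \<Rightarrow> bool" where
  "form_ideal bar lam \<Lambda> I \<Gamma> \<longleftrightarrow>
     two_sided_ideal I \<and> bar ` I = I \<and>
     add_subgroup \<Gamma> \<and> Gam_min bar lam \<Lambda> I \<subseteq> \<Gamma> \<and> \<Gamma> \<subseteq> Gam_max \<Lambda> I \<and>
     (\<forall>x. \<forall>y\<in>\<Gamma>. x * y * bar x \<in> \<Gamma>)"


section \<open>The hyperbolic unitary group\<close>

definition skew_one :: "nat \<Rightarrow> 'a::ring_1 mat" where
  "skew_one n = mat n n (\<lambda>(i, j). if i + j + 1 = n then 1 else 0)"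

definition form_f :: "nat \<Rightarrow> ('a::ring_1 \<Rightarrow> 'a) \<Rightarrow> 'a vec \<Rightarrow> 'a vec \<Rightarrow> 'a" where
  "form_f n bar v w =
     map_vec bar v \<bullet>
       (four_block_mat (0\<^sub>m n n) (skew_one n) (0\<^sub>m n n) (0\<^sub>m n n) *\<^sub>v w)"

definition form_h :: "nat \<Rightarrow> ('a::ring_1 \<Rightarrow> 'a) \<Rightarrow> 'a \<Rightarrow> 'a vec \<Rightarrow> 'a vec \<Rightarrow> 'a" where
  "form_h n bar lam v w =
     map_vec bar v \<bullet>
       (four_block_mat (0\<^sub>m n n) (skew_one n) (lam \<cdot>\<^sub>m skew_one n) (0\<^sub>m n n) *\<^sub>v w)"

text \<open>The value \<open>form_q n bar \<Lambda> v\<close> is a coset of \<open>\<Lambda>\<close>, an element of \<open>R/\<Lambda>\<close>.\<close>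

definition form_q :: "nat \<Rightarrow> ('a::ring_1 \<Rightarrow> 'a) \<Rightarrow> 'a set \<Rightarrow> 'a vec \<Rightarrow> 'a set" where
  "form_q n bar \<Lambda> v = {form_f n bar v v + a | a. a \<in> \<Lambda>}"

definition GL :: "nat \<Rightarrow> 'a::ring_1 mat monoid" where
  "GL m = units_of (ring_mat TYPE('a) m ())"

definition unitary_group ::
  "nat \<Rightarrow> ('a::ring_1 \<Rightarrow> 'a) \<Rightarrow> 'a \<Rightarrow> 'a set \<Rightarrow> 'a mat monoid" where
  "unitary_group n bar lam \<Lambda> = (GL (2 * n))
     \<lparr>carrier := {\<sigma> \<in> carrier (GL (2 * n)).
        (\<forall>u \<in> carrier_vec (2 * n). \<forall>v \<in> carrier_vec (2 * n).
           form_h n bar lam (\<sigma> *\<^sub>v u) (\<sigma> *\<^sub>v v) = form_h n bar lam u v) \<and>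
        (\<forall>v \<in> carrier_vec (2 * n). form_q n bar \<Lambda> (\<sigma> *\<^sub>v v) = form_q n bar \<Lambda> v)}\<rparr>"


section \<open>Elementary subgroups\<close>

definition Om :: "nat \<Rightarrow> int set" where
  "Om n = {1..int n} \<union> {- int n..-1}"

definition eps :: "int \<Rightarrow> int" where
  "eps i = (if i > 0 then 1 else - 1)"

text \<open>Indices from \<open>Om n\<close> are listed in the order \<open>1, \<dots>, n, -n, \<dots>, -1\<close>, while
  matrix positions are counted from \<open>0\<close>.\<close>

definition pos :: "nat \<Rightarrow> int \<Rightarrow> nat" where
  "pos n i = nat (if i > 0 then i - 1 else 2 * int n + i)"

definition mat_unit :: "nat \<Rightarrow> int \<Rightarrow> int \<Rightarrow> 'a::ring_1 mat" where
  "mat_unit n i j =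
     mat (2 * n) (2 * n) (\<lambda>(k, l). if k = pos n i \<and> l = pos n j then 1 else 0)"

text \<open>Integer powers of \<open>lam\<close>; in a form ring its inverse is \<open>bar lam\<close>.\<close>

definition lam_pow :: "('a::ring_1 \<Rightarrow> 'a) \<Rightarrow> 'a \<Rightarrow> int \<Rightarrow> 'a" where
  "lam_pow bar lam k = (if k \<ge> 0 then lam ^ nat k else bar lam ^ nat (- k))"

definition T_short ::
  "nat \<Rightarrow> ('a::ring_1 \<Rightarrow> 'a) \<Rightarrow> 'a \<Rightarrow> int \<Rightarrow> int \<Rightarrow> 'a \<Rightarrow> 'a mat" where
  "T_short n bar lam i j x =
     1\<^sub>m (2 * n) + x \<cdot>\<^sub>m mat_unit n i j
       - (lam_pow bar lam ((eps j - eps i) div 2) * bar x) \<cdot>\<^sub>m mat_unit n (- j) (- i)"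

definition T_long :: "nat \<Rightarrow> int \<Rightarrow> 'a::ring_1 \<Rightarrow> 'a mat" where
  "T_long n i y = 1\<^sub>m (2 * n) + y \<cdot>\<^sub>m mat_unit n i (- i)"

text \<open>The \<open>(I, \<Gamma>)\<close>-elementary transvections. All elementary transvections are
  obtained for \<open>I = UNIV\<close> and \<open>\<Gamma> = \<Lambda>\<close>.\<close>

definition elem_transvections ::
  "nat \<Rightarrow> ('a::ring_1 \<Rightarrow> 'a) \<Rightarrow> 'a \<Rightarrow> 'a set \<Rightarrow> 'a set \<Rightarrow> 'a mat set" where
  "elem_transvections n bar lam I \<Gamma> =
     {T_short n bar lam i j x | i j x.
        i \<in> Om n \<and> j \<in> Om n \<and> i \<noteq> j \<and> i \<noteq> - j \<and> x \<in> I} \<union>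
     {T_long n i y | i y.
        i \<in> Om n \<and> y \<in> (\<lambda>g. lam_pow bar lam (- ((eps i + 1) div 2)) * g) ` \<Gamma>}"

definition EU :: "nat \<Rightarrow> ('a::ring_1 \<Rightarrow> 'a) \<Rightarrow> 'a \<Rightarrow> 'a set \<Rightarrow> 'a mat set" where
  "EU n bar lam \<Lambda> =
     generate (unitary_group n bar lam \<Lambda>) (elem_transvections n bar lam UNIV \<Lambda>)"

definition EU_ideal ::
  "nat \<Rightarrow> ('a::ring_1 \<Rightarrow> 'a) \<Rightarrow> 'a \<Rightarrow> 'a set \<Rightarrow> 'a set \<Rightarrow> 'a set \<Rightarrow> 'a mat set" where
  "EU_ideal n bar lam \<Lambda> I \<Gamma> =
     generate (unitary_group n bar lam \<Lambda>) (elem_transvections n bar lam I \<Gamma>)"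

definition EU_rel ::
  "nat \<Rightarrow> ('a::ring_1 \<Rightarrow> 'a) \<Rightarrow> 'a \<Rightarrow> 'a set \<Rightarrow> 'a set \<Rightarrow> 'a set \<Rightarrow> 'a mat set" where
  "EU_rel n bar lam \<Lambda> I \<Gamma> =
     (\<lambda>N. N \<lhd> (unitary_group n bar lam \<Lambda>)\<lparr>carrier := EU n bar lam \<Lambda>\<rparr>)
       hull EU_ideal n bar lam \<Lambda> I \<Gamma>"


section \<open>Congruence subgroups\<close>

definition U_cong ::
  "nat \<Rightarrow> ('a::ring_1 \<Rightarrow> 'a) \<Rightarrow> 'a \<Rightarrow> 'a set \<Rightarrow> 'a set \<Rightarrow> 'a set \<Rightarrow> 'a mat set" where
  "U_cong n bar lam \<Lambda> I \<Gamma> =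
     {\<sigma> \<in> carrier (unitary_group n bar lam \<Lambda>).
        (\<forall>k < 2 * n. \<forall>l < 2 * n. (\<sigma> - 1\<^sub>m (2 * n)) $$ (k, l) \<in> I) \<and>
        (\<forall>v \<in> carrier_vec (2 * n).
           form_f n bar (\<sigma> *\<^sub>v v) (\<sigma> *\<^sub>v v) - form_f n bar v v \<in> \<Gamma>)}"

definition group_commutator :: "('g, 'b) monoid_scheme \<Rightarrow> 'g \<Rightarrow> 'g \<Rightarrow> 'g" where
  "group_commutator G g h = g \<otimes>\<^bsub>G\<^esub> h \<otimes>\<^bsub>G\<^esub> inv\<^bsub>G\<^esub> g \<otimes>\<^bsub>G\<^esub> inv\<^bsub>G\<^esub> h"

definition CU ::
  "nat \<Rightarrow> ('a::ring_1 \<Rightarrow> 'a) \<Rightarrow> 'a \<Rightarrow> 'a set \<Rightarrow> 'a set \<Rightarrow> 'a set \<Rightarrow> 'a mat set" where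
  "CU n bar lam \<Lambda> I \<Gamma> =
     {\<sigma> \<in> carrier (unitary_group n bar lam \<Lambda>).
        \<forall>\<epsilon> \<in> EU n bar lam \<Lambda>.
          group_commutator (unitary_group n bar lam \<Lambda>) \<sigma> \<epsilon> \<in> U_cong n bar lam \<Lambda> I \<Gamma>}"

end

theory Submission
  imports Defs "HOL-Library.Function_Algebras"
begin

text \<open>For \<open>u\<close> isotropic and orthogonal to \<open>v\<close>, let \<open>T(u,v,b)\<close> be the transvection
  \<open>w \<mapsto> w + u h(v,w) - bar(lam) (v + u b) h(u,w)\<close>; unitary maps satisfy
  \<open>g T(u,v,b) g^-1 = T(gu,gv,b)\<close>, and both kinds of root elements have this form.

  Let \<open>N\<close> be a group normalized by the elementary group and containing the
  \<open>(I,\<Gamma>)\<close>-elementary transvections, and let \<open>u\<close> be a column of a unitary map. The Koszul vectors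
  \<open>x_kl = phi_l e_k - phi_k e_l\<close>, where \<open>phi_k = h(u,e_k)\<close>, span the orthogonal complement of \<open>u\<close>,
  and the transvections along vectors with two nonzero coordinates are products of elementary ones.
  As the \<open>phi_k\<close> generate the unit ideal, it follows that \<open>T(u,y,b) \<in> N\<close> for every \<open>y\<close> with
  entries in \<open>I\<close> that is orthogonal to \<open>u\<close> and every \<open>b\<close> with \<open>b - f(y,y) \<in> \<Gamma>\<close>.
  Consequently \<open>[\<sigma>,EU] \<subseteq> N\<close> as soon as \<open>\<sigma>\<close> is scalar modulo \<open>I\<close>, \<open>f\<close> takes values in \<open>\<Gamma>\<close>
  on the columns of \<open>\<sigma>\<close>, and \<open>b \<mapsto> d b bar(d)\<close> is trivial on \<open>\<Lambda>/\<Gamma>\<close> for each diagonal entry \<open>d\<close>.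
  These conditions characterize the full congruence subgroup, so every group in the sandwich is
  normalized by \<open>EU\<close>.

  Conversely, let \<open>H\<close> be normalized by \<open>EU\<close>, and let \<open>I\<close> and \<open>\<Gamma>\<close> consist of the parameters of
  the elementary transvections in \<open>H\<close>. For \<open>\<sigma> \<in> H\<close> and an elementary \<open>\<tau>\<close> fixing the column
  \<open>\<sigma> e_i\<close>, the map \<open>\<eta> = \<sigma>^-1 \<tau> \<sigma>\<close> fixes \<open>e_i\<close> and is congruent to \<open>\<tau>\<close> modulo \<open>H\<close>, whence
  \<open>T(e_i, \<eta> z, b)\<close> and \<open>T(\<tau> e_i, \<tau> z, b)\<close> agree modulo \<open>H\<close>. Taking for \<open>\<tau>\<close> transvections along
  Koszul vectors shows that \<open>\<sigma>\<close> is scalar modulo \<open>I\<close>; correcting \<open>\<sigma>\<close> by long root elements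
  that move two of its columns into the zero locus of \<open>f\<close> modulo \<open>\<Gamma>\<close> gives the remaining
  conditions.\<close>

section \<open>Transvections\<close>

text \<open>No entry of a column is ever inverted in R and nothing is localized: a claim is shown
  after multiplication by certain scalars, the scalars that work form an ideal, and unimodularity of
  a column puts 1 into it. Two obstacles shape the arguments. The diagonal entries d of a map that
  is scalar modulo I are units only modulo I, so the norm q = d bar(d) remains in the long root
  parameters; there q^2 acts trivially on \<Lambda>/\<Gamma> but q need not. The congruence results
  are proved for an abstract N and used for three groups: the image of H, the image of the relative
  elementary group, and the group \<open>UC\<close> of elementary maps satisfying the congruence
  conditions. The last one yields membership in \<open>EE\<close>, and at level (R, \<Lambda>) it
  turns relative statements into absolute ones.\<close>

definition scl :: "'a::comm_ring_1 \<Rightarrow> ('b \<Rightarrow> 'a) \<Rightarrow> 'b \<Rightarrow> 'a" where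
  "scl s v = (\<lambda>k. s * v k)"

definition bas :: "int \<Rightarrow> int \<Rightarrow> 'a::comm_ring_1" where
  "bas i = (\<lambda>k. if k = i then 1 else 0)"

lemma scl_apply [simp]: "scl s v k = s * v k"
  by (simp add: scl_def)

lemma scl_simps [simp]: "scl 1 v = v" "scl 0 v = 0" "scl s 0 = 0" "scl s (scl t v) = scl (s * t) v"
  by (auto simp: fun_eq_iff algebra_simps)

lemma scl_add: "scl (s + t) v = scl s v + scl t v"
  and scl_minus: "scl (- s) v = - scl s v"
  and scl_diff: "scl (s - t) v = scl s v - scl t v"
  and scl_add_right: "scl s (v + w) = scl s v + scl s w"
  and scl_diff_right: "scl s (v - w) = scl s v - scl s w"
  by (auto simp: fun_eq_iff algebra_simps)

lemma bas_apply: "bas i k = (if k = i then 1 else 0)"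
  by (simp add: bas_def)

lemma finite_Om [simp]: "finite (Om n)"
  by (simp add: Om_def)

lemma Om_uminus [simp]: "- i \<in> Om n \<longleftrightarrow> i \<in> Om n"
  by (auto simp: Om_def)

lemma Om_nonzero: "i \<in> Om n \<Longrightarrow> i \<noteq> 0"
  by (auto simp: Om_def)

lemma Om_neq_minus: "i \<in> Om n \<Longrightarrow> i \<noteq> - i"
  by (auto simp: Om_def)

locale hyperbolic =
  fixes n :: nat and bar :: "'a::comm_ring_1 \<Rightarrow> 'a" and lam :: 'a and \<Lambda> :: "'a set"
  assumes n3: "n \<ge> 3" and form_ring: "form_ring bar lam \<Lambda>"
begin

lemma bar_add [simp]: "bar (x + y) = bar x + bar y"
  and bar_mult [simp]: "bar (x * y) = bar x * bar y"
  and bar_bar [simp]: "bar (bar x) = x"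
  using form_ring by (auto simp: form_ring_def involution_def mult.commute)

lemma bar_0 [simp]: "bar 0 = 0"
  using bar_add[of 0 0] by simp

lemma bar_1 [simp]: "bar 1 = 1"
  using bar_mult[of "bar 1" 1] by simp

lemma bar_minus [simp]: "bar (- x) = - bar x"
  using bar_add[of x "- x"] by (simp add: eq_neg_iff_add_eq_0 add.commute)

lemma bar_diff [simp]: "bar (x - y) = bar x - bar y"
  using bar_add[of x "- y"] by simp

lemma bar_sum: "bar (sum g A) = (\<Sum>k\<in>A. bar (g k))"
  by (induction A rule: infinite_finite_induct) auto

lemma lam_bar [simp]: "lam * bar lam = 1" "bar lam * lam = 1"
  using form_ring by (auto simp: form_ring_def mult.commute)

lemma lam_bar_left [simp]: "lam * (bar lam * x) = x" "bar lam * (lam * x) = x"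
  by (simp_all flip: mult.assoc)

text \<open>\<open>th i\<close> is the value \<open>h(e_i, e_-i)\<close>.\<close>

definition th :: "int \<Rightarrow> 'a" where
  "th i = (if i > 0 then 1 else lam)"

lemma th_bar [simp]: "th i * bar (th i) = 1" "bar (th i) * th i = 1"
  by (auto simp: th_def)

lemma th_bar_left [simp]: "th i * (bar (th i) * x) = x" "bar (th i) * (th i * x) = x"
  by (simp_all flip: mult.assoc)

definition ff :: "(int \<Rightarrow> 'a) \<Rightarrow> (int \<Rightarrow> 'a) \<Rightarrow> 'a" where
  "ff v w = (\<Sum>k = 1..int n. bar (v k) * w (- k))"

definition hh :: "(int \<Rightarrow> 'a) \<Rightarrow> (int \<Rightarrow> 'a) \<Rightarrow> 'a" where
  "hh v w = ff v w + lam * bar (ff w v)"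

lemma ff_lin [simp]:
  "ff (v + v') w = ff v w + ff v' w" "ff v (w + w') = ff v w + ff v w'"
  "ff (scl s v) w = bar s * ff v w" "ff v (scl s w) = s * ff v w"
  "ff (- v) w = - ff v w" "ff v (- w) = - ff v w"
  "ff (v - v') w = ff v w - ff v' w" "ff v (w - w') = ff v w - ff v w'"
  "ff 0 w = 0" "ff v 0 = 0"
  by (simp_all add: ff_def sum.distrib sum_subtractf sum_negf sum_distrib_left algebra_simps)

lemma hh_lin [simp]:
  "hh (v + v') w = hh v w + hh v' w" "hh v (w + w') = hh v w + hh v w'"
  "hh (scl s v) w = bar s * hh v w" "hh v (scl s w) = s * hh v w"
  "hh (- v) w = - hh v w" "hh v (- w) = - hh v w"
  "hh (v - v') w = hh v w - hh v' w" "hh v (w - w') = hh v w - hh v w'"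
  "hh 0 w = 0" "hh v 0 = 0"
  by (simp_all add: hh_def algebra_simps)

lemma hh_swap: "hh v w = lam * bar (hh w v)"
  by (simp add: hh_def algebra_simps)

lemma hh_zero_swap: "hh v w = 0 \<Longrightarrow> hh w v = 0"
  using hh_swap[of w v] by simp

lemma ff_bas_left: "ff (bas i) w = (if i \<in> {1..int n} then w (- i) else 0)"
  by (simp add: ff_def bas_def if_distrib[of bar] if_distrib[of "\<lambda>x. x * _"] cong: if_cong)

lemma ff_bas_right: "ff v (bas i) = (if - i \<in> {1..int n} then bar (v (- i)) else 0)"
proof -
  have "ff v (bas i) = (\<Sum>k = 1..int n. if k = - i then bar (v k) else 0)"
    unfolding ff_def by (rule sum.cong) (auto simp: bas_def)
  then show ?thesis by simp
qed

lemma hh_bas_left: "i \<in> Om n \<Longrightarrow> hh (bas i) w = th i * w (- i)"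
  by (auto simp: hh_def ff_bas_left ff_bas_right th_def Om_def)

lemma hh_bas_right: "i \<in> Om n \<Longrightarrow> hh w (bas i) = th (- i) * bar (w (- i))"
  by (auto simp: hh_def ff_bas_left ff_bas_right th_def Om_def)

text \<open>\<open>T (bas i) (scl s (bas k)) 0\<close> is a short root element and \<open>T (bas i) 0 b\<close> a long root element.\<close>

definition T :: "(int \<Rightarrow> 'a) \<Rightarrow> (int \<Rightarrow> 'a) \<Rightarrow> 'a \<Rightarrow> (int \<Rightarrow> 'a) \<Rightarrow> int \<Rightarrow> 'a" where
  "T u v b w = w + scl (hh v w) u - scl (bar lam * hh u w) (v + scl b u)"

lemma T_comp:
  assumes "hh u u = 0" "hh u v = 0" "hh u v' = 0"
  shows "T u v b \<circ> T u v' b' = T u (v + v') (b + b' + hh v v')"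
  using assms hh_zero_swap[OF assms(2)] hh_zero_swap[OF assms(3)]
  by (auto simp: fun_eq_iff T_def algebra_simps)

lemma T_id [simp]: "T 0 u b = id" "T u 0 0 = id"
  by (auto simp: fun_eq_iff T_def)

text \<open>Lets a transvection along a complicated \<open>u\<close> with a simple \<open>v\<close>
  be treated as one along \<open>v\<close>.\<close>

lemma T_sym: "T u v 0 = T v (scl (- lam) u) 0"
  by (auto simp: fun_eq_iff T_def algebra_simps)

lemma T_scale: "T (scl s u) v b = T u (scl (bar s) v) (s * bar s * b)"
  by (auto simp: fun_eq_iff T_def algebra_simps)

lemma T_self: "hh u u = 0 \<Longrightarrow> T u (v + scl s u) b = T u v (b + s - lam * bar s)"
  by (auto simp: fun_eq_iff T_def algebra_simps)

text \<open>The factor \<open>T p (scl b q) 0\<close> collects the cross terms between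
  \<open>p\<close> and \<open>q\<close> that the scalar \<open>b\<close> produces. The relation on
  \<open>b\<close>, which says that the transvection preserves h, expresses bar(b) through
  \<open>b\<close> and so matches both halves of these cross terms.\<close>

lemma T_split:
  assumes "hh p p = 0" "hh q q = 0" "hh p q = 0" "hh p v = 0" "hh q v = 0"
    and "b + lam * bar b = hh v v"
  shows "T (p + q) v b = T p v b \<circ> T q v b \<circ> T p (scl b q) 0"
proof -
  have *: "bar b = bar lam * (hh v v - b)"
    by (simp flip: assms(6))
  show ?thesis
    using assms(1-5) hh_zero_swap[OF assms(3)] hh_zero_swap[OF assms(4)] hh_zero_swap[OF assms(5)]
    by (auto simp: fun_eq_iff T_def algebra_simps *)
qed

end

section \<open>Form parameters and unitary maps\<close>

context hyperbolic
begin

definition skew :: "'a \<Rightarrow> 'a" where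
  "skew c = c - lam * bar c"

lemma skew_add: "skew (c + d) = skew c + skew d"
  and skew_diff: "skew (c - d) = skew c - skew d"
  and skew_0 [simp]: "skew 0 = 0"
  by (auto simp: skew_def algebra_simps)

lemma form_ideal_UNIV: "form_ideal bar lam \<Lambda> UNIV \<Lambda>"
proof -
  have L: "0 \<in> \<Lambda>" "\<And>x y. x \<in> \<Lambda> \<Longrightarrow> y \<in> \<Lambda> \<Longrightarrow> x + y \<in> \<Lambda>" "\<And>x. x \<in> \<Lambda> \<Longrightarrow> - x \<in> \<Lambda>"
    "\<And>x. x - lam * bar x \<in> \<Lambda>" "\<And>x y. y \<in> \<Lambda> \<Longrightarrow> x * y * bar x \<in> \<Lambda>"
    using form_ring by (auto simp: form_ring_def add_subgroup_def Lam_min_def)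
  have "b \<in> \<Lambda>" if "b \<in> group_closure {x * y * bar x | x y. x \<in> UNIV \<and> y \<in> \<Lambda>}" for b
    using that
  proof (induction rule: group_closure.induct)
    case (diff s t)
    then show ?case using L(2)[of s "- t"] L(3) by simp
  qed (use L in auto)
  then have "Gam_min bar lam \<Lambda> UNIV \<subseteq> \<Lambda>"
    using L unfolding Gam_min_def by blast
  moreover have "bar ` UNIV = UNIV"
    by (metis bar_bar surjI)
  ultimately show ?thesis
    using L by (auto simp: form_ideal_def two_sided_ideal_def add_subgroup_def Gam_max_def)
qed

lemma Lam_skew: "x \<in> \<Lambda> \<Longrightarrow> lam * bar x = - x"
  using form_ring unfolding form_ring_def Lam_max_def by (metis (mono_tags, lifting) equation_minus_iff mem_Collect_eq subsetD)

lemma lam_cancel: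
  "lam * (x * bar lam) = x" "lam * (x * (bar lam * y)) = x * y"
  "lam * (x * (y * bar lam)) = x * y" "lam * (x * (y * (bar lam * z))) = x * (y * z)"
  by (simp_all add: mult.left_commute[of _ "bar lam"] mult.commute[of _ "bar lam"])

text \<open>Vectors are functions on all integers, but the forms only see the coordinates in \<open>Om n\<close>.\<close>

definition VV :: "(int \<Rightarrow> 'a) set" where
  "VV = {v. \<forall>k. k \<notin> Om n \<longrightarrow> v k = 0}"

lemma VV_simps [simp]:
  "v \<in> VV \<Longrightarrow> w \<in> VV \<Longrightarrow> v + w \<in> VV" "v \<in> VV \<Longrightarrow> w \<in> VV \<Longrightarrow> v - w \<in> VV"
  "v \<in> VV \<Longrightarrow> - v \<in> VV" "v \<in> VV \<Longrightarrow> scl s v \<in> VV" "0 \<in> VV" "i \<in> Om n \<Longrightarrow> bas i \<in> VV"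
  by (auto simp: VV_def bas_apply)

lemma hh_self_0: "ff u u \<in> \<Lambda> \<Longrightarrow> hh u u = 0"
  by (simp add: hh_def Lam_skew)

lemma hh_self: "b - ff v v \<in> \<Lambda> \<Longrightarrow> b + lam * bar b = hh v v"
  using Lam_skew[of "b - ff v v"] by (simp add: hh_def algebra_simps)

lemma ff_swap_add: "ff w v = hh w v - lam * bar (ff v w)"
  by (simp add: hh_def)

text \<open>The change of f is sorted so that each summand is either a value of \<open>skew\<close>
  or a conjugate r x bar(r), with x in \<Lambda> once \<open>ff u u\<close> is. When the arguments
  of \<open>skew\<close> and the conjugating factors lie in an ideal I, the whole change therefore
  lies in \<Gamma>.\<close>

lemma ff_T:
  assumes "hh u u = 0" "hh u v = 0" "b - ff v v \<in> \<Lambda>"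
  defines "P \<equiv> \<lambda>w. hh v w" and "Q \<equiv> \<lambda>w. hh u w"
  defines "A \<equiv> \<lambda>w. P w - bar lam * b * Q w"
  shows "ff (T u v b w) (T u v b w) - ff w w =
    skew (ff w (scl (A w) u - scl (bar lam * Q w) v))
    + skew (ff (scl (- (bar lam * Q w)) v) (scl (A w) u)) + skew (bar (P w) * Q w)
    + A w * ff u u * bar (A w) + Q w * (skew (ff v v) + (b - ff v v)) * bar (Q w)"
proof -
  define d where "d = scl (A w) u - scl (bar lam * Q w) v"
  have Tw: "T u v b w = w + d"
    by (auto simp: fun_eq_iff T_def d_def A_def P_def Q_def algebra_simps)
  have vu: "hh v u = 0" using hh_zero_swap assms(2) by simp
  have lb: "lam * bar b = hh v v - b" using hh_self[OF assms(3)] by (simp add: algebra_simps)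
  have hdw: "hh d w = bar (A w) * Q w - lam * bar (Q w) * P w"
    by (simp add: d_def P_def Q_def)
  have fd: "ff d d = A w * bar (A w) * ff u u + Q w * bar (Q w) * ff v v
      + skew (ff (scl (- (bar lam * Q w)) v) (scl (A w) u))"
  proof -
    have "ff u v = - lam * bar (ff v u)"
      using ff_swap_add[of u v] assms(2) by simp
    then show ?thesis
      by (simp add: d_def skew_def algebra_simps lam_cancel)
  qed
  have dw: "ff d w = hh d w - lam * bar (ff w d)" by (rule ff_swap_add)
  have "ff (w + d) (w + d) - ff w w = skew (ff w d) + hh d w + ff d d"
    by (simp add: dw skew_def)
  moreover have "hh d w = skew (bar (P w) * Q w) - lam * bar b * (Q w * bar (Q w))"
    by (simp add: hdw A_def skew_def algebra_simps)
  moreover have sk: "skew (ff v v) + (b - ff v v) = ff v v - lam * bar b"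
    unfolding lb by (simp add: hh_def skew_def)
  ultimately show ?thesis
    unfolding Tw fd d_def[symmetric] sk by (simp add: algebra_simps del: ff_lin)
qed

text \<open>Invertibility is left to other sources: \<open>EE_inv\<close>, \<open>N_inv\<close>, or
  a right inverse as in \<open>cu_good\<close>.\<close>

definition uni :: "((int \<Rightarrow> 'a) \<Rightarrow> (int \<Rightarrow> 'a)) \<Rightarrow> bool" where
  "uni g \<longleftrightarrow> (\<forall>v w. g (v + w) = g v + g w) \<and> (\<forall>s v. g (scl s v) = scl s (g v)) \<and>
     (\<forall>v w. hh (g v) (g w) = hh v w) \<and> (\<forall>v. ff (g v) (g v) - ff v v \<in> \<Lambda>) \<and> (\<forall>v\<in>VV. g v \<in> VV)"

lemma uniD:
  assumes "uni g"
  shows "g (v + w) = g v + g w" "g (scl s v) = scl s (g v)" "hh (g v) (g w) = hh v w"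
    "ff (g v) (g v) - ff v v \<in> \<Lambda>" "v \<in> VV \<Longrightarrow> g v \<in> VV"
    "g (- v) = - g v" "g (v - w) = g v - g w" "g 0 = 0"
proof -
  show add: "g (v + w) = g v + g w" and scl: "g (scl s v) = scl s (g v)" for v w s
    using assms by (auto simp: uni_def)
  show minus: "g (- v) = - g v" for v using scl[of "- 1" v] by (simp add: scl_minus)
  show "g (v - w) = g v - g w" using add[of v "- w"] minus[of w] by simp
  show "g 0 = 0" using scl[of 0 0] by simp
qed (use assms in \<open>auto simp: uni_def\<close>)

lemma T_conj: "uni g \<Longrightarrow> g \<circ> T u v b = T (g u) (g v) b \<circ> g"
  by (auto simp: fun_eq_iff T_def uniD)

end

section \<open>Arithmetic of a form ideal\<close>

locale level = hyperbolic +
  fixes I \<Gamma> assumes form_ideal: "form_ideal bar lam \<Lambda> I \<Gamma>"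
begin

lemma I_add: "x \<in> I \<Longrightarrow> y \<in> I \<Longrightarrow> x + y \<in> I"
  and I_minus: "x \<in> I \<Longrightarrow> - x \<in> I"
  and I_0 [simp]: "0 \<in> I"
  and I_mult: "x \<in> I \<Longrightarrow> r * x \<in> I" "x \<in> I \<Longrightarrow> x * r \<in> I"
  and I_bar: "x \<in> I \<Longrightarrow> bar x \<in> I"
  using form_ideal by (auto simp: form_ideal_def two_sided_ideal_def add_subgroup_def)

lemma I_diff: "x \<in> I \<Longrightarrow> y \<in> I \<Longrightarrow> x - y \<in> I"
  using I_add[of x "- y"] I_minus by simp

lemma I_sum: "(\<And>k. k \<in> A \<Longrightarrow> g k \<in> I) \<Longrightarrow> sum g A \<in> I"
  by (induction A rule: infinite_finite_induct) (auto intro: I_add)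

lemma Gam_add: "x \<in> \<Gamma> \<Longrightarrow> y \<in> \<Gamma> \<Longrightarrow> x + y \<in> \<Gamma>"
  and Gam_minus: "x \<in> \<Gamma> \<Longrightarrow> - x \<in> \<Gamma>"
  and Gam_0 [simp]: "0 \<in> \<Gamma>"
  and Gam_I: "x \<in> \<Gamma> \<Longrightarrow> x \<in> I"
  and Gam_Lam: "x \<in> \<Gamma> \<Longrightarrow> x \<in> \<Lambda>"
  and Gam_conj: "x \<in> \<Gamma> \<Longrightarrow> r * x * bar r \<in> \<Gamma>"
  using form_ideal by (auto simp: form_ideal_def add_subgroup_def Gam_max_def)

lemma Gam_diff: "x \<in> \<Gamma> \<Longrightarrow> y \<in> \<Gamma> \<Longrightarrow> x - y \<in> \<Gamma>"
  using Gam_add[of x "- y"] Gam_minus by simp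

lemma Gam_min_subset: "Gam_min bar lam \<Lambda> I \<subseteq> \<Gamma>"
  using form_ideal by (simp add: form_ideal_def)

lemma Gam_skew:
  assumes "c \<in> I" shows "skew c \<in> \<Gamma>"
proof -
  have "skew c + 0 \<in> Gam_min bar lam \<Lambda> I"
    unfolding Gam_min_def skew_def using assms by (blast intro: zero_in_group_closure)
  then show ?thesis using Gam_min_subset by auto
qed

lemma Gam_I_conj:
  assumes "r \<in> I" "x \<in> \<Lambda>" shows "r * x * bar r \<in> \<Gamma>"
proof -
  have "0 - lam * bar 0 + r * x * bar r \<in> Gam_min bar lam \<Lambda> I"
    unfolding Gam_min_def using assms I_0 by (blast intro: group_closure.base)
  then show ?thesis using Gam_min_subset by auto
qed

lemma ff_in_I: "(\<And>k. w k \<in> I) \<Longrightarrow> ff v w \<in> I" "(\<And>k. w k \<in> I) \<Longrightarrow> ff w v \<in> I"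
  by (auto simp: ff_def intro!: I_sum intro: I_mult I_bar)

lemma hh_in_I: "(\<And>k. w k \<in> I) \<Longrightarrow> hh v w \<in> I" "(\<And>k. w k \<in> I) \<Longrightarrow> hh w v \<in> I"
  by (auto simp: hh_def intro!: I_add intro: ff_in_I I_mult I_bar)

lemma T_I: 
  assumes "\<And>k. y k \<in> I" shows "T u v b y k \<in> I"
  using assms by (auto simp: T_def intro!: I_add I_diff intro: I_mult hh_in_I)

text \<open>The arguments of \<open>skew\<close> and the conjugating factors in \<open>ff_T\<close>
  are built from values of h and f at \<open>w\<close>, hence lie in I. The closure properties of
  \<Lambda> are hypotheses because they are read off only below, from the instance (R,
  \<Lambda>).\<close>

lemma ff_T_small:
  assumes "ff u u \<in> \<Lambda>" "hh u v = 0" "b - ff v v \<in> \<Lambda>" "\<And>k. w k \<in> I"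
    and L: "\<And>c. skew c \<in> \<Lambda>" "\<And>x y. x \<in> \<Lambda> \<Longrightarrow> y \<in> \<Lambda> \<Longrightarrow> x + y \<in> \<Lambda>"
  shows "ff (T u v b w) (T u v b w) - ff w w \<in> \<Gamma>"
proof -
  have P: "hh x w \<in> I" for x using assms(4) by (rule hh_in_I)
  have F: "ff w x \<in> I" for x using assms(4) by (rule ff_in_I)
  define a where "a = hh v w - bar lam * b * hh u w"
  have a: "a \<in> I" unfolding a_def using P by (intro I_diff I_mult)
  have "skew (ff v v) + (b - ff v v) \<in> \<Lambda>" using assms by blast
  moreover have "ff (scl (- (bar lam * hh u w)) v) (scl a u) \<in> I"
    using a by (auto intro: I_mult I_minus)
  moreover have "bar (hh v w) * hh u w \<in> I" using P by (intro I_mult)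
  ultimately show ?thesis
    unfolding ff_T[OF hh_self_0[OF assms(1)] assms(2,3)] a_def[symmetric]
    using a P assms(1) F by (intro Gam_add Gam_skew Gam_I_conj)
qed

end

text \<open>At level (R, \<Lambda>) congruence of vectors is void, so every relative result has an
  absolute one as a special case.\<close>

sublocale hyperbolic \<subseteq> top: level n bar lam \<Lambda> UNIV \<Lambda>
  by unfold_locales (rule form_ideal_UNIV)

context hyperbolic
begin

lemmas Lam_add = top.Gam_add and Lam_minus = top.Gam_minus and Lam_0 [simp] = top.Gam_0
  and Lam_conj = top.Gam_conj and Lam_diff = top.Gam_diff

lemma Lam_skewI [simp]: "skew c \<in> \<Lambda>"
  using top.Gam_skew by simp

lemma T_uni:
  assumes "u \<in> VV" "v \<in> VV" "ff u u \<in> \<Lambda>" "hh u v = 0" "b - ff v v \<in> \<Lambda>"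
  shows "uni (T u v b)"
proof -
  have b: "b = hh v v - lam * bar b" using hh_self[OF assms(5)] by (simp add: algebra_simps)
  have uu: "hh u u = 0" using assms(3) by (rule hh_self_0)
  have vu: "hh v u = 0" using assms(4) by (rule hh_zero_swap)
  have "hh (T u v b x) (T u v b y) = hh x y" for x y
  proof -
    have x: "hh x u = lam * bar (hh u x)" "hh x v = lam * bar (hh v x)"
      by (rule hh_swap)+
    have "hh (T u v b x) (T u v b y) = hh x y + bar (hh u x) * hh u y * (hh v v - b - lam * bar b)"
      by (simp add: T_def uu vu assms(4) x algebra_simps)
    moreover have "hh v v - b - lam * bar b = 0" using b by (simp add: algebra_simps)
    ultimately show ?thesis by simp
  qed
  moreover have "ff (T u v b x) (T u v b x) - ff x x \<in> \<Lambda>" for x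
    using top.ff_T_small[OF assms(3-5)] top.Gam_skew top.Gam_add by auto
  ultimately show ?thesis
    using assms(1,2) by (auto simp: uni_def T_def scl_add_right scl_diff_right scl_add scl_diff algebra_simps)
qed

lemma uni_comp: "uni g \<Longrightarrow> uni g' \<Longrightarrow> uni (g \<circ> g')"
  unfolding uni_def using Lam_add[of "ff (g (g' v)) (g (g' v)) - ff (g' v) (g' v)" "ff (g' v) (g' v) - ff v v" for v]
  by auto

lemma uni_id: "uni id"
  by (simp add: uni_def)

text \<open>The elementary group as a set of maps, see \<open>act_EU\<close> and
  \<open>EE_act\<close>. Left multiplication by generators suffices, since a generator is inverted
  by negating its parameter.\<close>

inductive_set EE :: "((int \<Rightarrow> 'a) \<Rightarrow> (int \<Rightarrow> 'a)) set" where
  EE_id: "id \<in> EE"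
| EE_short: "g \<in> EE \<Longrightarrow> i \<in> Om n \<Longrightarrow> k \<in> Om n \<Longrightarrow> k \<noteq> i \<Longrightarrow> k \<noteq> - i \<Longrightarrow>
    T (bas i) (scl s (bas k)) 0 \<circ> g \<in> EE"
| EE_long: "g \<in> EE \<Longrightarrow> i \<in> Om n \<Longrightarrow> b \<in> \<Lambda> \<Longrightarrow> T (bas i) 0 b \<circ> g \<in> EE"

lemma EE_short1: "i \<in> Om n \<Longrightarrow> k \<in> Om n \<Longrightarrow> k \<noteq> i \<Longrightarrow> k \<noteq> - i \<Longrightarrow>
    T (bas i) (scl s (bas k)) 0 \<in> EE"
  using EE_short[OF EE_id] by simp

lemma EE_long1: "i \<in> Om n \<Longrightarrow> b \<in> \<Lambda> \<Longrightarrow> T (bas i) 0 b \<in> EE"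
  using EE_long[OF EE_id] by simp

lemma EE_comp: "g \<in> EE \<Longrightarrow> g' \<in> EE \<Longrightarrow> g \<circ> g' \<in> EE"
  by (induction g rule: EE.induct) (auto simp: comp_assoc intro: EE.intros)

lemma ff_bas_self [simp]: "ff (bas i) (bas i) = 0"
  by (simp add: ff_bas_left bas_apply)

lemma hh_bas_self [simp]: "hh (bas i) (bas i) = 0"
  by (simp add: hh_def)

lemma hh_bas_bas: "i \<in> Om n \<Longrightarrow> hh (bas i) (bas k) = (if k = - i then th i else 0)"
  by (auto simp: hh_bas_left bas_apply)

lemma ff_scl_bas [simp]: "ff (scl s (bas i)) (scl t (bas i)) = 0"
  by simp

lemma EE_uni: "g \<in> EE \<Longrightarrow> uni g"
proof (induction rule: EE.induct)
  case (EE_short g i k s)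
  then have "uni (T (bas i) (scl s (bas k)) 0)" by (intro T_uni) (simp_all add: hh_bas_bas)
  then show ?case using EE_short uni_comp by blast
next
  case (EE_long g i b)
  then have "uni (T (bas i) 0 b)" by (intro T_uni) simp_all
  then show ?case using EE_long uni_comp by blast
qed (rule uni_id)

lemma EE_inv: "g \<in> EE \<Longrightarrow> \<exists>g'\<in>EE. g' \<circ> g = id \<and> g \<circ> g' = id"
proof (induction rule: EE.induct)
  case EE_id
  then show ?case by (intro bexI[of _ id] EE.EE_id) simp
next
  case (EE_short g i k s)
  then obtain g' where g': "g' \<in> EE" "g' \<circ> g = id" "g \<circ> g' = id" by blast
  let ?t = "T (bas i) (scl s (bas k)) 0" and ?t' = "T (bas i) (scl (- s) (bas k)) 0"
  have t: "?t' \<circ> ?t = id" "?t \<circ> ?t' = id"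
    using EE_short by (simp_all add: T_comp hh_bas_bas flip: scl_add)
  have "g' \<circ> ?t' \<in> EE" using g' EE_short by (auto intro: EE_comp EE_short1)
  moreover have "(g' \<circ> ?t') \<circ> (?t \<circ> g) = g' \<circ> (?t' \<circ> ?t) \<circ> g"
    "(?t \<circ> g) \<circ> (g' \<circ> ?t') = ?t \<circ> (g \<circ> g') \<circ> ?t'" by (simp_all add: comp_assoc)
  ultimately show ?case using t g'(2,3) by (metis comp_id)
next
  case (EE_long g i b)
  then obtain g' where g': "g' \<in> EE" "g' \<circ> g = id" "g \<circ> g' = id" by blast
  let ?t = "T (bas i) 0 b" and ?t' = "T (bas i) 0 (- b)"
  have t: "?t' \<circ> ?t = id" "?t \<circ> ?t' = id"
    using EE_long by (simp_all add: T_comp)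
  have "g' \<circ> ?t' \<in> EE" using g' EE_long by (auto intro: EE_comp EE_long1 Lam_minus)
  moreover have "(g' \<circ> ?t') \<circ> (?t \<circ> g) = g' \<circ> (?t' \<circ> ?t) \<circ> g"
    "(?t \<circ> g) \<circ> (g' \<circ> ?t') = ?t \<circ> (g \<circ> g') \<circ> ?t'" by (simp_all add: comp_assoc)
  ultimately show ?case using t g'(2,3) by (metis comp_id)
qed

end

section \<open>Congruence modulo a normalized group\<close>

text \<open>\<open>N\<close> need not be contained in \<open>EE\<close>: it will be the image of an arbitrary group normalized by \<open>EU\<close>.\<close>

locale normalized = hyperbolic +
  fixes N :: "((int \<Rightarrow> 'a) \<Rightarrow> (int \<Rightarrow> 'a)) set"
  assumes N_id: "id \<in> N"
    and N_comp: "\<nu> \<in> N \<Longrightarrow> \<mu> \<in> N \<Longrightarrow> \<nu> \<circ> \<mu> \<in> N"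
    and N_inv: "\<nu> \<in> N \<Longrightarrow> \<exists>\<nu>'\<in>N. \<nu>' \<circ> \<nu> = id \<and> \<nu> \<circ> \<nu>' = id"
    and N_norm: "g \<in> EE \<Longrightarrow> \<nu> \<in> N \<Longrightarrow> \<exists>\<nu>'\<in>N. g \<circ> \<nu> = \<nu>' \<circ> g"
begin

text \<open>Both sides are elementary because only elementary maps are known to normalize N; this
  makes the relation compatible with composition and inversion.\<close>

definition rel :: "((int \<Rightarrow> 'a) \<Rightarrow> (int \<Rightarrow> 'a)) \<Rightarrow> ((int \<Rightarrow> 'a) \<Rightarrow> (int \<Rightarrow> 'a)) \<Rightarrow> bool" where
  "rel A B \<longleftrightarrow> A \<in> EE \<and> B \<in> EE \<and> (\<exists>\<nu>\<in>N. A = \<nu> \<circ> B)"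

lemma rel_EE: "rel A B \<Longrightarrow> A \<in> EE" "rel A B \<Longrightarrow> B \<in> EE"
  by (auto simp: rel_def)

lemma rel_refl: "A \<in> EE \<Longrightarrow> rel A A"
  unfolding rel_def using N_id by (auto intro!: bexI[of _ id])

lemma rel_sym: 
  assumes "rel A B" shows "rel B A"
proof -
  obtain \<nu> where "\<nu> \<in> N" "A = \<nu> \<circ> B" using assms by (auto simp: rel_def)
  moreover obtain \<nu>' where "\<nu>' \<in> N" "\<nu>' \<circ> \<nu> = id" using N_inv \<open>\<nu> \<in> N\<close> by blast
  ultimately have "B = \<nu>' \<circ> A" by (metis comp_assoc id_comp)
  then show ?thesis using assms \<open>\<nu>' \<in> N\<close> by (auto simp: rel_def)
qed

lemma rel_trans [trans]: "rel A B \<Longrightarrow> rel B C \<Longrightarrow> rel A C"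
  unfolding rel_def by (metis N_comp comp_assoc)

lemma rel_comp:
  assumes "rel A B" "rel C D" shows "rel (A \<circ> C) (B \<circ> D)"
proof -
  obtain \<nu> \<mu> where "\<nu> \<in> N" "A = \<nu> \<circ> B" "\<mu> \<in> N" "C = \<mu> \<circ> D"
    using assms by (auto simp: rel_def)
  moreover obtain \<mu>' where "\<mu>' \<in> N" "B \<circ> \<mu> = \<mu>' \<circ> B"
    using N_norm assms \<open>\<mu> \<in> N\<close> by (auto simp: rel_def)
  ultimately have "A \<circ> C = (\<nu> \<circ> \<mu>') \<circ> (B \<circ> D)" "\<nu> \<circ> \<mu>' \<in> N"
    by (metis comp_assoc) (simp add: N_comp \<open>\<nu> \<in> N\<close> \<open>\<mu>' \<in> N\<close>)
  moreover have "A \<circ> C \<in> EE" "B \<circ> D \<in> EE" using assms rel_EE EE_comp by blast+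
  ultimately show ?thesis unfolding rel_def by blast
qed

lemma rel_inv:
  assumes "rel A B" "A \<circ> A' = id" "A' \<circ> A = id" "B \<circ> B' = id" "B' \<circ> B = id"
  shows "rel A' B'"
proof -
  have inv: "C' \<in> EE" if C: "C \<in> EE" "C \<circ> C' = id" "C' \<circ> C = id" for C C' :: "(int \<Rightarrow> 'a) \<Rightarrow> int \<Rightarrow> 'a"
  proof -
    obtain D where "D \<in> EE" "D \<circ> C = id" using EE_inv[OF C(1)] by blast
    then have "C' = D" using C by (metis comp_assoc comp_id id_comp)
    then show ?thesis using \<open>D \<in> EE\<close> by simp
  qed
  have E: "A' \<in> EE" "B' \<in> EE" using inv assms rel_EE by blast+
  then have "rel (A' \<circ> (B \<circ> B')) (A' \<circ> (A \<circ> B'))"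
    using assms by (intro rel_comp rel_refl rel_sym[of A B])
  moreover have "A' \<circ> (B \<circ> B') = A'" "A' \<circ> (A \<circ> B') = B'"
    using assms by (simp_all flip: comp_assoc)
  ultimately show ?thesis by simp
qed

lemma rel_cancel_left:
  assumes "rel (A \<circ> X) (B \<circ> Y)" "rel A B" shows "rel X Y"
proof -
  obtain A' B' where "A' \<circ> A = id" "A \<circ> A' = id" "B' \<circ> B = id" "B \<circ> B' = id"
    using EE_inv rel_EE assms(2) by meson
  moreover from this have "rel (A' \<circ> (A \<circ> X)) (B' \<circ> (B \<circ> Y))"
    using rel_inv assms by (blast intro: rel_comp)
  ultimately show ?thesis by (simp flip: comp_assoc)
qed

lemma rel_cancel_right:
  assumes "rel (X \<circ> A) (Y \<circ> B)" "rel A B" shows "rel X Y"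
proof -
  obtain A' B' where "A' \<circ> A = id" "A \<circ> A' = id" "B' \<circ> B = id" "B \<circ> B' = id"
    using EE_inv rel_EE assms(2) by meson
  moreover from this have "rel ((X \<circ> A) \<circ> A') ((Y \<circ> B) \<circ> B')"
    using rel_inv assms by (blast intro: rel_comp)
  ultimately show ?thesis by (simp add: comp_assoc)
qed

lemma rel_conj:
  assumes "rel g g'" "rel X X'" "g \<circ> X = Y \<circ> g" "g' \<circ> X' = Y' \<circ> g'"
  shows "rel Y Y'"
  using rel_comp[OF assms(1,2)] assms by (auto intro: rel_cancel_right)

lemma rel_id_iff: "rel A id \<longleftrightarrow> A \<in> EE \<and> A \<in> N"
  by (auto simp: rel_def EE_id)

lemma N_commutator:
  assumes "g \<in> N" "g \<in> EE" "h \<in> EE" "c \<circ> (h \<circ> g) = g \<circ> h"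
  shows "c \<in> N"
proof -
  have g: "rel g id" using assms by (simp add: rel_id_iff)
  have a: "rel (g \<circ> h) (id \<circ> h)" by (rule rel_comp rel_refl g assms)+
  have b: "rel (h \<circ> g) (h \<circ> id)" by (rule rel_comp rel_refl g assms)+
  have "rel (g \<circ> h) (h \<circ> g)"
    using rel_trans[OF a[unfolded id_comp] rel_sym[OF b[unfolded comp_id]]] .
  then have "rel (c \<circ> (h \<circ> g)) (id \<circ> (h \<circ> g))" using assms by simp
  then have "rel c id" by (rule rel_cancel_right) (use assms EE_comp rel_refl in blast)
  then show ?thesis by (simp add: rel_id_iff)
qed

end

locale relative = level n bar lam \<Lambda> I \<Gamma> + normalized n bar lam \<Lambda> N
  for n :: nat and bar :: "'a::comm_ring_1 \<Rightarrow> 'a" and lam :: 'a and \<Lambda> I \<Gamma> N +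
  assumes N_short: "i \<in> Om n \<Longrightarrow> k \<in> Om n \<Longrightarrow> k \<noteq> i \<Longrightarrow> k \<noteq> - i \<Longrightarrow> s \<in> I \<Longrightarrow>
      T (bas i) (scl s (bas k)) 0 \<in> N"
    and N_long: "i \<in> Om n \<Longrightarrow> b \<in> \<Gamma> \<Longrightarrow> T (bas i) 0 b \<in> N"

context hyperbolic
begin

text \<open>Here n \<ge> 3 enters: of the pairs with absolute value 1, 2, 3 at most two are met by
  \<open>k\<close> and \<open>l\<close>. Most arguments below work with such a spare index.\<close>

lemma ex_Om: "\<exists>m\<in>Om n. m \<noteq> k \<and> m \<noteq> - k \<and> m \<noteq> l \<and> m \<noteq> - l"
proof -
  have "{1, 2, 3} \<subseteq> Om n" using n3 by (auto simp: Om_def)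
  moreover have "\<exists>m\<in>{1, 2, 3::int}. m \<noteq> k \<and> m \<noteq> - k \<and> m \<noteq> l \<and> m \<noteq> - l"
    by simp presburger
  ultimately show ?thesis by blast
qed

definition two :: "int \<Rightarrow> 'a \<Rightarrow> int \<Rightarrow> 'a \<Rightarrow> int \<Rightarrow> 'a" where
  "two k \<alpha> l \<beta> = scl \<alpha> (bas k) + scl \<beta> (bas l)"

lemma two_apply: "two k \<alpha> l \<beta> m = (if m = k then \<alpha> else 0) + (if m = l then \<beta> else 0)"
  by (simp add: two_def bas_apply)

lemma scl_two: "scl c (two k \<alpha> l \<beta>) = two k (c * \<alpha>) l (c * \<beta>)"
  by (simp add: two_def scl_add_right)

lemma two_0 [simp]: "two k 0 l 0 = 0"
  by (simp add: two_def)

lemma two_VV [simp]: "k \<in> Om n \<Longrightarrow> l \<in> Om n \<Longrightarrow> two k \<alpha> l \<beta> \<in> VV"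
  by (simp add: two_def)

lemma ff_bas_bas: "i \<noteq> - k \<Longrightarrow> ff (bas i) (bas k) = 0"
  by (auto simp: ff_bas_left bas_apply)

lemma ff_two [simp]: "k \<noteq> - l \<Longrightarrow> ff (two k \<alpha> l \<beta>) (two k \<gamma> l \<delta>) = 0"
  by (simp add: two_def ff_bas_bas)

lemma hh_two [simp]: "k \<noteq> - l \<Longrightarrow> hh (two k \<alpha> l \<beta>) (two k \<gamma> l \<delta>) = 0"
  by (simp add: hh_def)

lemma hh_two_left: "k \<in> Om n \<Longrightarrow> l \<in> Om n \<Longrightarrow>
    hh (two k \<alpha> l \<beta>) w = bar \<alpha> * th k * w (- k) + bar \<beta> * th l * w (- l)"
  by (simp add: two_def hh_bas_left)

lemma T_scl_bas: "T x (scl s (bas m)) 0 = T (bas m) (scl (- (lam * bar s)) x) 0"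
  unfolding T_sym[of x] T_scale by (simp add: mult.commute)

end

section \<open>Congruent parameters and transvections with few nonzero coordinates\<close>

context level
begin

definition veq :: "(int \<Rightarrow> 'a) \<Rightarrow> (int \<Rightarrow> 'a) \<Rightarrow> bool" where
  "veq v v' \<longleftrightarrow> (\<forall>k. v k - v' k \<in> I)"

lemma I_mult_diff:
  assumes "x - x' \<in> I" "y - y' \<in> I" shows "x * y - x' * y' \<in> I"
proof -
  have "x * y - x' * y' = (x - x') * y + x' * (y - y')" by (simp add: algebra_simps)
  then show ?thesis using assms by (auto intro: I_add I_mult)
qed

lemma I_bar_diff: "x - x' \<in> I \<Longrightarrow> bar x - bar x' \<in> I"
  using I_bar[of "x - x'"] by simp

lemma I_add_diff: "x - x' \<in> I \<Longrightarrow> y - y' \<in> I \<Longrightarrow> (x + y) - (x' + y') \<in> I"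
  using I_add[of "x - x'" "y - y'"] by (simp add: algebra_simps)

lemma I_minus_diff: "x - x' \<in> I \<Longrightarrow> - x - (- x') \<in> I"
  using I_minus[of "x - x'"] by simp

lemma ff_veq:
  assumes "veq v v'" "veq w w'" shows "ff v w - ff v' w' \<in> I"
proof -
  have "ff v w - ff v' w' = (\<Sum>k = 1..int n. bar (v k) * w (- k) - bar (v' k) * w' (- k))"
    by (simp add: ff_def sum_subtractf)
  also have "\<dots> \<in> I"
    using assms by (intro I_sum I_mult_diff I_bar_diff) (auto simp: veq_def)
  finally show ?thesis .
qed

text \<open>What matters about \<open>b\<close> is the defect b - f(v,v) in \<Lambda>, not
  \<open>b\<close> itself: with a common direction, \<open>T u v b\<close> and
  \<open>T u v' b'\<close> should agree modulo N when the vectors agree modulo I and the defects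
  agree modulo \<Gamma>.\<close>

definition qcong :: "(int \<Rightarrow> 'a) \<Rightarrow> 'a \<Rightarrow> (int \<Rightarrow> 'a) \<Rightarrow> 'a \<Rightarrow> bool" where
  "qcong v b v' b' \<longleftrightarrow> v \<in> VV \<and> v' \<in> VV \<and> veq v v' \<and> b - ff v v \<in> \<Lambda> \<and> b' - ff v' v' \<in> \<Lambda> \<and>
     (b - ff v v) - (b' - ff v' v') \<in> \<Gamma>"

text \<open>The new scalar is the one that \<open>T_comp\<close> assigns to the first factor when
  the second is split off. Defects are additive up to \<open>skew (ff v2 v1)\<close>, and passing to
  the primed vectors changes that term by \<open>skew\<close> of an element of I.\<close>

lemma qcong_split:
  assumes "qcong (v1 + v2) b (v1' + v2') b'" "qcong v2 b2 v2' b2'" "v1 \<in> VV" "v1' \<in> VV"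
  shows "qcong v1 (b - b2 - hh v1 v2) v1' (b' - b2' - hh v1' v2')"
proof -
  have *: "b - b2 - hh v1 v2 - ff v1 v1 = (b - ff (v1 + v2) (v1 + v2)) - (b2 - ff v2 v2) + skew (ff v2 v1)"
    for b b2 v1 v2 by (simp add: hh_def skew_def)
  have "(v1 + v2) k - (v1' + v2') k - (v2 k - v2' k) \<in> I" for k
    using assms by (intro I_diff[of "(v1 + v2) k - (v1' + v2') k"]) (simp_all add: qcong_def veq_def)
  then have veq: "veq v1 v1'" by (simp add: veq_def)
  have "skew (ff v2 v1) - skew (ff v2' v1') \<in> \<Gamma>"
    unfolding skew_diff[symmetric] using veq assms by (intro Gam_skew ff_veq) (auto simp: qcong_def)
  moreover define d d' e e' where "d = b - ff (v1 + v2) (v1 + v2)" and "d' = b' - ff (v1' + v2') (v1' + v2')"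
    and "e = b2 - ff v2 v2" and "e' = b2' - ff v2' v2'"
  moreover have d: "d \<in> \<Lambda>" "d' \<in> \<Lambda>" "d - d' \<in> \<Gamma>" "e \<in> \<Lambda>" "e' \<in> \<Lambda>" "e - e' \<in> \<Gamma>"
    using assms unfolding qcong_def d_def d'_def e_def e'_def by blast+
  ultimately have "((d - d') - (e - e')) + (skew (ff v2 v1) - skew (ff v2' v1')) \<in> \<Gamma>"
    using Gam_add Gam_diff by blast
  then have "(d - e + skew (ff v2 v1)) - (d' - e' + skew (ff v2' v1')) \<in> \<Gamma>"
    by (simp add: algebra_simps)
  moreover have "d - e + skew (ff v2 v1) \<in> \<Lambda>" "d' - e' + skew (ff v2' v1') \<in> \<Lambda>"
    using d Lam_add Lam_diff Lam_skewI by blast+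
  ultimately show ?thesis using veq assms(3,4) unfolding qcong_def * d_def d'_def e_def e'_def by blast
qed

lemma qcong_two:
  assumes "k \<in> Om n" "l \<in> Om n" "k \<noteq> - l" "\<alpha> - \<alpha>' \<in> I" "\<beta> - \<beta>' \<in> I"
  shows "qcong (two k \<alpha> l \<beta>) 0 (two k \<alpha>' l \<beta>') 0"
  using assms by (auto simp: qcong_def veq_def two_apply intro: I_add_diff)

lemma qcong_bas:
  assumes "k \<in> Om n" "s - s' \<in> I" "b \<in> \<Lambda>" "b' \<in> \<Lambda>" "b - b' \<in> \<Gamma>"
  shows "qcong (scl s (bas k)) b (scl s' (bas k)) b'"
  using assms by (auto simp: qcong_def veq_def bas_apply)

end

context relative
begin

lemma rel_short:
  assumes "i \<in> Om n" "k \<in> Om n" "k \<noteq> i" "k \<noteq> - i" "s - s' \<in> I"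
  shows "rel (T (bas i) (scl s (bas k)) 0) (T (bas i) (scl s' (bas k)) 0)"
proof -
  have "T (bas i) (scl s (bas k)) 0 = T (bas i) (scl (s - s') (bas k)) 0 \<circ> T (bas i) (scl s' (bas k)) 0"
    using assms by (simp add: T_comp hh_bas_bas flip: scl_add)
  then show ?thesis unfolding rel_def using assms EE_short1 N_short by blast
qed

lemma rel_long:
  assumes "i \<in> Om n" "b \<in> \<Lambda>" "b' \<in> \<Lambda>" "b - b' \<in> \<Gamma>"
  shows "rel (T (bas i) 0 b) (T (bas i) 0 b')"
proof -
  have "T (bas i) 0 b = T (bas i) 0 (b - b') \<circ> T (bas i) 0 b'"
    using assms by (simp add: T_comp)
  then show ?thesis unfolding rel_def using assms EE_long1 N_long by blast
qed

text \<open>Induction on a finite set containing both supports. A coordinate other than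
  \<open>m\<close> splits off as a short root element, the coordinate at \<open>m\<close> is moved
  into the scalar by \<open>T_self\<close>, and a long root element remains at the end.\<close>

lemma rel_T_bas:
  assumes m: "m \<in> Om n" and "qcong z b z' b'" "z (- m) = 0" "z' (- m) = 0"
  shows "rel (T (bas m) z b) (T (bas m) z' b')"
proof -
  have "rel (T (bas m) z b) (T (bas m) z' b')"
    if "finite A" "qcong z b z' b'" "z (- m) = 0" "z' (- m) = 0" "\<And>k. k \<notin> A \<Longrightarrow> z k = 0 \<and> z' k = 0"
    for A z b z' b'
    using that
  proof (induction A arbitrary: z b z' b' rule: finite_induct)
    case empty
    then have z: "z = 0" "z' = 0" by (auto simp: fun_eq_iff)
    show ?case unfolding z using empty(1) m unfolding qcong_def z by (intro rel_long) simp_all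
  next
    case (insert k A)
    show ?case
    proof (cases "k = - m \<or> k \<notin> Om n")
      case True
      then have "z k = 0 \<and> z' k = 0" using insert.prems by (auto simp: qcong_def VV_def)
      then have "z j = 0 \<and> z' j = 0" if "j \<notin> A" for j
        using insert.prems(4)[of j] that by (cases "j = k") auto
      then show ?thesis using insert.prems by (intro insert.IH) auto
    next
      case False
      define z1 z1' where "z1 = z - scl (z k) (bas k)" and "z1' = z' - scl (z' k) (bas k)"
      have z: "z = z1 + scl (z k) (bas k)" "z' = z1' + scl (z' k) (bas k)"
        by (simp_all add: z1_def z1'_def)
      have VV: "z1 \<in> VV" "z1' \<in> VV"
        using insert.prems(1) False by (auto simp: z1_def z1'_def qcong_def)
      have m0: "z1 (- m) = 0" "z1' (- m) = 0"
        using insert.prems False by (auto simp: z1_def z1'_def bas_apply)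
      have supp: "z1 j = 0 \<and> z1' j = 0" if "j \<notin> A" for j
        using insert.prems(4)[of j] that by (cases "j = k") (auto simp: z1_def z1'_def bas_apply)
      have d: "z k - z' k \<in> I" using insert.prems(1) by (simp add: qcong_def veq_def)
      have q: "qcong (z1 + scl (z k) (bas k)) b (z1' + scl (z' k) (bas k)) b'"
        using insert.prems(1) z by simp
      show ?thesis
      proof (cases "k = m")
        case True
        have h0: "hh z1 (scl (z k) (bas k)) = 0" "hh z1' (scl (z' k) (bas k)) = 0"
          using m m0 True by (simp_all add: hh_bas_right)
        have "skew (z k) - skew (z' k) \<in> \<Gamma>" using d by (simp add: Gam_skew flip: skew_diff)
        then have "- skew (z k) - - skew (z' k) \<in> \<Gamma>"
          using Gam_minus[of "skew (z k) - skew (z' k)"] by simp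
        \<comment> \<open>With this scalar the part that remains carries
          \<open>b + skew (z k)\<close>, exactly what \<open>T_self\<close> produces.\<close>
        then have "qcong (scl (z k) (bas k)) (- skew (z k)) (scl (z' k) (bas k)) (- skew (z' k))"
          using m True d by (intro qcong_bas) (auto intro: Lam_minus)
        from qcong_split[OF q this VV] have "rel (T (bas m) z1 (b + skew (z k))) (T (bas m) z1' (b' + skew (z' k)))"
          using m0 supp unfolding h0 by (intro insert.IH) auto
        moreover have "T (bas m) z b = T (bas m) z1 (b + skew (z k))"
          "T (bas m) z' b' = T (bas m) z1' (b' + skew (z' k))"
          using True z T_self[of "bas m" z1 "z m" b] T_self[of "bas m" z1' "z' m" b']
          by (simp_all add: skew_def algebra_simps)
        ultimately show ?thesis by simp
      next
        case km: False
        have "qcong (scl (z k) (bas k)) 0 (scl (z' k) (bas k)) 0"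
          using False d by (intro qcong_bas) auto
        from qcong_split[OF q this VV]
        have "rel (T (bas m) z1 (b - 0 - hh z1 (scl (z k) (bas k)))) (T (bas m) z1' (b' - 0 - hh z1' (scl (z' k) (bas k))))"
          using m0 supp by (intro insert.IH) auto
        moreover have "rel (T (bas m) (scl (z k) (bas k)) 0) (T (bas m) (scl (z' k) (bas k)) 0)"
          using m km False d by (intro rel_short) auto
        ultimately have "rel (T (bas m) z1 (b - 0 - hh z1 (scl (z k) (bas k))) \<circ> T (bas m) (scl (z k) (bas k)) 0)
            (T (bas m) z1' (b' - 0 - hh z1' (scl (z' k) (bas k))) \<circ> T (bas m) (scl (z' k) (bas k)) 0)"
          by (rule rel_comp)
        moreover have "T (bas m) y1 (c - 0 - hh y1 (scl s (bas k))) \<circ> T (bas m) (scl s (bas k)) 0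
            = T (bas m) (y1 + scl s (bas k)) c" if "y1 (- m) = 0" for y1 c s
          using that m km False by (subst T_comp) (auto simp: hh_bas_left bas_apply)
        ultimately show ?thesis using m0 by (simp flip: z)
      qed
    qed
  qed
  from this[OF finite_Om[of n] assms(2-4)] show ?thesis
    using assms(2) by (auto simp: qcong_def VV_def)
qed

lemma rel_T_two_bas:
  assumes "k \<in> Om n" "l \<in> Om n" "k \<noteq> - l" "\<alpha> - \<alpha>' \<in> I" "\<beta> - \<beta>' \<in> I"
    and "m \<in> Om n" "m \<noteq> k" "m \<noteq> - k" "m \<noteq> l" "m \<noteq> - l" "s - s' \<in> I"
  shows "rel (T (two k \<alpha> l \<beta>) (scl s (bas m)) 0) (T (two k \<alpha>' l \<beta>') (scl s' (bas m)) 0)"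
  unfolding T_scl_bas scl_two using assms
  by (intro rel_T_bas qcong_two I_mult_diff I_minus_diff I_bar_diff) (auto simp: two_apply)

text \<open>Coordinates of \<open>u\<close> away from the pairs of \<open>k\<close> and
  \<open>l\<close> split off one by one. For the rest, with x the two-coordinate direction and m a
  spare index, \<open>?g\<close> fixes \<open>u\<close> and carries \<open>bas (- m)\<close> to
  \<open>bas (- m) + x\<close>. \<open>T_split\<close> then expresses \<open>T x u b\<close> through
  transvections along \<open>bas (- m)\<close>, which \<open>rel_T_bas\<close> controls.\<close>

lemma rel_T_two:
  assumes kl: "k \<in> Om n" "l \<in> Om n" "k \<noteq> - l" and ab: "\<alpha> - \<alpha>' \<in> I" "\<beta> - \<beta>' \<in> I"
    and "qcong u b u' b'" "hh (two k \<alpha> l \<beta>) u = 0" "hh (two k \<alpha>' l \<beta>') u' = 0"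
  shows "rel (T (two k \<alpha> l \<beta>) u b) (T (two k \<alpha>' l \<beta>') u' b')"
proof -
  let ?x = "two k \<alpha> l \<beta>" and ?x' = "two k \<alpha>' l \<beta>'"
  have "rel (T ?x u b) (T ?x' u' b')"
    if "finite A" "qcong u b u' b'" "hh ?x u = 0" "hh ?x' u' = 0"
      "\<And>j. j \<notin> A \<union> {k, - k, l, - l} \<Longrightarrow> u j = 0 \<and> u' j = 0"
    for A u b u' b'
    using that
  proof (induction A arbitrary: u b u' b' rule: finite_induct)
    case empty
    obtain m where m: "m \<in> Om n" "m \<noteq> k" "m \<noteq> - k" "m \<noteq> l" "m \<noteq> - l"
      using ex_Om by blast
    have um: "u m = 0" "u' m = 0" "u (- m) = 0" "u' (- m) = 0"
      using empty(4)[of m] empty(4)[of "- m"] m by auto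
    let ?s = "scl (th m) (bas m)"
    let ?g = "T ?x ?s 0" and ?g' = "T ?x' ?s 0"
    have rg: "rel ?g ?g'"
      using kl ab m by (intro rel_T_two_bas) auto
    have rm: "rel (T (bas (- m)) u b) (T (bas (- m)) u' b')"
      using empty m um by (intro rel_T_bas) auto
    have g: "T (two k \<alpha> l \<beta>) ?s 0 \<circ> T (bas (- m)) u b = T (bas (- m) + two k \<alpha> l \<beta>) u b \<circ> T (two k \<alpha> l \<beta>) ?s 0"
      and split: "T (bas (- m) + two k \<alpha> l \<beta>) u b = T (bas (- m)) u b \<circ> T (two k \<alpha> l \<beta>) u b
         \<circ> T (bas (- m)) (scl b (two k \<alpha> l \<beta>)) 0"
      if "T (two k \<alpha> l \<beta>) ?s 0 \<in> EE" "hh (two k \<alpha> l \<beta>) u = 0" "u (- m) = 0" "u m = 0" "b - ff u u \<in> \<Lambda>" for \<alpha> \<beta> u b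
    proof -
      let ?x = "two k \<alpha> l \<beta>"
      have "T ?x ?s 0 (bas (- m)) = bas (- m) + ?x"
        using kl m by (simp add: T_def hh_bas_left hh_two_left bas_apply Om_nonzero)
      moreover have "T ?x ?s 0 u = u"
        using that m by (simp add: T_def hh_bas_left)
      ultimately show "T ?x ?s 0 \<circ> T (bas (- m)) u b = T (bas (- m) + ?x) u b \<circ> T ?x ?s 0"
        using T_conj[OF EE_uni[OF that(1)], of "bas (- m)" u b] by simp
      show "T (bas (- m) + ?x) u b = T (bas (- m)) u b \<circ> T ?x u b \<circ> T (bas (- m)) (scl b ?x) 0"
        using that m kl by (intro T_split) (auto simp: hh_bas_left two_apply hh_self)
    qed
    have L: "b - ff u u \<in> \<Lambda>" "b' - ff u' u' \<in> \<Lambda>" using empty(1) by (auto simp: qcong_def)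
    have "b - b' = (b - ff u u - (b' - ff u' u')) + (ff u u - ff u' u')" by simp
    then have bb: "b - b' \<in> I"
      using empty(1) by (metis I_add Gam_I ff_veq qcong_def)
    have "rel (T (bas (- m) + ?x) u b) (T (bas (- m) + ?x') u' b')"
      by (rule rel_conj[OF rg rm g g]) (use rg rel_EE empty um L in auto)
    then have "rel (T (bas (- m)) u b \<circ> T ?x u b \<circ> T (bas (- m)) (scl b ?x) 0)
        (T (bas (- m)) u' b' \<circ> T ?x' u' b' \<circ> T (bas (- m)) (scl b' ?x') 0)"
      using split[of \<alpha> \<beta> u b] split[of \<alpha>' \<beta>' u' b'] rg rel_EE empty um L by simp
    moreover have "rel (T (bas (- m)) (scl b ?x) 0) (T (bas (- m)) (scl b' ?x') 0)"
      unfolding scl_two using kl m ab bb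
      by (intro rel_T_bas qcong_two I_mult_diff) (auto simp: two_apply)
    ultimately show ?case using rm by (blast intro: rel_cancel_left rel_cancel_right)
  next
    case (insert p A)
    show ?case
    proof (cases "p \<in> {k, - k, l, - l} \<or> p \<notin> Om n")
      case True
      then have "u j = 0 \<and> u' j = 0" if "j \<notin> A \<union> {k, - k, l, - l}" for j
        using insert.prems that by (cases "j = p") (auto simp: qcong_def VV_def)
      then show ?thesis using insert.prems by (intro insert.IH) auto
    next
      case False
      define v v' where "v = u - scl (u p) (bas p)" and "v' = u' - scl (u' p) (bas p)"
      have u: "u = v + scl (u p) (bas p)" "u' = v' + scl (u' p) (bas p)"
        by (simp_all add: v_def v'_def)
      have VV: "v \<in> VV" "v' \<in> VV"
        using insert.prems(1) False by (auto simp: v_def v'_def qcong_def)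
      have hp: "hh (two k \<alpha> l \<beta>) (bas p) = 0" for \<alpha> \<beta>
        using False kl by (auto simp: hh_two_left bas_apply)
      have h0: "hh ?x v = 0" "hh ?x' v' = 0"
        using insert.prems hp by (simp_all add: v_def v'_def)
      have supp: "v j = 0 \<and> v' j = 0" if "j \<notin> A \<union> {k, - k, l, - l}" for j
        using insert.prems(4)[of j] that by (cases "j = p") (auto simp: v_def v'_def bas_apply)
      have d: "u p - u' p \<in> I" using insert.prems(1) by (simp add: qcong_def veq_def)
      have q: "qcong (v + scl (u p) (bas p)) b (v' + scl (u' p) (bas p)) b'"
        using insert.prems(1) u by simp
      have "qcong (scl (u p) (bas p)) 0 (scl (u' p) (bas p)) 0"
        using False d by (intro qcong_bas) auto
      from qcong_split[OF q this VV]
      have "rel (T ?x v (b - 0 - hh v (scl (u p) (bas p)))) (T ?x' v' (b' - 0 - hh v' (scl (u' p) (bas p))))"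
        using h0 supp by (intro insert.IH) auto
      moreover have "rel (T ?x (scl (u p) (bas p)) 0) (T ?x' (scl (u' p) (bas p)) 0)"
        using kl ab False d by (intro rel_T_two_bas) auto
      ultimately have "rel (T ?x v (b - 0 - hh v (scl (u p) (bas p))) \<circ> T ?x (scl (u p) (bas p)) 0)
          (T ?x' v' (b' - 0 - hh v' (scl (u' p) (bas p))) \<circ> T ?x' (scl (u' p) (bas p)) 0)"
        by (rule rel_comp)
      moreover have "T (two k \<alpha> l \<beta>) y1 (c - 0 - hh y1 (scl s (bas p))) \<circ> T (two k \<alpha> l \<beta>) (scl s (bas p)) 0
          = T (two k \<alpha> l \<beta>) (y1 + scl s (bas p)) c"
        if "hh (two k \<alpha> l \<beta>) y1 = 0" for y1 c s \<alpha> \<beta>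
        using that kl hp by (subst T_comp) auto
      ultimately show ?thesis using h0 by (simp flip: u)
    qed
  qed
  from this[OF finite_Om[of n] assms(6-8)] show ?thesis
    using assms(6) by (auto simp: qcong_def VV_def)
qed

end

section \<open>Transvections along unimodular columns\<close>

context hyperbolic
begin

definition column :: "(int \<Rightarrow> 'a) \<Rightarrow> bool" where
  "column u \<longleftrightarrow> u \<in> VV \<and> ff u u \<in> \<Lambda> \<and> (\<exists>p\<in>VV. hh u p = 1)"

definition phi :: "(int \<Rightarrow> 'a) \<Rightarrow> int \<Rightarrow> 'a" where
  "phi u k = hh u (bas k)"

lemma phi_opp: "i \<in> Om n \<Longrightarrow> phi u (- i) = th i * bar (u i)"
  by (simp add: phi_def hh_bas_right)

lemma sum_fun_apply: "(\<Sum>k\<in>A. g k) x = (\<Sum>k\<in>A. (g k :: int \<Rightarrow> 'a) x)"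
  by (induction A rule: infinite_finite_induct) auto

lemma VV_sum: "v \<in> VV \<Longrightarrow> v = (\<Sum>k\<in>Om n. scl (v k) (bas k))"
  by (auto simp: fun_eq_iff sum_fun_apply VV_def bas_apply if_distrib cong: if_cong)

lemma hh_sum_right: "hh u (\<Sum>k\<in>A. g k) = (\<Sum>k\<in>A. hh u (g k))"
proof (induction A rule: infinite_finite_induct)
  case (insert k A)
  then show ?case unfolding sum.insert[OF insert.hyps] hh_lin by simp
qed (simp_all only: sum.infinite sum.empty hh_lin not_False_eq_True)

lemma hh_phi: "y \<in> VV \<Longrightarrow> hh u y = (\<Sum>k\<in>Om n. y k * phi u k)"
  by (subst VV_sum) (auto simp: hh_sum_right phi_def)

definition is_ideal :: "'a set \<Rightarrow> bool" where
  "is_ideal K \<longleftrightarrow> 0 \<in> K \<and> (\<forall>x\<in>K. \<forall>y\<in>K. x + y \<in> K) \<and> (\<forall>r. \<forall>x\<in>K. r * x \<in> K)"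

lemma is_ideal_sum: "is_ideal K \<Longrightarrow> (\<And>k. k \<in> A \<Longrightarrow> g k \<in> K) \<Longrightarrow> sum g A \<in> K"
  by (induction A rule: infinite_finite_induct) (auto simp: is_ideal_def)

lemma is_ideal_diff: "is_ideal K \<Longrightarrow> x \<in> K \<Longrightarrow> y \<in> K \<Longrightarrow> x - y \<in> K"
  unfolding is_ideal_def by (metis mult_minus1 diff_conv_add_uminus)

lemma is_ideal_mult: "is_ideal K \<Longrightarrow> x \<in> K \<Longrightarrow> r * x \<in> K" "is_ideal K \<Longrightarrow> x \<in> K \<Longrightarrow> x * r \<in> K"
  by (auto simp: is_ideal_def mult.commute[of x])

text \<open>The relation h(u,p) = 1 writes c as a combination of the products
  \<open>c * phi u k\<close>. This takes the place of localization.\<close>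

lemma unimodular:
  assumes "column u" "is_ideal K" "\<And>k. k \<in> Om n \<Longrightarrow> c * phi u k \<in> K"
  shows "c \<in> K"
proof -
  obtain p where p: "p \<in> VV" "hh u p = 1" using assms(1) by (auto simp: column_def)
  have "c = c * hh u p" using p by simp
  also have "\<dots> = (\<Sum>k\<in>Om n. p k * (c * phi u k))"
    unfolding hh_phi[OF p(1)] by (simp add: sum_distrib_left mult.left_commute)
  also have "\<dots> \<in> K" using assms by (auto intro: is_ideal_sum is_ideal_mult(1))
  finally show ?thesis .
qed

text \<open>These vectors span the orthogonal complement of a unimodular \<open>u\<close>.\<close>

definition koszul :: "(int \<Rightarrow> 'a) \<Rightarrow> int \<Rightarrow> int \<Rightarrow> int \<Rightarrow> 'a" where
  "koszul u k l = two k (phi u l) l (- phi u k)"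

lemma hh_koszul [simp]: "hh u (koszul u k l) = 0" "hh (koszul u k l) u = 0"
proof -
  show *: "hh u (koszul u k l) = 0" by (simp add: koszul_def two_def flip: phi_def)
  then show "hh (koszul u k l) u = 0" by (rule hh_zero_swap)
qed

text \<open>For a spare k the value h(x_kl, x_-k,l') is the unit \<open>th k\<close> times
  bar(phi_l) phi_l', which settles all products with l' \<noteq> -l. The products with l' = -l are
  tested against every phi_j by \<open>unimodular\<close>.\<close>

lemma koszul_ideal:
  assumes u: "column u" and K: "is_ideal K"
    and gen: "\<And>k l k' l'. k \<in> Om n \<Longrightarrow> l \<in> Om n \<Longrightarrow> k' \<in> Om n \<Longrightarrow> l' \<in> Om n \<Longrightarrow>
      k \<noteq> l \<Longrightarrow> k \<noteq> - l \<Longrightarrow> k' \<noteq> l' \<Longrightarrow> k' \<noteq> - l' \<Longrightarrow> hh (koszul u k l) (koszul u k' l') \<in> K"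
  shows "1 \<in> K"
proof -
  have a: "bar (phi u l) * phi u l' \<in> K" if l: "l \<in> Om n" "l' \<in> Om n" "l' \<noteq> - l" for l l'
  proof -
    obtain k where k: "k \<in> Om n" "k \<noteq> l" "k \<noteq> - l" "k \<noteq> l'" "k \<noteq> - l'" using ex_Om by blast
    then have "hh (koszul u k l) (koszul u (- k) l') \<in> K" using l by (intro gen) auto
    then have "th k * (bar (phi u l) * phi u l') \<in> K"
      using k l by (simp add: koszul_def hh_two_left two_apply Om_neq_minus algebra_simps split: if_splits)
    then show ?thesis using is_ideal_mult(1)[OF K, of _ "bar (th k)"] by fastforce
  qed
  have b: "bar (phi u k) * phi u (- k) \<in> K" if k: "k \<in> Om n" for k
  proof (rule unimodular[OF u K])
    fix j assume j: "j \<in> Om n"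
    show "bar (phi u k) * phi u (- k) * phi u j \<in> K"
    proof (cases "j = - k")
      case False
      then show ?thesis using is_ideal_mult(1)[OF K a[OF k j], of "phi u (- k)"] by (simp add: algebra_simps)
    next
      case True
      obtain l where l: "l \<in> Om n" "l \<noteq> k" "l \<noteq> - k" using ex_Om by blast
      \<comment> \<open>This value has two summands. After multiplication by phi_-k the first is a
        multiple of bar(phi_l) phi_-k, already in K, so the second, bar(phi_k) phi_-k^2 up to a
        unit, is in K as well.\<close>
      then have "hh (koszul u k l) (koszul u (- k) (- l)) \<in> K" using k by (intro gen) auto
      moreover have "hh (koszul u k l) (koszul u (- k) (- l))
          = th k * bar (phi u l) * phi u (- l) + th l * bar (phi u k) * phi u (- k)"
        using k l by (auto simp: koszul_def hh_two_left two_apply algebra_simps)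
      ultimately have "phi u (- k) * (th k * bar (phi u l) * phi u (- l) + th l * bar (phi u k) * phi u (- k)) \<in> K"
        using K by (auto intro: is_ideal_mult)
      moreover have "bar (phi u l) * phi u (- k) \<in> K" using a k l by auto
      then have "(th k * phi u (- l)) * (bar (phi u l) * phi u (- k)) \<in> K"
        using K by (auto intro: is_ideal_mult)
      ultimately have "th l * (bar (phi u k) * phi u (- k) * phi u (- k)) \<in> K"
        using is_ideal_diff[OF K] by (fastforce simp: algebra_simps)
      then have "bar (phi u k) * phi u (- k) * phi u (- k) \<in> K"
        using is_ideal_mult(1)[OF K, of _ "bar (th l)"] by fastforce
      then show ?thesis using True by simp
    qed
  qed
  have "bar (phi u l) * phi u l' \<in> K" if "l \<in> Om n" "l' \<in> Om n" for l l'
    using a b that by (cases "l' = - l") auto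
  then have c: "bar (phi u l) \<in> K" if "l \<in> Om n" for l
    using unimodular[OF u K] that by blast
  obtain p where p: "p \<in> VV" "hh u p = 1" using u by (auto simp: column_def)
  have "1 = bar (hh u p)" using p by simp
  also have "\<dots> = (\<Sum>k\<in>Om n. bar (p k) * bar (phi u k))" unfolding hh_phi[OF p(1)] by (simp add: bar_sum)
  also have "\<dots> \<in> K" using K c by (auto intro: is_ideal_sum is_ideal_mult(1))
  finally show ?thesis .
qed

lemma column_hh: "column u \<Longrightarrow> hh u u = 0"
  by (auto simp: column_def intro: hh_self_0)

lemma column_uni:
  assumes "column u" "uni g" shows "column (g u)"
proof -
  obtain p where "p \<in> VV" "hh u p = 1" using assms(1) by (auto simp: column_def)
  then have "g p \<in> VV" "hh (g u) (g p) = 1" using assms by (auto simp: uniD)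
  moreover have "ff (g u) (g u) \<in> \<Lambda>"
    using assms uniD(4)[OF assms(2), of u] Lam_add[of "ff (g u) (g u) - ff u u" "ff u u"] by (simp add: column_def)
  moreover have "g u \<in> VV" using assms by (simp add: column_def uniD)
  ultimately show ?thesis unfolding column_def by blast
qed

lemma ff_scl_column: "column u \<Longrightarrow> ff (scl s u) (scl s u) \<in> \<Lambda>"
  using Lam_conj[of "ff u u" s] by (simp add: column_def mult_ac)

lemma koszul_VV [simp]: "k \<in> Om n \<Longrightarrow> l \<in> Om n \<Longrightarrow> koszul u k l \<in> VV"
  by (simp add: koszul_def)

lemma ff_koszul [simp]: "k \<noteq> - l \<Longrightarrow> ff (koszul u k l) (koszul u k l) = 0"
  by (simp add: koszul_def)

text \<open>The leftover coefficient at \<open>bas l\<close> is the sum of all y_k phi_k, which is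
  h(u,y) = 0.\<close>

lemma scl_phi_eq_sum:
  assumes "y \<in> VV" "hh u y = 0"
  shows "scl (phi u l) y = (\<Sum>k\<in>Om n. scl (y k) (koszul u k l))"
proof -
  have "(\<Sum>k\<in>Om n. scl (y k) (koszul u k l))
      = (\<Sum>k\<in>Om n. scl (phi u l) (scl (y k) (bas k))) - scl (\<Sum>k\<in>Om n. y k * phi u k) (bas l)"
    by (auto simp: fun_eq_iff sum_fun_apply koszul_def two_def sum.distrib sum_distrib_left sum_subtractf algebra_simps)
  moreover have "scl c (\<Sum>k\<in>A. g k) = (\<Sum>k\<in>A. scl c (g k))" for c A and g :: "int \<Rightarrow> int \<Rightarrow> 'a"
    by (simp add: fun_eq_iff sum_fun_apply sum_distrib_left)
  ultimately show ?thesis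
    using assms(2) arg_cong[OF VV_sum[OF assms(1)], of "scl (phi u l)"] by (simp add: hh_phi[OF assms(1)])
qed

end

section \<open>Transvections along a unimodular column with vectors in I\<close>

context relative
begin

text \<open>By \<open>T_sym\<close> the two-coordinate vector becomes the direction and the column
  becomes the vector, so \<open>rel_T_two\<close> applies to an arbitrary column.\<close>

lemma rel_T_column_two:
  assumes u: "column u" and k: "k \<in> Om n" "l \<in> Om n" "k \<noteq> - l" "\<alpha> - \<alpha>' \<in> I" "\<beta> - \<beta>' \<in> I"
    and h: "hh u (two k \<alpha> l \<beta>) = 0" "hh u (two k \<alpha>' l \<beta>') = 0"
  shows "rel (T u (two k \<alpha> l \<beta>) 0) (T u (two k \<alpha>' l \<beta>') 0)"
proof -
  have "ff (scl (- lam) u) (scl (- lam) u) \<in> \<Lambda>" using u by (rule ff_scl_column)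
  then have "qcong (scl (- lam) u) 0 (scl (- lam) u) 0"
    using u Lam_minus by (fastforce simp: qcong_def veq_def column_def)
  then show ?thesis unfolding T_sym[of u] using h[THEN hh_zero_swap]
    by (intro rel_T_two k) simp_all
qed

lemma T_column_koszul_EE:
  assumes "column u" "k \<in> Om n" "l \<in> Om n" "k \<noteq> - l"
  shows "T u (scl r (koszul u k l)) 0 \<in> EE"
proof -
  have "hh u (scl r (koszul u k l)) = 0" by simp
  then have "hh u (two k (r * phi u l) l (r * - phi u k)) = 0" by (simp only: koszul_def scl_two)
  then show ?thesis
    using rel_T_column_two[OF assms, of "r * phi u l" "r * phi u l" "r * - phi u k" "r * - phi u k"]
    by (simp add: koszul_def scl_two rel_EE)
qed

lemma N_T_koszul:
  assumes "column u" "k \<in> Om n" "l \<in> Om n" "k \<noteq> - l" "r \<in> I"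
  shows "T u (scl r (koszul u k l)) 0 \<in> N"
proof -
  have "hh u (scl r (koszul u k l)) = 0" by simp
  then have "hh u (two k (r * phi u l) l (r * - phi u k)) = 0" by (simp only: koszul_def scl_two)
  then have "rel (T u (two k (r * phi u l) l (r * - phi u k)) 0) (T u (two k 0 l 0) 0)"
    using assms by (intro rel_T_column_two) (auto intro: I_mult I_minus)
  then show ?thesis by (simp add: koszul_def scl_two rel_id_iff)
qed

text \<open>Two transvections along the same \<open>u\<close> commute up to
  \<open>T u 0 (skew c)\<close> with c = h(x,y). Taking Koszul vectors, one of them scaled by bar(r)
  with r in I, puts every value h(x,y) into the ideal K, and \<open>koszul_ideal\<close>
  applies.\<close>

lemma N_T_skew:
  assumes u: "column u" and "c \<in> I"
  shows "T u 0 (skew c) \<in> N"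
proof -
  define K where "K = {c. \<forall>r\<in>I. T u 0 (skew (r * c)) \<in> N}"
  have uu: "hh u u = 0" using u by (rule column_hh)
  have "is_ideal K"
    unfolding is_ideal_def
  proof (intro conjI ballI allI)
    show "0 \<in> K" by (simp add: K_def N_id)
    show "x + y \<in> K" if "x \<in> K" "y \<in> K" for x y
    proof -
      have "T u 0 (skew (r * (x + y))) = T u 0 (skew (r * x)) \<circ> T u 0 (skew (r * y))" for r
        by (simp add: T_comp uu skew_add distrib_left)
      then show ?thesis using that N_comp by (simp add: K_def)
    qed
    show "s * x \<in> K" if "x \<in> K" for s x
      using that unfolding K_def by (simp add: I_mult flip: mult.assoc)
  qed
  moreover have "hh (koszul u k l) (koszul u k' l') \<in> K"
    if k: "k \<in> Om n" "l \<in> Om n" "k' \<in> Om n" "l' \<in> Om n" "k \<noteq> - l" "k' \<noteq> - l'" for k l k' l'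
    unfolding K_def
  proof (intro CollectI ballI)
    fix r assume r: "r \<in> I"
    let ?x = "scl (bar r) (koszul u k l)" and ?y = "scl 1 (koszul u k' l')"
    have g: "T u ?x 0 \<in> N" using u k r by (intro N_T_koszul) (auto intro: I_bar)
    have gE: "T u ?x 0 \<in> EE" using u k by (intro T_column_koszul_EE)
    have hE: "T u ?y 0 \<in> EE" using u k by (intro T_column_koszul_EE)
    have "skew (r * hh (koszul u k l) (koszul u k' l')) = hh ?x ?y - hh ?y ?x"
      using hh_swap[of ?y ?x] by (simp add: skew_def)
    then have "T u 0 (skew (r * hh (koszul u k l) (koszul u k' l'))) \<circ> (T u ?y 0 \<circ> T u ?x 0) = T u ?x 0 \<circ> T u ?y 0"
      using uu by (simp add: T_comp add.commute)
    then show "T u 0 (skew (r * hh (koszul u k l) (koszul u k' l'))) \<in> N"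
      by (rule N_commutator[OF g gE hE])
  qed
  ultimately have "1 \<in> K" by (intro koszul_ideal[OF u])
  then show ?thesis using assms by (simp add: K_def)
qed

text \<open>Conjugation by \<open>T u x 0\<close> turns \<open>T w 0 b\<close> into \<open>T (w + scl (hh x w) u) 0 b\<close>; up to factors in \<open>N\<close>
  this is \<open>T (scl (hh x w) u) 0 b\<close>, and the values \<open>hh x w\<close> at Koszul vectors generate the unit ideal.\<close>

lemma N_T_Gam:
  assumes u: "column u" and "b \<in> \<Gamma>"
  shows "T u 0 b \<in> N"
proof -
  define K where "K = {s. \<forall>b\<in>\<Gamma>. T u 0 (s * b * bar s) \<in> N}"
  have uu: "hh u u = 0" using u by (rule column_hh)
  have "is_ideal K"
    unfolding is_ideal_def
  proof (intro conjI ballI allI)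
    show "0 \<in> K" by (simp add: K_def N_id)
    \<comment> \<open>Since lam bar(b) = -b, the cross terms of (s + t) b bar(s + t) combine to
      \<open>skew (s * b * bar t)\<close>, whose argument lies in I; \<open>N_T_skew\<close> removes
      it.\<close>
    show "s + t \<in> K" if "s \<in> K" "t \<in> K" for s t
      unfolding K_def
    proof (intro CollectI ballI)
      fix b assume b: "b \<in> \<Gamma>"
      then have lb: "lam * bar b = - b" using Gam_Lam Lam_skew by blast
      have "lam * bar (s * b * bar t) = (lam * bar b) * (bar s * t)" by (simp add: mult_ac)
      then have "skew (s * b * bar t) = s * b * bar t + t * b * bar s"
        unfolding skew_def lb by (simp add: mult_ac)
      then have "(s + t) * b * bar (s + t) = s * b * bar s + (t * b * bar t + skew (s * b * bar t))"
        by (simp add: algebra_simps)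
      then have "T u 0 ((s + t) * b * bar (s + t)) = T u 0 (s * b * bar s) \<circ> (T u 0 (t * b * bar t) \<circ> T u 0 (skew (s * b * bar t)))"
        by (simp add: T_comp uu)
      moreover have "s * b * bar t \<in> I" using b by (auto intro: I_mult Gam_I)
      ultimately show "T u 0 ((s + t) * b * bar (s + t)) \<in> N"
        using that b N_comp N_T_skew[OF u] by (auto simp: K_def)
    qed
    show "r * s \<in> K" if "s \<in> K" for r s
      unfolding K_def
    proof (intro CollectI ballI)
      fix b assume "b \<in> \<Gamma>"
      then have "r * b * bar r \<in> \<Gamma>" by (rule Gam_conj)
      then have "T u 0 (s * (r * b * bar r) * bar s) \<in> N" using that by (auto simp: K_def)
      then show "T u 0 (r * s * b * bar (r * s)) \<in> N" by (simp add: mult_ac)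
    qed
  qed
  moreover have "hh (koszul u k l) (koszul u k' l') \<in> K"
    if k: "k \<in> Om n" "l \<in> Om n" "k' \<in> Om n" "l' \<in> Om n" "k \<noteq> - l" "k' \<noteq> - l'" for k l k' l'
    unfolding K_def
  proof (intro CollectI ballI)
    fix b assume b: "b \<in> \<Gamma>"
    let ?x = "koszul u k l" and ?w = "koszul u k' l'"
    define s where "s = hh ?x ?w"
    let ?g = "T u ?x 0"
    have g: "?g \<in> EE" using T_column_koszul_EE[OF u k(1,2,5), of 1] by simp
    have gw: "?g ?w = ?w + scl s u" by (simp add: T_def s_def)
    have bL: "b \<in> \<Lambda>" and bI: "b \<in> I" using b by (auto intro: Gam_Lam Gam_I)
    have "rel (T ?w 0 b) (T ?w 0 0)"
      unfolding koszul_def using k b bL by (intro rel_T_two) (auto simp: qcong_def veq_def)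
    then have w: "rel (T ?w 0 b) id" by simp
    have "rel (T (?w + scl s u) 0 b) id"
    proof (rule rel_conj[OF rel_refl[OF g] w])
      show "?g \<circ> T ?w 0 b = T (?w + scl s u) 0 b \<circ> ?g"
        using T_conj[OF EE_uni[OF g], of ?w 0 b] unfolding gw uniD(8)[OF EE_uni[OF g]] .
    qed simp
    moreover have "T (?w + scl s u) 0 b = T ?w 0 b \<circ> T (scl s u) 0 b \<circ> T ?w (scl b (scl s u)) 0"
    proof (rule T_split)
      show "hh ?w ?w = 0" using k by (simp add: koszul_def)
    qed (use uu bL in \<open>simp_all add: Lam_skew\<close>)
    moreover have "rel (T ?w (scl b (scl s u)) 0) id"
    proof -
      have e: "T ?w (scl b (scl s u)) 0 = T (two k' (bar (b * s) * phi u l') l' (bar (b * s) * - phi u k')) u 0"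
        unfolding scl_two[symmetric] koszul_def[symmetric] T_scale by simp
      have "hh (scl (bar (b * s)) ?w) u = 0" by simp
      then have h: "hh (two k' (bar (b * s) * phi u l') l' (bar (b * s) * - phi u k')) u = 0"
        by (simp only: koszul_def scl_two)
      have "- ff u u \<in> \<Lambda>" using u Lam_minus by (auto simp: column_def)
      then have "rel (T (two k' (bar (b * s) * phi u l') l' (bar (b * s) * - phi u k')) u 0) (T (two k' 0 l' 0) u 0)"
        using u k bI h by (intro rel_T_two)
          (auto simp: qcong_def veq_def column_def simp del: bar_mult intro: I_mult I_bar I_minus)
      then show ?thesis using e by simp
    qed
    ultimately have "rel (T ?w 0 b \<circ> T (scl s u) 0 b) id"
      using rel_cancel_right[of _ _ id id] by fastforce
    then have "rel (T (scl s u) 0 b) id"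
      using rel_cancel_left[OF _ w, of _ id] by simp
    then show "T u 0 (hh ?x ?w * b * bar (hh ?x ?w)) \<in> N"
      by (simp add: T_scale rel_id_iff mult_ac flip: s_def)
  qed
  ultimately have "1 \<in> K" by (intro koszul_ideal[OF u])
  then show ?thesis using assms by (simp add: K_def)
qed

definition Iorth :: "(int \<Rightarrow> 'a) \<Rightarrow> (int \<Rightarrow> 'a) set" where
  "Iorth u = {y \<in> VV. (\<forall>k. y k \<in> I) \<and> hh u y = 0}"

definition YY :: "(int \<Rightarrow> 'a) \<Rightarrow> (int \<Rightarrow> 'a) set" where
  "YY u = {y \<in> Iorth u. \<forall>b. b - ff y y \<in> \<Gamma> \<longrightarrow> T u y b \<in> N}"

text \<open>The aim is 1 in \<open>GG u\<close>. Quantifying over the module \<open>Iorth u\<close>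
  makes this set an ideal, whereas \<open>YY u\<close> is shown only to be additive.\<close>

definition GG :: "(int \<Rightarrow> 'a) \<Rightarrow> 'a set" where
  "GG u = {r. \<forall>y\<in>Iorth u. scl r y \<in> YY u}"

lemma Iorth_add: "y \<in> Iorth u \<Longrightarrow> z \<in> Iorth u \<Longrightarrow> y + z \<in> Iorth u"
  by (auto simp: Iorth_def intro: I_add)

lemma Iorth_scl: "y \<in> Iorth u \<Longrightarrow> scl r y \<in> Iorth u"
  by (auto simp: Iorth_def intro: I_mult)

lemma YY_0:
  assumes "column u" shows "0 \<in> YY u"
  using assms N_T_Gam by (auto simp: YY_def Iorth_def)

lemma YY_add:
  assumes "column u" "y \<in> YY u" "z \<in> YY u"
  shows "y + z \<in> YY u"
  unfolding YY_def
proof (intro CollectI conjI allI impI)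
  show "y + z \<in> Iorth u" using assms by (auto simp: YY_def intro: Iorth_add)
  fix b assume b: "b - ff (y + z) (y + z) \<in> \<Gamma>"
  define b1 where "b1 = b - ff z z - hh y z"
  have "\<forall>k. y k \<in> I" using assms by (auto simp: YY_def Iorth_def)
  then have "skew (ff z y) \<in> \<Gamma>" by (intro Gam_skew ff_in_I) auto
  moreover have "b1 - ff y y = (b - ff (y + z) (y + z)) + skew (ff z y)"
    by (simp add: b1_def hh_def skew_def)
  ultimately have "b1 - ff y y \<in> \<Gamma>" using b Gam_add by metis
  then have "T u y b1 \<in> N" using assms by (auto simp: YY_def)
  moreover have "T u z (ff z z) \<in> N" using assms by (auto simp: YY_def)
  moreover have "T u (y + z) b = T u y b1 \<circ> T u z (ff z z)"
    using assms column_hh by (subst T_comp) (auto simp: YY_def Iorth_def b1_def)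
  ultimately show "T u (y + z) b \<in> N" by (simp add: N_comp)
qed

lemma YY_sum: "column u \<Longrightarrow> (\<And>k. k \<in> A \<Longrightarrow> g k \<in> YY u) \<Longrightarrow> sum g A \<in> YY u"
proof (induction A rule: infinite_finite_induct)
  case (insert k A)
  then show ?case unfolding sum.insert[OF insert.hyps] by (intro YY_add) auto
qed (simp_all add: YY_0)

lemma GG_ideal:
  assumes "column u" shows "is_ideal (GG u)"
  unfolding is_ideal_def
proof (intro conjI ballI allI)
  show "0 \<in> GG u" using YY_0[OF assms] by (simp add: GG_def)
  show "x + y \<in> GG u" if "x \<in> GG u" "y \<in> GG u" for x y
    using that YY_add[OF assms] by (simp add: GG_def scl_add)
  show "r * x \<in> GG u" if "x \<in> GG u" for r x
  proof -
    have "scl x (scl r y) \<in> YY u" if "y \<in> Iorth u" for y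
      using \<open>x \<in> GG u\<close> Iorth_scl[OF that] unfolding GG_def by blast
    then show ?thesis by (simp add: GG_def mult.commute)
  qed
qed

lemma YY_koszul:
  assumes "column u" "k \<in> Om n" "l \<in> Om n" "k \<noteq> - l" "r \<in> I"
  shows "scl r (koszul u k l) \<in> YY u"
  unfolding YY_def
proof (intro CollectI conjI allI impI)
  show "scl r (koszul u k l) \<in> Iorth u" using assms by (auto simp: Iorth_def intro: I_mult)
  fix b assume "b - ff (scl r (koszul u k l)) (scl r (koszul u k l)) \<in> \<Gamma>"
  then have "b \<in> \<Gamma>" using assms by simp
  have "T u (scl r (koszul u k l)) b = T u (scl r (koszul u k l)) 0 \<circ> T u 0 b"
    using column_hh assms by (simp add: T_comp)
  then show "T u (scl r (koszul u k l)) b \<in> N"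
    using N_comp N_T_koszul[OF assms] N_T_Gam[OF assms(1) \<open>b \<in> \<Gamma>\<close>] by simp
qed

text \<open>phi_l y is a sum of Koszul vectors x_kl, of which only x_-l,l is not allowed. The second
  factor phi_m repairs this through the relation phi_m x_-l,l = phi_l x_-l,m - phi_-l x_l,m.\<close>

lemma GG_phi_phi:
  assumes u: "column u" and l: "l \<in> Om n" and m: "m \<in> Om n" "m \<noteq> l" "m \<noteq> - l"
  shows "phi u l * phi u m \<in> GG u"
  unfolding GG_def
proof (intro CollectI ballI)
  fix y assume y: "y \<in> Iorth u"
  have "scl (phi u l * phi u m) y = scl (phi u l) (scl (phi u m) y)" by simp
  also have "\<dots> = (\<Sum>k\<in>Om n. scl (phi u m * y k) (koszul u k l))"
    using y by (subst scl_phi_eq_sum) (auto simp: Iorth_def)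
  also have "\<dots> \<in> YY u"
  proof (rule YY_sum[OF u])
    fix k assume k: "k \<in> Om n"
    have yI: "y k \<in> I" using y by (auto simp: Iorth_def)
    show "scl (phi u m * y k) (koszul u k l) \<in> YY u"
    proof (cases "k = - l")
      case False
      then show ?thesis using u k l yI by (intro YY_koszul) (auto intro: I_mult)
    next
      case True
      have "scl (phi u m * y k) (koszul u k l) = scl (y k * phi u l) (koszul u (- l) m) + scl (- (y k * phi u (- l))) (koszul u l m)"
        unfolding True by (auto simp: fun_eq_iff koszul_def two_def algebra_simps)
      moreover have "scl (y k * phi u l) (koszul u (- l) m) \<in> YY u" "scl (- (y k * phi u (- l))) (koszul u l m) \<in> YY u"
        using u l m yI by (auto intro!: YY_koszul intro: I_mult I_minus)
      ultimately show ?thesis using YY_add[OF u] by simp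
    qed
  qed
  finally show "scl (phi u l * phi u m) y \<in> YY u" .
qed

text \<open>The square arises from mixed products by an elementary change of basis
  replacing \<open>phi u l\<close> by \<open>phi u l + phi u k\<close>.\<close>

lemma GG_phi_sq:
  assumes u: "column u" and k: "k \<in> Om n"
  shows "phi u k * phi u k \<in> GG u"
proof -
  obtain l where l: "l \<in> Om n" "l \<noteq> k" "l \<noteq> - k" using ex_Om by blast
  define e e' where "e = T (bas k) (scl (- th (- l)) (bas (- l))) 0" and "e' = T (bas k) (scl (th (- l)) (bas (- l))) 0"
  have e: "e \<in> EE" "e' \<in> EE" unfolding e_def e'_def using k l by (auto intro!: EE_short1)
  have inv: "e' \<circ> e = id"
    unfolding e_def e'_def using k l by (subst T_comp) (auto simp: hh_bas_bas simp flip: scl_add)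
  have e'b: "e' (bas k) = bas k" "e' (bas l) = bas l + bas k"
    using k l by (auto simp: e'_def T_def hh_bas_left bas_apply)
  have ue: "uni e" "uni e'" using e EE_uni by auto
  have adj: "hh (e u) w = hh u (e' w)" for w
    using uniD(3)[OF ue(2), of "e u" w] inv by (metis comp_apply id_apply)
  have u': "column (e u)" using column_uni[OF u ue(1)] .
  have "phi (e u) l * phi (e u) k \<in> GG (e u)" using u' k l by (intro GG_phi_phi) auto
  then have r: "(phi u l + phi u k) * phi u k \<in> GG (e u)"
    by (simp add: phi_def adj e'b)
  \<comment> \<open>The multiplier passes back from \<open>e u\<close> to \<open>u\<close>: e
    carries \<open>Iorth u\<close> into \<open>Iorth (e u)\<close>, and on vectors with entries in I
    it changes f only within \<Gamma>, so the admissible scalars are the same.\<close>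
  have "(phi u l + phi u k) * phi u k \<in> GG u"
    unfolding GG_def
  proof (intro CollectI ballI)
    fix y assume y: "y \<in> Iorth u"
    define z where "z = scl ((phi u l + phi u k) * phi u k) y"
    have z: "z \<in> Iorth u" unfolding z_def using y by (rule Iorth_scl)
    have "e y \<in> Iorth (e u)"
      using y ue by (auto simp: Iorth_def uniD) (auto simp: e_def intro: T_I)
    moreover have "e z = scl ((phi u l + phi u k) * phi u k) (e y)"
      unfolding z_def by (rule uniD(2)[OF ue(1)])
    ultimately have ez: "e z \<in> YY (e u)" using r unfolding GG_def by simp
    have fz: "ff (e z) (e z) - ff z z \<in> \<Gamma>"
      unfolding e_def using k l z Lam_add by (intro ff_T_small) (auto simp: hh_bas_bas Iorth_def)
    show "z \<in> YY u"
      unfolding YY_def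
    proof (intro CollectI conjI allI impI)
      show "z \<in> Iorth u" by (fact z)
      fix b assume "b - ff z z \<in> \<Gamma>"
      then have "b - ff (e z) (e z) \<in> \<Gamma>" using Gam_diff[OF _ fz, of "b - ff z z"] by simp
      then have "T (e u) (e z) b \<in> N" using ez by (auto simp: YY_def)
      then obtain \<nu> where "\<nu> \<in> N" "e' \<circ> T (e u) (e z) b = \<nu> \<circ> e'" using N_norm e by blast
      moreover have "e' \<circ> T (e u) (e z) b = T u z b \<circ> e'"
        using T_conj[OF ue(2), of "e u" "e z" b] inv by (metis comp_apply id_apply)
      moreover obtain d where "e' \<circ> d = id" using EE_inv[OF e(2)] by blast
      ultimately have "T u z b = \<nu>" by (metis comp_assoc comp_id)
      then show "T u z b \<in> N" using \<open>\<nu> \<in> N\<close> by simp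
    qed
  qed
  moreover have "phi u l * phi u k \<in> GG u" using u k l by (intro GG_phi_phi) auto
  ultimately show ?thesis
    using is_ideal_diff[OF GG_ideal[OF u]] by (fastforce simp: algebra_simps)
qed

lemma N_T_column:
  assumes u: "column u" and "y \<in> VV" "\<And>k. y k \<in> I" "hh u y = 0" "b - ff y y \<in> \<Gamma>"
  shows "T u y b \<in> N"
proof -
  note G = GG_ideal[OF u]
  have sq: "phi u k * phi u m \<in> GG u" if "k \<in> Om n" "m \<in> Om n" "m \<noteq> - k" for k m
    using that GG_phi_phi[OF u, of k m] GG_phi_sq[OF u, of k] by (cases "m = k") auto
  have "phi u k * phi u (- k) \<in> GG u" if k: "k \<in> Om n" for k
  \<comment> \<open>After multiplication by phi_j there is always a factor already in the ideal:
    phi_k phi_j for j \<noteq> -k, and the square of phi_-k for j = -k.\<close>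
  proof (rule unimodular[OF u G])
    fix j assume j: "j \<in> Om n"
    show "phi u k * phi u (- k) * phi u j \<in> GG u"
    proof (cases "j = - k")
      case False
      then show ?thesis using is_ideal_mult(1)[OF G sq[OF k j], of "phi u (- k)"] by (simp add: algebra_simps)
    next
      case True
      have "phi u (- k) * phi u (- k) \<in> GG u" using k Om_neq_minus[OF k] by (intro sq) auto
      then show ?thesis using True is_ideal_mult(1)[OF G, of _ "phi u k"] by (simp add: mult.assoc)
    qed
  qed
  then have "phi u k * phi u m \<in> GG u" if "k \<in> Om n" "m \<in> Om n" for k m
    using that sq by (cases "m = - k") auto
  then have "phi u k \<in> GG u" if "k \<in> Om n" for k using unimodular[OF u G] that by blast
  then have "1 \<in> GG u" using unimodular[OF u G, of 1] by simp
  then show ?thesis using assms by (auto simp: GG_def YY_def Iorth_def)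
qed

end

section \<open>The full congruence subgroup\<close>

context hyperbolic
begin

lemma hh_bas_opp: "i \<in> Om n \<Longrightarrow> hh (bas i) (bas (- i)) = th i"
  by (simp add: hh_bas_bas)

lemma th_cancel:
  "bar (th i) * (y * (th i * z)) = y * z" "th i * (y * (bar (th i) * z)) = y * z"
  "bar (th i) * (y * th i) = y" "th i * (y * bar (th i)) = y"
  by (simp_all add: mult.left_commute[of y]) (simp_all add: mult.commute[of y])

lemma column_bas:
  assumes "i \<in> Om n" shows "column (bas i)"
  unfolding column_def
proof (intro conjI bexI)
  show "hh (bas i) (scl (bar (th i)) (bas (- i))) = 1"
    using assms by (simp add: hh_bas_opp)
qed (use assms in auto)

end

section \<open>Elementary maps satisfying the congruence conditions\<close>

context level
begin

lemma veq_refl [simp]: "veq v v"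
  by (simp add: veq_def)

lemma hh_veq:
  assumes "veq v v'" "veq w w'" shows "hh v w - hh v' w' \<in> I"
proof -
  have "lam * (bar (ff w v) - bar (ff w' v')) \<in> I"
    using ff_veq[OF assms(2,1)] by (intro I_mult I_bar_diff)
  then have "(ff v w - ff v' w') + lam * (bar (ff w v) - bar (ff w' v')) \<in> I"
    by (intro I_add ff_veq assms)
  then show ?thesis by (simp add: hh_def algebra_simps)
qed

text \<open>Chosen as an instance of \<open>relative\<close>: general results about N then give both
  membership in \<open>EE\<close> and the congruence conditions defining the full congruence
  subgroup.\<close>

definition UC :: "((int \<Rightarrow> 'a) \<Rightarrow> (int \<Rightarrow> 'a)) set" where
  "UC = {\<rho> \<in> EE. \<forall>v. veq (\<rho> v) v \<and> ff (\<rho> v) (\<rho> v) - ff v v \<in> \<Gamma>}"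

lemma veq_sym: "veq v w \<Longrightarrow> veq w v"
  unfolding veq_def using I_minus by fastforce

lemma veq_trans: "veq v w \<Longrightarrow> veq w x \<Longrightarrow> veq v x"
  unfolding veq_def by (metis I_add diff_add_cancel add_diff_eq)

lemma veq_I: "veq v w \<Longrightarrow> v k - w k \<in> I"
  by (simp add: veq_def)

lemma UC_T:
  assumes v: "\<And>k. v k \<in> I" and i: "i \<in> Om n" and "hh (bas i) v = 0" "ff v v = 0" "b \<in> \<Gamma>"
    and "T (bas i) v b \<in> EE"
  shows "T (bas i) v b \<in> UC"
  unfolding UC_def
proof (intro CollectI conjI allI)
  fix w
  have P: "hh v w \<in> I" using v by (rule hh_in_I)
  have bI: "b \<in> I" "b \<in> \<Lambda>" using assms by (auto intro: Gam_I Gam_Lam)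
  define a where "a = hh v w - bar lam * b * hh (bas i) w"
  have a: "a \<in> I" unfolding a_def using P bI by (intro I_diff I_mult)
  have d: "(scl a (bas i) - scl (bar lam * hh (bas i) w) v) k \<in> I" for k
    using a v by (auto intro!: I_diff intro: I_mult)
  have "T (bas i) v b w - w = scl a (bas i) - scl (bar lam * hh (bas i) w) v"
    by (auto simp: fun_eq_iff T_def a_def algebra_simps)
  then show "veq (T (bas i) v b w) w" using d unfolding veq_def by (metis fun_diff_def)
  have F: "ff (scl (- (bar lam * hh (bas i) w)) v) x \<in> I" for x
    using v by (intro ff_in_I) (simp add: I_minus I_mult)
  have "bar (hh v w) * hh (bas i) w \<in> I" using P by (intro I_mult I_bar)
  moreover have "ff w (scl a (bas i) - scl (bar lam * hh (bas i) w) v) \<in> I"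
    using d by (rule ff_in_I)
  moreover have "hh (bas i) w * (skew (ff v v) + (b - ff v v)) * bar (hh (bas i) w) \<in> \<Gamma>"
    using assms Gam_conj by simp
  moreover have "a * ff (bas i) (bas i) * bar a \<in> \<Gamma>" by simp
  moreover have "b - ff v v \<in> \<Lambda>" using bI assms by simp
  ultimately show "ff (T (bas i) v b w) (T (bas i) v b w) - ff w w \<in> \<Gamma>"
    unfolding ff_T[OF hh_bas_self assms(3) \<open>b - ff v v \<in> \<Lambda>\<close>] a_def[symmetric]
    using F by (intro Gam_add Gam_skew)
qed (fact assms)

lemma EE_ff_small:
  assumes "g \<in> EE" "\<And>k. y k \<in> I"
  shows "(\<forall>k. g y k \<in> I) \<and> ff (g y) (g y) - ff y y \<in> \<Gamma>"
  using assms
proof (induction g rule: EE.induct)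
  case (EE_short g i k s)
  then have g: "\<And>k. g y k \<in> I" "ff (g y) (g y) - ff y y \<in> \<Gamma>" by auto
  let ?t = "T (bas i) (scl s (bas k)) 0"
  have t: "ff (?t (g y)) (?t (g y)) - ff (g y) (g y) \<in> \<Gamma>"
    using EE_short g Lam_add by (intro ff_T_small) (auto simp: hh_bas_bas)
  show ?case using Gam_add[OF t g(2)] T_I[OF g(1)] by simp
next
  case (EE_long g i b)
  then have g: "\<And>k. g y k \<in> I" "ff (g y) (g y) - ff y y \<in> \<Gamma>" by auto
  let ?t = "T (bas i) 0 b"
  have t: "ff (?t (g y)) (?t (g y)) - ff (g y) (g y) \<in> \<Gamma>"
    using EE_long g Lam_add by (intro ff_T_small) (auto simp: hh_bas_bas)
  show ?case using Gam_add[OF t g(2)] T_I[OF g(1)] by simp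
qed simp

lemma EE_veq:
  assumes "g \<in> EE" "veq v w" shows "veq (g v) (g w)"
proof -
  have "g v - g w = g (v - w)" using uniD(7)[OF EE_uni[OF assms(1)]] by simp
  moreover have "\<forall>k. g (v - w) k \<in> I"
    using assms EE_ff_small[of g "v - w"] by (simp add: veq_def)
  ultimately show ?thesis unfolding veq_def by (metis fun_diff_def)
qed

text \<open>For v = w + y with y small, the cross terms of f change by \<open>skew\<close> of an
  element of I because g preserves h, and \<open>EE_ff_small\<close> covers y. This is what makes
  \<open>UC\<close> normalized by \<open>EE\<close>.\<close>

lemma EE_ff_veq:
  assumes g: "g \<in> EE" and "veq v w"
  shows "(ff (g v) (g v) - ff v v) - (ff (g w) (g w) - ff w w) \<in> \<Gamma>"
proof -
  define y where "y = v - w"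
  have v: "v = w + y" by (simp add: y_def)
  have y: "\<And>k. y k \<in> I" using assms by (simp add: y_def veq_def)
  note u = EE_uni[OF g]
  define c where "c = ff (g w) (g y) - ff w y"
  have "c \<in> I" unfolding c_def using y EE_ff_small[OF g y] by (intro I_diff ff_in_I) auto
  have "hh (g y) (g w) = hh y w" using u by (rule uniD(3))
  then have "ff (g y) (g w) - ff y w = - (lam * bar c)"
    unfolding ff_swap_add[of "g y" "g w"] ff_swap_add[of y w] c_def by (simp add: algebra_simps)
  then have "(ff (g v) (g v) - ff v v) - (ff (g w) (g w) - ff w w) = skew c + (ff (g y) (g y) - ff y y)"
    unfolding v uniD(1)[OF u] by (simp add: skew_def c_def algebra_simps)
  then show ?thesis using \<open>c \<in> I\<close> EE_ff_small[OF g y] by (simp add: Gam_add Gam_skew)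
qed

end

sublocale level \<subseteq> uc: relative n bar lam \<Lambda> I \<Gamma> UC
proof unfold_locales
  show "id \<in> UC" by (simp add: UC_def EE_id)
next
  fix \<nu> \<mu> assume "\<nu> \<in> UC" "\<mu> \<in> UC"
  then have "\<nu> \<circ> \<mu> \<in> EE" "veq (\<nu> (\<mu> v)) v" "ff (\<nu> (\<mu> v)) (\<nu> (\<mu> v)) - ff v v \<in> \<Gamma>" for v
    using EE_comp veq_trans[of "\<nu> (\<mu> v)" "\<mu> v" v]
      Gam_add[of "ff (\<nu> (\<mu> v)) (\<nu> (\<mu> v)) - ff (\<mu> v) (\<mu> v)" "ff (\<mu> v) (\<mu> v) - ff v v"]
    by (auto simp: UC_def)
  then show "\<nu> \<circ> \<mu> \<in> UC" by (simp add: UC_def)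
next
  fix \<nu> assume \<nu>: "\<nu> \<in> UC"
  then obtain \<mu> where \<mu>: "\<mu> \<in> EE" "\<mu> \<circ> \<nu> = id" "\<nu> \<circ> \<mu> = id" using EE_inv by (auto simp: UC_def)
  have e: "\<nu> (\<mu> v) = v" for v using \<mu> by (metis comp_apply id_apply)
  have "veq (\<mu> v) v" "ff (\<mu> v) (\<mu> v) - ff v v \<in> \<Gamma>" for v
    using \<nu> veq_sym[of v "\<mu> v"] Gam_minus[of "ff v v - ff (\<mu> v) (\<mu> v)"] e[of v]
    by (auto simp: UC_def dest!: spec[of _ "\<mu> v"])
  then show "\<exists>\<nu>'\<in>UC. \<nu>' \<circ> \<nu> = id \<and> \<nu> \<circ> \<nu>' = id" using \<mu> by (auto simp: UC_def)
next
  fix g \<nu> assume g: "g \<in> EE" and \<nu>: "\<nu> \<in> UC"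
  obtain g' where g': "g' \<in> EE" "g' \<circ> g = id" "g \<circ> g' = id" using EE_inv[OF g] by blast
  have e: "g (g' v) = v" for v using g' by (metis comp_apply id_apply)
  have "g \<circ> \<nu> \<circ> g' \<in> EE" using g g' \<nu> by (auto simp: UC_def intro!: EE_comp)
  moreover have "veq (g (\<nu> (g' v))) v" for v
    using EE_veq[OF g, of "\<nu> (g' v)" "g' v"] \<nu> by (simp add: UC_def e)
  moreover have "ff (g (\<nu> (g' v))) (g (\<nu> (g' v))) - ff v v \<in> \<Gamma>" for v
    using EE_ff_veq[OF g, of "\<nu> (g' v)" "g' v"] \<nu>
      Gam_add[of "(ff (g (\<nu> (g' v))) (g (\<nu> (g' v))) - ff (\<nu> (g' v)) (\<nu> (g' v))) - (ff v v - ff (g' v) (g' v))"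
        "ff (\<nu> (g' v)) (\<nu> (g' v)) - ff (g' v) (g' v)"]
    by (simp add: UC_def e)
  ultimately have "g \<circ> \<nu> \<circ> g' \<in> UC" by (simp add: UC_def)
  moreover have "g \<circ> \<nu> = (g \<circ> \<nu> \<circ> g') \<circ> g" using g' by (simp add: comp_assoc)
  ultimately show "\<exists>\<nu>'\<in>UC. g \<circ> \<nu> = \<nu>' \<circ> g" by blast
next
  fix i k s assume *: "i \<in> Om n" "k \<in> Om n" "k \<noteq> i" "k \<noteq> - i" "s \<in> I"
  then show "T (bas i) (scl s (bas k)) 0 \<in> UC"
    using EE_short1[OF *(1-4)] by (intro UC_T) (simp_all add: hh_bas_bas I_mult)
next
  fix i b assume *: "i \<in> Om n" "b \<in> \<Gamma>"
  then show "T (bas i) 0 b \<in> UC"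
    using EE_long1[OF *(1) Gam_Lam[OF *(2)]] by (intro UC_T) simp_all
qed

section \<open>Maps that are scalar modulo I\<close>

context level
begin

definition scalar :: "((int \<Rightarrow> 'a) \<Rightarrow> (int \<Rightarrow> 'a)) \<Rightarrow> 'a \<Rightarrow> bool" where
  "scalar g c \<longleftrightarrow> (\<forall>i\<in>Om n. veq (g (bas i)) (scl c (bas i)))"

lemma scalar_unit:
  assumes g: "uni g" "scalar g c"
  shows "bar c * c - 1 \<in> I"
proof -
  obtain i where i: "i \<in> Om n" using ex_Om by blast
  then have "hh (g (bas i)) (g (bas (- i))) - hh (scl c (bas i)) (scl c (bas (- i))) \<in> I"
    using g by (intro hh_veq) (auto simp: scalar_def)
  then have "th i - c * (bar c * th i) \<in> I"
    using i by (simp add: uniD(3)[OF g(1)] hh_bas_opp)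
  then have "- (bar (th i) * (th i - c * (bar c * th i))) \<in> I" by (intro I_minus I_mult)
  moreover have "- (bar (th i) * (th i - c * (bar c * th i))) = c * bar c * (bar (th i) * th i) - bar (th i) * th i"
    by (simp only: algebra_simps minus_diff_eq)
  ultimately show ?thesis by (simp add: mult.commute)
qed

lemma I_1_mult: "x - 1 \<in> I \<Longrightarrow> y - 1 \<in> I \<Longrightarrow> x * y - 1 \<in> I"
  using I_mult_diff[of x 1 y 1] by simp

lemma scalar_diag:
  assumes g: "uni g" "scalar g c" "i \<in> Om n" "j \<in> Om n"
  shows "g (bas i) i * bar (g (bas j) j) - 1 \<in> I"
proof -
  have "g (bas k) k - c \<in> I" if "k \<in> Om n" for k
    using g(2) that veq_I[of "g (bas k)" "scl c (bas k)" k] by (simp add: scalar_def bas_apply)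
  then have "g (bas i) i * bar (g (bas j) j) - c * bar c \<in> I"
    using assms by (intro I_mult_diff I_bar_diff) auto
  then have "(g (bas i) i * bar (g (bas j) j) - c * bar c) + (bar c * c - 1) \<in> I"
    using scalar_unit[OF g(1,2)] by (rule I_add)
  then show ?thesis by (simp add: mult.commute)
qed

text \<open>With r = q - 1 the difference is r b + b r + r b r, and lam bar(r b) = - b r turns the
  first two terms into \<open>skew (r * b)\<close>.\<close>

lemma norm_conj_Gam:
  assumes "bar q = q" "q - 1 \<in> I" "b \<in> \<Lambda>"
  shows "q * b * q - b \<in> \<Gamma>"
proof -
  have "lam * bar ((q - 1) * b) = (lam * bar b) * (q - 1)" by (simp add: assms(1) mult_ac)
  also have "\<dots> = - b * (q - 1)" using assms(3) by (simp only: Lam_skew)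
  finally have "q * b * q - b = skew ((q - 1) * b) + (q - 1) * b * bar (q - 1)"
    unfolding skew_def by (simp add: assms(1) algebra_simps)
  then show ?thesis
    using assms(2,3) Gam_add[OF Gam_skew Gam_I_conj] by (metis I_mult(2))
qed

lemma scalar_off:
  assumes "scalar g c" "i \<in> Om n" "k \<noteq> i" shows "g (bas i) k \<in> I"
  using assms veq_I[of "g (bas i)" "scl c (bas i)" k] by (simp add: scalar_def bas_apply)

end

context relative
begin

lemma qcong_column:
  assumes g: "uni g" "scalar g c" and i: "i \<in> Om n" and f: "ff (g (bas i)) (g (bas i)) \<in> \<Gamma>"
  shows "qcong (scl r (g (bas i))) 0 (scl (r * g (bas i) i) (bas i)) 0"
proof -
  have "veq (scl r (g (bas i))) (scl (r * g (bas i) i) (bas i))"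
    using scalar_off[OF g(2) i] by (auto simp: veq_def bas_apply intro: I_mult)
  moreover have "- ff (scl r (g (bas i))) (scl r (g (bas i))) \<in> \<Gamma>"
    using Gam_minus[OF Gam_conj[OF f, of r]] by (simp add: mult_ac)
  moreover have "g (bas i) \<in> VV" using uniD(5)[OF g(1)] i by simp
  ultimately show ?thesis using i Gam_Lam by (simp add: qcong_def)
qed

text \<open>After \<open>T_sym\<close> the column is the vector and not the direction, and
  \<open>qcong_column\<close> replaces it by its diagonal part.\<close>

lemma rel_column_two:
  assumes g: "uni g" "scalar g c" and i: "i \<in> Om n" and f: "ff (g (bas i)) (g (bas i)) \<in> \<Gamma>"
    and k: "k \<in> Om n" "k \<noteq> i" "k \<noteq> - i" and "\<beta> \<in> I" "hh (g (bas i)) (two k \<alpha> (- i) \<beta>) = 0"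
  shows "rel (T (g (bas i)) (two k \<alpha> (- i) \<beta>) 0) (T (scl (g (bas i) i) (bas i)) (scl \<alpha> (bas k)) 0)"
proof -
  have "rel (T (two k \<alpha> (- i) \<beta>) (scl (- lam) (g (bas i))) 0)
      (T (two k \<alpha> (- i) 0) (scl (- lam * g (bas i) i) (bas i)) 0)"
    using assms hh_zero_swap[OF assms(9)]
    by (intro rel_T_two qcong_column) (auto simp: two_def hh_bas_bas)
  then show ?thesis
    unfolding T_sym[of "g (bas i)"] T_sym[of "scl (g (bas i) i) (bas i)"] by (simp add: two_def)
qed

text \<open>The instance \<open>N = UC\<close> of \<open>N_T_column\<close> supplies the membership in \<open>EE\<close>, since \<open>UC \<subseteq> EE\<close>.\<close>

lemma rel_T_column_id:
  assumes "column u" "y \<in> VV" "\<And>k. y k \<in> I" "hh u y = 0" "b - ff y y \<in> \<Gamma>"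
  shows "rel (T u y b) id"
  using N_T_column[OF assms] uc.N_T_column[OF assms] by (simp add: rel_id_iff UC_def)

text \<open>\<open>phi u (- i)\<close> is invertible only modulo I, with \<open>t\<close> arranged
  so that \<open>t * phi u (- i) = x * q\<close> and q = 1 modulo I. The Koszul multiple
  \<open>A\<close> has the same coordinate at \<open>m\<close> as \<open>scl (x * q) v\<close>, so
  the difference \<open>Y\<close> has entries in I. Both \<open>Y\<close> and
  \<open>scl (x * (1 - q)) v\<close> are trivial by \<open>rel_T_column_id\<close>, and
  \<open>A\<close> is handled by \<open>rel_column_two\<close>.\<close>

lemma rel_column_short:
  assumes g: "uni g" "scalar g c" and i: "i \<in> Om n" and m: "m \<in> Om n" "m \<noteq> i" "m \<noteq> - i"
    and f: "ff (g (bas i)) (g (bas i)) \<in> \<Gamma>" "ff (g (bas m)) (g (bas m)) \<in> \<Gamma>"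
  shows "rel (T (g (bas i)) (scl x (g (bas m))) 0) (T (bas i) (scl x (bas m)) 0)"
proof -
  define u v where "u = g (bas i)" and "v = g (bas m)"
  have u: "column u" using column_uni[OF column_bas[OF i] g(1)] by (simp add: u_def)
  have uu: "hh u u = 0" using u by (rule column_hh)
  have uv: "hh u v = 0" unfolding u_def v_def uniD(3)[OF g(1)] using i m by (simp add: hh_bas_bas)
  have vv: "hh v v = 0" using f Gam_Lam hh_self_0 by (simp add: v_def)
  have vV: "v \<in> VV" using uniD(5)[OF g(1)] m by (simp add: v_def)
  define q where "q = u i * bar (u i)"
  have q: "q - 1 \<in> I" unfolding q_def u_def using g i i by (rule scalar_diag)
  then have q': "1 - q \<in> I" using I_minus[of "q - 1"] by simp
  have vk: "v k \<in> I" if "k \<noteq> m" for k unfolding v_def using g(2) m(1) that by (rule scalar_off)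
  have um: "u (- m) \<in> I" unfolding u_def using g(2) i m by (intro scalar_off) auto
  define t where "t = x * bar (phi u (- i))"
  have tq: "t * phi u (- i) = x * q" using i by (simp add: t_def phi_opp q_def mult.assoc th_cancel)
  define A where "A = scl (v m * t) (koszul u m (- i))"
  define Y where "Y = scl (x * q) v - A"
  have YI: "Y k \<in> I" for k
  proof -
    have "Y k = (if k = m then v m * (x * q - t * phi u (- i)) else x * q * v k
        + (if k = - i then v m * t * phi u m else 0))"
      using m by (auto simp: Y_def A_def koszul_def two_apply algebra_simps)
    moreover have "phi u m = th (- m) * bar (u (- m))" using m by (simp add: phi_def hh_bas_right)
    then have "phi u m \<in> I" using um by (simp add: I_mult I_bar)
    ultimately show ?thesis using vk[of k] by (auto simp: tq intro: I_add I_mult)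
  qed
  have AV: "A \<in> VV" using m i by (simp add: A_def)
  have hA: "hh u A = 0" by (simp add: A_def)
  have hY: "hh u Y = 0" using hA uv by (simp add: Y_def)
  have W: "Y + A = scl (x * q) v" by (simp add: Y_def)
  have fA: "ff A A = 0" using m by (simp add: A_def)
  have Y: "rel (T u Y (- hh Y A)) id"
  proof (rule rel_T_column_id[OF u _ YI hY])
    show "Y \<in> VV" using AV vV by (simp add: Y_def)
    have "ff (Y + A) (Y + A) = x * q * ff v v * bar (x * q)" unfolding W by (simp add: mult_ac)
    moreover have "x * q * ff v v * bar (x * q) \<in> \<Gamma>" unfolding v_def using f(2) by (rule Gam_conj)
    ultimately have "ff (Y + A) (Y + A) \<in> \<Gamma>" by simp
    moreover have "skew (ff A Y) \<in> \<Gamma>" using YI by (intro Gam_skew ff_in_I)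
    moreover have "- hh Y A - ff Y Y = skew (ff A Y) - ff (Y + A) (Y + A)"
      using fA by (simp add: hh_def skew_def)
    ultimately show "- hh Y A - ff Y Y \<in> \<Gamma>" by (simp only: Gam_diff)
  qed
  have A: "rel (T u A 0) (T (bas i) (scl x (bas m)) 0)"
  proof -
    have A2: "A = two m (v m * t * phi u (- i)) (- i) (v m * t * - phi u m)"
      by (simp only: A_def koszul_def scl_two)
    have "phi u m = th (- m) * bar (u (- m))" using m by (simp add: phi_def hh_bas_right)
    then have "phi u m \<in> I" using um by (simp add: I_mult I_bar)
    then have "rel (T u A 0) (T (scl (u i) (bas i)) (scl (v m * t * phi u (- i)) (bas m)) 0)"
      unfolding A2 u_def using g i f m hA unfolding u_def A2
      by (intro rel_column_two) (auto simp: u_def[symmetric] intro: I_mult I_minus)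
    also have "T (scl (u i) (bas i)) (scl (v m * t * phi u (- i)) (bas m)) 0 = T (bas i) (scl ((v m * bar (u i)) * q * x) (bas m)) 0"
      unfolding T_scale mult.assoc tq by (simp add: mult_ac)
    also have "rel (T (bas i) (scl ((v m * bar (u i)) * q * x) (bas m)) 0) (T (bas i) (scl x (bas m)) 0)"
    proof (rule rel_short)
      have "v m * bar (u i) - 1 \<in> I" unfolding u_def v_def using g m(1) i by (rule scalar_diag)
      then have "(v m * bar (u i)) * q - 1 \<in> I" using q by (rule I_1_mult)
      then show "(v m * bar (u i)) * q * x - x \<in> I"
        using I_mult(2)[of "(v m * bar (u i)) * q - 1" x] by (simp add: algebra_simps)
    qed (use i m in auto)
    finally show ?thesis .
  qed
  have W2: "T u (scl (x * q) v) 0 = T u Y (- hh Y A) \<circ> T u A 0"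
    using uu hA hY by (subst T_comp) (simp_all add: W)
  have Z: "rel (T u (scl (x * (1 - q)) v) 0) id"
  proof (rule rel_T_column_id[OF u])
    have "0 - ff (scl (x * (1 - q)) v) (scl (x * (1 - q)) v) = - (x * (1 - q) * ff v v * bar (x * (1 - q)))"
      by (simp add: mult_ac)
    then show "0 - ff (scl (x * (1 - q)) v) (scl (x * (1 - q)) v) \<in> \<Gamma>"
      using Gam_minus[OF Gam_conj] f by (simp only: v_def)
  qed (use vV uv q' in \<open>auto intro: I_mult\<close>)
  have "T u (scl x v) 0 = T u (scl (x * (1 - q)) v) 0 \<circ> (T u Y (- hh Y A) \<circ> T u A 0)"
    unfolding W2[symmetric] using uu uv vv by (subst T_comp) (simp_all add: algebra_simps flip: scl_add)
  moreover have "rel (T u (scl (x * (1 - q)) v) 0 \<circ> (T u Y (- hh Y A) \<circ> T u A 0))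
      (id \<circ> (id \<circ> T (bas i) (scl x (bas m)) 0))"
    by (intro rel_comp Y Z A)
  ultimately show ?thesis by (simp only: u_def v_def id_comp)
qed

text \<open>Conjugating \<open>T W 0 b\<close> by \<open>T u X 0\<close> adds \<open>scl s u\<close>
  to \<open>W\<close>, and \<open>T_split\<close> isolates \<open>T (scl s u) 0 b\<close>. The same
  computation for the diagonal parts, marked by primes, is congruent factor by factor. As s bar(s) =
  q^2, the column side carries q b q, which equals b modulo \<Gamma>; the diagonal side carries one
  more factor q, from \<open>u' = scl (u i) (bas i)\<close>.\<close>

lemma rel_column_long:
  assumes g: "uni g" "scalar g c" and i: "i \<in> Om n" and f: "ff (g (bas i)) (g (bas i)) \<in> \<Gamma>"
    and b: "b \<in> \<Lambda>"
  defines "q \<equiv> g (bas i) i * bar (g (bas i) i)"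
  shows "rel (T (g (bas i)) 0 b) (T (bas i) 0 (q * (q * b * q)))"
proof -
  obtain k where k: "k \<in> Om n" "k \<noteq> i" "k \<noteq> - i" using ex_Om by blast
  define u u' where "u = g (bas i)" and "u' = scl (u i) (bas i)"
  have u: "column u" using column_uni[OF column_bas[OF i] g(1)] by (simp add: u_def)
  have uu: "hh u u = 0" using u by (rule column_hh)
  have qbar: "bar q = q" by (simp add: q_def mult.commute)
  have q1: "q - 1 \<in> I" unfolding q_def using g i i by (rule scalar_diag)
  define p where "p = phi u (- i)"
  have p: "p = th i * bar (u i)" using i by (simp add: p_def phi_opp)
  have pq: "bar p * p = q" by (simp add: p q_def u_def th_cancel mult.assoc)
  have small: "phi u j \<in> I" if "j \<in> Om n" "j \<noteq> - i" for j
  proof -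
    have "u (- j) \<in> I" unfolding u_def using g(2) i that by (intro scalar_off) auto
    then show ?thesis using that by (simp add: phi_def hh_bas_right I_mult I_bar)
  qed
  define X W where "X = koszul u k (- i)" and "W = koszul u (- k) (- i)"
  define X' W' where "X' = scl p (bas k)" and "W' = scl p (bas (- k))"
  have X: "X = two k p (- i) (- phi u k)" and W: "W = two (- k) p (- i) (- phi u (- k))"
    by (simp_all add: X_def W_def koszul_def p_def)
  have X': "X' = two k p (- i) 0" and W': "W' = two (- k) p (- i) 0"
    by (simp_all add: X'_def W'_def two_def)
  have uX: "hh u X = 0" "hh u W = 0" "hh W u = 0" by (simp_all add: X_def W_def)
  have uX': "hh u' X' = 0" "hh u' W' = 0" "hh W' u' = 0" "hh u' u' = 0"
    using i k by (simp_all add: u'_def X'_def W'_def hh_bas_bas)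
  have WW: "hh W W = 0" "hh W' W' = 0" using k by (simp_all add: W W')
  define s where "s = q * th k"
  have s: "hh X W = s" "hh X' W' = s"
    using i k Om_nonzero[OF i] by (auto simp: X W X'_def W'_def hh_two_left two_apply s_def pq[symmetric] Om_neq_minus hh_bas_opp mult_ac)
  define h h' where "h = T u X 0" and "h' = T u' X' 0"
  have h: "rel h h'"
    unfolding h_def h'_def X X'_def u_def u'_def
    using g i f k uX(1) small[of k] unfolding X u_def
    by (intro rel_column_two) (auto simp: u_def[symmetric] intro: I_minus)
  have hW: "h W = W + scl s u" "h' W' = W' + scl s u'"
    using uX uX' by (simp_all add: h_def h'_def T_def s)
  have uni: "uni h" "uni h'" using h rel_EE EE_uni by auto
  have w: "rel (T W 0 b) (T W' 0 b)"
    unfolding W W' using k i b small[of "- k"]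
    by (intro rel_T_two) (auto simp: qcong_def veq_def intro: I_minus)
  have "rel (T (W + scl s u) 0 b) (T (W' + scl s u') 0 b)"
  proof (rule rel_conj[OF h w])
    show "h \<circ> T W 0 b = T (W + scl s u) 0 b \<circ> h"
      using T_conj[OF uni(1), of W 0 b] unfolding hW uniD(8)[OF uni(1)] .
    show "h' \<circ> T W' 0 b = T (W' + scl s u') 0 b \<circ> h'"
      using T_conj[OF uni(2), of W' 0 b] unfolding hW uniD(8)[OF uni(2)] .
  qed
  moreover have "T (W + scl s u) 0 b = T W 0 b \<circ> T (scl s u) 0 b \<circ> T W (scl b (scl s u)) 0"
    by (rule T_split) (use WW uX uu b in \<open>simp_all add: Lam_skew\<close>)
  moreover have "T (W' + scl s u') 0 b = T W' 0 b \<circ> T (scl s u') 0 b \<circ> T W' (scl b (scl s u')) 0"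
    by (rule T_split) (use WW uX' b in \<open>simp_all add: Lam_skew\<close>)
  moreover have "rel (T W (scl b (scl s u)) 0) (T W' (scl b (scl s u')) 0)"
  proof -
    have "qcong (scl (b * s) u) 0 (scl (b * s) u') 0"
      using qcong_column[OF g i f, of "b * s"] by (simp add: u_def u'_def)
    then show ?thesis unfolding W W' scl_simps using k i small[of "- k"] uX(3) uX'(3) unfolding W W'
      by (intro rel_T_two) (auto intro: I_minus)
  qed
  ultimately have "rel (T (scl s u) 0 b) (T (scl s u') 0 b)"
    using w by (metis rel_cancel_left rel_cancel_right)
  moreover have ss: "s * bar s = q * q" by (simp add: s_def qbar mult.assoc th_cancel)
  then have "T (scl s u) 0 b = T u 0 (q * b * q)"
    unfolding T_scale by (simp add: mult_ac)
  moreover have "T (scl s u') 0 b = T (bas i) 0 (q * (q * b * q))"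
    unfolding u'_def T_scale ss by (simp add: q_def u_def mult_ac)
  ultimately have main: "rel (T u 0 (q * b * q)) (T (bas i) 0 (q * (q * b * q)))" by simp
  have "q * b * q - b \<in> \<Gamma>" using qbar q1 b by (rule norm_conj_Gam)
  then have "b - q * b * q \<in> \<Gamma>" using Gam_minus[of "q * b * q - b"] by simp
  then have "rel (T u 0 (b - q * b * q)) id"
    using u by (intro rel_T_column_id) auto
  from rel_comp[OF this main] have "rel (T u 0 (b - q * b * q) \<circ> T u 0 (q * b * q)) (T (bas i) 0 (q * (q * b * q)))"
    by simp
  then show ?thesis using uu by (simp add: T_comp u_def)
qed

text \<open>By \<open>rel_column_long\<close>, q^3 b = b modulo \<Gamma>, while
  \<open>norm_conj_Gam\<close> for q b gives q^3 b = q b. Hence q b = b.\<close>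

lemma norm_one_mod_Gam:
  assumes g: "uni g" "scalar g c" and i: "i \<in> Om n" and f: "ff (g (bas i)) (g (bas i)) \<in> \<Gamma>"
    and rel: "\<And>b. b \<in> \<Lambda> \<Longrightarrow> rel (T (g (bas i)) 0 b) (T (bas i) 0 b)"
    and N: "\<And>b. b \<in> \<Lambda> \<Longrightarrow> T (bas i) 0 b \<in> N \<Longrightarrow> b \<in> \<Gamma>"
    and b: "b \<in> \<Lambda>"
  shows "g (bas i) i * b * bar (g (bas i) i) - b \<in> \<Gamma>"
proof -
  define d q where "d = g (bas i) i" and "q = d * bar d"
  have qbar: "bar q = q" by (simp add: q_def mult.commute)
  have q1: "q - 1 \<in> I" unfolding q_def d_def using g i i by (rule scalar_diag)
  have L: "q * x \<in> \<Lambda>" if "x \<in> \<Lambda>" for x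
    using Lam_conj[OF that, of d] by (simp add: q_def mult_ac)
  have *: "q * (q * x * q) - x \<in> \<Gamma>" if x: "x \<in> \<Lambda>" for x
  proof -
    have y: "q * (q * x * q) \<in> \<Lambda>" using L[OF L[OF L[OF x]]] by (simp add: mult_ac)
    have "rel (T (bas i) 0 (q * (q * x * q))) (T (bas i) 0 x)"
      using rel_trans[OF rel_sym[OF rel_column_long[OF g i f x]] rel[OF x]] by (simp add: q_def d_def)
    moreover have "T (bas i) 0 (q * (q * x * q)) = T (bas i) 0 (q * (q * x * q) - x) \<circ> T (bas i) 0 x"
      by (simp add: T_comp)
    ultimately have "rel (T (bas i) 0 (q * (q * x * q) - x) \<circ> T (bas i) 0 x) (id \<circ> T (bas i) 0 x)" by simp
    then have "rel (T (bas i) 0 (q * (q * x * q) - x)) id"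
      by (rule rel_cancel_right) (rule rel_refl[OF EE_long1[OF i x]])
    then show ?thesis using N Lam_diff[OF y x] by (simp add: rel_id_iff)
  qed
  have "(q * (q * b * q) - b) - (q * (q * b) * q - q * b) \<in> \<Gamma>"
    using *[OF b] norm_conj_Gam[OF qbar q1 L[OF b]] by (rule Gam_diff)
  then have "q * b - b \<in> \<Gamma>" by (simp add: mult_ac)
  then show ?thesis by (simp add: q_def d_def mult_ac)
qed

end

section \<open>Two descriptions of the full congruence subgroup\<close>

context level
begin

text \<open>The last condition is not automatic: the commutator of \<open>g\<close> with the long root element of
  parameter \<open>b\<close> at \<open>i\<close> has the long root part \<open>d b bar(d) - b\<close>, where \<open>d = g (bas i) i\<close>.\<close>

definition good :: "((int \<Rightarrow> 'a) \<Rightarrow> (int \<Rightarrow> 'a)) \<Rightarrow> bool" where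
  "good g \<longleftrightarrow> uni g \<and> (\<exists>c. scalar g c) \<and> (\<forall>i\<in>Om n. ff (g (bas i)) (g (bas i)) \<in> \<Gamma>) \<and>
     (\<forall>i\<in>Om n. \<forall>b\<in>\<Lambda>. g (bas i) i * b * bar (g (bas i) i) - b \<in> \<Gamma>)"

text \<open>The commutator condition evaluated at \<epsilon> (g v), which the commutator sends to g
  (\<epsilon> v); this avoids inverses.\<close>

definition cu :: "((int \<Rightarrow> 'a) \<Rightarrow> (int \<Rightarrow> 'a)) \<Rightarrow> bool" where
  "cu g \<longleftrightarrow> uni g \<and> (\<forall>\<epsilon>\<in>EE. \<forall>v. veq (g (\<epsilon> v)) (\<epsilon> (g v)) \<and>
     ff (g (\<epsilon> v)) (g (\<epsilon> v)) - ff (\<epsilon> (g v)) (\<epsilon> (g v)) \<in> \<Gamma>)"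

end

context relative
begin

text \<open>By \<open>T_conj\<close>, g turns a generator into the transvection along the
  corresponding columns of g, which is congruent to the generator modulo N. For long roots the
  factor q^3 from \<open>rel_column_long\<close> is removed by three uses of q x = x modulo
  \<Gamma>.\<close>

lemma good_commute:
  assumes g: "good g" and "\<epsilon> \<in> EE"
  shows "\<exists>\<nu>\<in>N. g \<circ> \<epsilon> = \<nu> \<circ> \<epsilon> \<circ> g"
proof -
  obtain c where c: "uni g" "scalar g c" using g by (auto simp: good_def)
  have f: "ff (g (bas i)) (g (bas i)) \<in> \<Gamma>" if "i \<in> Om n" for i using g that by (auto simp: good_def)
  have step: "\<exists>\<nu>\<in>N. g \<circ> (t \<circ> \<epsilon>) = \<nu> \<circ> (t \<circ> \<epsilon>) \<circ> g"
    if t: "g \<circ> t = t' \<circ> g" "rel t' t" and IH: "\<exists>\<nu>\<in>N. g \<circ> \<epsilon> = \<nu> \<circ> \<epsilon> \<circ> g" for t t' \<epsilon>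
  proof -
    obtain \<nu> where \<nu>: "\<nu> \<in> N" "g \<circ> \<epsilon> = \<nu> \<circ> \<epsilon> \<circ> g" using IH by blast
    obtain \<mu> where \<mu>: "\<mu> \<in> N" "t' = \<mu> \<circ> t" using t by (auto simp: rel_def)
    obtain \<nu>' where \<nu>': "\<nu>' \<in> N" "t \<circ> \<nu> = \<nu>' \<circ> t" using N_norm rel_EE(2)[OF t(2)] \<nu>(1) by blast
    have "g \<circ> (t \<circ> \<epsilon>) = (g \<circ> t) \<circ> \<epsilon>" by (simp only: comp_assoc)
    also have "\<dots> = t' \<circ> (g \<circ> \<epsilon>)" unfolding t(1) by (simp only: comp_assoc)
    also have "\<dots> = \<mu> \<circ> ((t \<circ> \<nu>) \<circ> \<epsilon> \<circ> g)" unfolding \<nu>(2) \<mu>(2) by (simp only: comp_assoc)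
    also have "\<dots> = (\<mu> \<circ> \<nu>') \<circ> (t \<circ> \<epsilon>) \<circ> g" unfolding \<nu>'(2) by (simp only: comp_assoc)
    finally show ?thesis using N_comp[OF \<mu>(1) \<nu>'(1)] by blast
  qed
  show ?thesis
    using assms(2)
  proof (induction \<epsilon> rule: EE.induct)
    case EE_id
    show ?case using N_id by (intro bexI[of _ id]) simp_all
  next
    case (EE_short \<epsilon> i k s)
    have "rel (T (g (bas i)) (scl s (g (bas k))) 0) (T (bas i) (scl s (bas k)) 0)"
      using c EE_short f by (intro rel_column_short) auto
    then show ?case
      using T_conj[OF c(1), of "bas i" "scl s (bas k)" 0] EE_short.IH unfolding uniD(2)[OF c(1)] by (intro step)
  next
    case (EE_long \<epsilon> i b)
    define q where "q = g (bas i) i * bar (g (bas i) i)"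
    have L: "q * x \<in> \<Lambda>" and G: "q * x - x \<in> \<Gamma>" if "x \<in> \<Lambda>" for x
      using Lam_conj[OF that, of "g (bas i) i"] g EE_long that by (auto simp: q_def good_def mult_ac)
    have "(q * (q * (q * b)) - q * (q * b)) + ((q * (q * b) - q * b) + (q * b - b)) \<in> \<Gamma>"
      using EE_long by (intro Gam_add G L)
    then have "q * (q * b * q) - b \<in> \<Gamma>" by (simp add: mult_ac)
    moreover have "q * (q * b * q) \<in> \<Lambda>" using L[OF L[OF L[OF EE_long(3)]]] by (simp add: mult_ac)
    ultimately have "rel (T (bas i) 0 (q * (q * b * q))) (T (bas i) 0 b)"
      using EE_long by (intro rel_long)
    moreover have "rel (T (g (bas i)) 0 b) (T (bas i) 0 (q * (q * b * q)))"
      unfolding q_def using c EE_long f by (intro rel_column_long) auto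
    ultimately have "rel (T (g (bas i)) 0 b) (T (bas i) 0 b)" by (blast intro: rel_trans)
    then show ?case
      using T_conj[OF c(1), of "bas i" 0 b] EE_long.IH unfolding uniD(8)[OF c(1)] by (intro step)
  qed
qed

end

context level
begin

lemma good_cu:
  assumes "good g" shows "cu g"
  unfolding cu_def
proof (intro conjI ballI allI)
  show "uni g" using assms by (simp add: good_def)
  fix \<epsilon> v assume "\<epsilon> \<in> EE"
  then obtain \<nu> where "\<nu> \<in> UC" "g \<circ> \<epsilon> = \<nu> \<circ> \<epsilon> \<circ> g" using uc.good_commute assms by blast
  moreover from this have "g (\<epsilon> v) = \<nu> (\<epsilon> (g v))" by (metis comp_apply)
  ultimately show "veq (g (\<epsilon> v)) (\<epsilon> (g v))" "ff (g (\<epsilon> v)) (g (\<epsilon> v)) - ff (\<epsilon> (g v)) (\<epsilon> (g v)) \<in> \<Gamma>"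
    by (simp_all add: UC_def)
qed

text \<open>The value of f at the image of \<open>bas (- i)\<close> is \<open>b\<close> up to
  sign.\<close>

lemma UC_long:
  assumes "i \<in> Om n" "b \<in> \<Lambda>" "T (bas i) 0 b \<in> UC" shows "b \<in> \<Gamma>"
proof -
  define w where "w = bas (- i) - scl (bar lam * th i * b) (bas i)"
  have "T (bas i) 0 b (bas (- i)) = w"
    using assms by (simp add: w_def T_def hh_bas_opp mult_ac)
  then have "ff w w \<in> \<Gamma>" using assms by (auto simp: UC_def dest!: spec[of _ "bas (- i)"])
  moreover have "ff w w = (if i > 0 then b else - b)"
    using assms Om_nonzero[OF assms(1)] Lam_skew[OF assms(2)]
    by (auto simp: w_def ff_bas_left bas_apply th_def Om_def)
  ultimately show ?thesis using Gam_minus[of "- b"] by (auto split: if_splits)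
qed

lemma scalarI:
  assumes off: "\<And>i k. i \<in> Om n \<Longrightarrow> k \<in> Om n \<Longrightarrow> k \<noteq> i \<Longrightarrow> g (bas i) k \<in> I" and "\<And>i. i \<in> Om n \<Longrightarrow> g (bas i) \<in> VV"
    and d: "\<And>i j. i \<in> Om n \<Longrightarrow> j \<in> Om n \<Longrightarrow> j \<noteq> i \<Longrightarrow> j \<noteq> - i \<Longrightarrow> g (bas i) i - g (bas j) j \<in> I"
  shows "\<exists>c. scalar g c"
proof -
  have d2: "g (bas i) i - g (bas j) j \<in> I" if "i \<in> Om n" "j \<in> Om n" for i j
  proof -
    obtain l where "l \<in> Om n" "l \<noteq> i" "l \<noteq> - i" "l \<noteq> j" "l \<noteq> - j" using ex_Om by blast
    then have "g (bas i) i - g (bas l) l \<in> I" "g (bas l) l - g (bas j) j \<in> I"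
      using that by (auto intro!: d)
    then show ?thesis using I_add by fastforce
  qed
  have "1 \<in> Om n" using n3 by (auto simp: Om_def)
  moreover have "g (bas i) k \<in> I" if "i \<in> Om n" "k \<noteq> i" for i k
    using that assms(2)[OF that(1)] off[of i k] by (cases "k \<in> Om n") (auto simp: VV_def)
  ultimately have "scalar g (g (bas 1) 1)"
    using d2 by (auto simp: scalar_def veq_def bas_apply)
  then show ?thesis by blast
qed

text \<open>The element \<open>?e\<close> adds \<open>scl (th j) (bas i)\<close> to
  \<open>bas (- j)\<close>, so comparing the two orders of composition at \<open>bas (- j)\<close>
  isolates the column \<open>g (bas i)\<close>, up to its coordinates at \<open>i\<close> and
  \<open>j\<close>. The coordinate at \<open>j\<close> is reached with another choice of
  \<open>j\<close>.\<close>

lemma cu_scalar: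
  assumes "cu g" shows "\<exists>c. scalar g c"
proof -
  have u: "uni g" using assms by (simp add: cu_def)
  have *: "(k \<noteq> i \<longrightarrow> k \<noteq> j \<longrightarrow> g (bas i) k \<in> I) \<and> g (bas i) i - g (bas (- j)) (- j) \<in> I"
    if ij: "i \<in> Om n" "j \<in> Om n" "j \<noteq> i" "j \<noteq> - i" for i j k
  proof -
    let ?e = "T (bas i) (scl 1 (bas j)) 0"
    have "?e \<in> EE" using ij by (intro EE_short1)
    then have v: "veq (g (?e (bas (- j)))) (?e (g (bas (- j))))" using assms by (simp add: cu_def)
    have e: "g (?e (bas (- j))) = g (bas (- j)) + scl (th j) (g (bas i))"
    proof -
      have "?e (bas (- j)) = bas (- j) + scl (th j) (bas i)"
        using ij by (simp add: T_def hh_bas_bas)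
      then show ?thesis by (simp only: uniD[OF u])
    qed
    have ew: "?e w k = w k + th j * w (- j) * bas i k - bar lam * (th i * w (- i)) * bas j k" for w k
      using ij by (simp add: T_def hh_bas_left)
    then have d: "th j * g (bas i) k - (th j * g (bas (- j)) (- j) * bas i k - bar lam * (th i * g (bas (- j)) (- i)) * bas j k) \<in> I" for k
      using veq_I[OF v, of k] unfolding e ew by (simp add: algebra_simps)
    have cancel: "x \<in> I" if "th j * x \<in> I" for x
      using I_mult(1)[OF that, of "bar (th j)"] by simp
    have "g (bas i) k \<in> I" if "k \<noteq> i" "k \<noteq> j" using d[of k] that cancel by (simp add: bas_apply)
    moreover have "th j * (g (bas i) i - g (bas (- j)) (- j)) \<in> I"
      using d[of i] ij by (simp add: bas_apply right_diff_distrib)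
    ultimately show ?thesis using cancel by blast
  qed
  have off: "g (bas i) k \<in> I" if ik: "i \<in> Om n" "k \<noteq> i" for i k
  proof -
    obtain j where "j \<in> Om n" "j \<noteq> i" "j \<noteq> - i" "j \<noteq> k" using ex_Om by blast
    then show ?thesis using * ik by blast
  qed
  show ?thesis
  proof (rule scalarI)
    show "g (bas i) \<in> VV" if "i \<in> Om n" for i using uniD(5)[OF u] that by simp
    show "g (bas i) i - g (bas j) j \<in> I" if "i \<in> Om n" "j \<in> Om n" "j \<noteq> i" "j \<noteq> - i" for i j
      using *[of i "- j"] that by simp
  qed (use off in blast)
qed

text \<open>Evaluate the condition at \<open>bas (- k)\<close>: one order produces the wanted value
  next to f(w,w) and a \<open>skew\<close> term, while in the other order f(w,w) changes only within
  \<Gamma>, because \<open>hh (bas i) ?w\<close> lies in I.\<close>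

lemma cu_ff:
  assumes g: "cu g" and i: "i \<in> Om n"
  shows "ff (g (bas i)) (g (bas i)) \<in> \<Gamma>"
proof -
  obtain c where c: "scalar g c" using cu_scalar g by blast
  have u: "uni g" using g by (simp add: cu_def)
  obtain k where k: "k \<in> Om n" "k \<noteq> i" "k \<noteq> - i" using ex_Om by blast
  let ?e = "T (bas i) (bas k) 0" and ?w = "g (bas (- k))"
  have "T (bas i) (scl 1 (bas k)) 0 \<in> EE" using i k by (intro EE_short1)
  then have "?e \<in> EE" by simp
  then have v: "ff (g (?e (bas (- k)))) (g (?e (bas (- k)))) - ff (?e ?w) (?e ?w) \<in> \<Gamma>"
    using g by (simp add: cu_def)
  have e: "g (?e (bas (- k))) = ?w + scl (th k) (g (bas i))"
  proof -
    have "?e (bas (- k)) = bas (- k) + scl (th k) (bas i)"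
      using i k by (simp add: T_def hh_bas_bas)
    then show ?thesis by (simp only: uniD[OF u])
  qed
  define y where "y = th k * ff ?w (g (bas i))"
  have "ff ?w (g (bas i)) - ff (scl c (bas (- k))) (scl c (bas i)) \<in> I"
    using c i k by (intro ff_veq) (auto simp: scalar_def)
  moreover have "ff (scl c (bas (- k))) (scl c (bas i)) = 0" using k by (simp add: ff_bas_bas)
  ultimately have yI: "y \<in> I" unfolding y_def using I_mult by simp
  have "hh (g (bas i)) ?w = 0" unfolding uniD(3)[OF u] using i k by (simp add: hh_bas_bas)
  then have "bar (th k) * ff (g (bas i)) ?w = - (lam * bar y)"
    using ff_swap_add[of "g (bas i)" ?w] by (simp add: y_def mult_ac)
  then have "ff (g (?e (bas (- k)))) (g (?e (bas (- k)))) = ff ?w ?w + skew y + ff (g (bas i)) (g (bas i))"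
    unfolding e by (simp add: y_def skew_def algebra_simps)
  then have f1: "ff (g (bas i)) (g (bas i)) + (skew y + (ff ?w ?w - ff (?e ?w) (?e ?w))) \<in> \<Gamma>"
    using v by (simp add: algebra_simps)
  have Q: "hh (bas i) ?w \<in> I"
    using i k scalar_off[OF c, of "- k" "- i"] by (simp add: hh_bas_left I_mult)
  have F: "ff ?w (bas i) \<in> I"
    using i k scalar_off[OF c, of "- k" "- i"] by (simp add: ff_bas_right I_bar)
  have "skew (ff ?w (scl (hh (bas k) ?w - bar lam * 0 * hh (bas i) ?w) (bas i) - scl (bar lam * hh (bas i) ?w) (bas k))) \<in> \<Gamma>"
    using Q F by (auto intro!: Gam_skew I_diff intro: I_mult)
  moreover have "skew (ff (scl (- (bar lam * hh (bas i) ?w)) (bas k)) (scl (hh (bas k) ?w - bar lam * 0 * hh (bas i) ?w) (bas i))) \<in> \<Gamma>"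
    using Q by (intro Gam_skew) (auto intro!: I_minus intro: I_mult I_bar)
  moreover have "skew (bar (hh (bas k) ?w) * hh (bas i) ?w) \<in> \<Gamma>"
    using Q by (intro Gam_skew I_mult)
  moreover have "ff (?e ?w) (?e ?w) - ff ?w ?w =
      skew (ff ?w (scl (hh (bas k) ?w - bar lam * 0 * hh (bas i) ?w) (bas i) - scl (bar lam * hh (bas i) ?w) (bas k)))
      + skew (ff (scl (- (bar lam * hh (bas i) ?w)) (bas k)) (scl (hh (bas k) ?w - bar lam * 0 * hh (bas i) ?w) (bas i)))
      + skew (bar (hh (bas k) ?w) * hh (bas i) ?w)"
    using i k by (subst ff_T) (auto simp: hh_bas_bas)
  ultimately have "ff (?e ?w) (?e ?w) - ff ?w ?w \<in> \<Gamma>" by (simp only: Gam_add)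
  then have "skew y + (ff ?w ?w - ff (?e ?w) (?e ?w)) \<in> \<Gamma>"
    using Gam_add[OF Gam_skew[OF yI]] Gam_minus[of "ff (?e ?w) (?e ?w) - ff ?w ?w"] by simp
  from Gam_diff[OF f1 this] show ?thesis by simp
qed

text \<open>For the norm condition, \<open>?A \<circ> ?B'\<close> is the commutator of g with a long
  root element. The right inverse writes each vector as \<open>?B (g x)\<close>, where the
  hypothesis can be read as membership in \<open>UC\<close>.\<close>

lemma cu_good:
  assumes g: "cu g" and surj: "\<And>v. g (g' v) = v"
  shows "good g"
proof -
  obtain c where c: "scalar g c" using cu_scalar g by blast
  have u: "uni g" using g by (simp add: cu_def)
  have "g (bas i) i * b * bar (g (bas i) i) - b \<in> \<Gamma>" if i: "i \<in> Om n" and b: "b \<in> \<Lambda>" for i b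
  proof (rule uc.norm_one_mod_Gam[OF u c i cu_ff[OF g i] _ _ b])
    fix b assume b: "b \<in> \<Lambda>"
    let ?A = "T (g (bas i)) 0 b" and ?B = "T (bas i) 0 b" and ?B' = "T (bas i) 0 (- b)"
    have B: "?B \<in> EE" "?B' \<in> EE" using i b by (auto intro: EE_long1 Lam_minus)
    have A: "?A \<in> EE" using uc.rel_EE(1)[OF uc.rel_column_long[OF u c i cu_ff[OF g i] b]] .
    have inv: "?B \<circ> ?B' = id" "?B' \<circ> ?B = id" by (simp_all add: T_comp)
    have "?A \<circ> ?B' \<in> UC"
      unfolding UC_def
    proof (intro CollectI conjI allI)
      show "?A \<circ> ?B' \<in> EE" using A B by (intro EE_comp)
      fix v
      define x where "x = g' (?B' v)"
      have v: "v = ?B (g x)" unfolding x_def surj using inv(1) by (metis comp_apply id_apply)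
      have "(?A \<circ> ?B') v = ?A (g x)" by (simp add: x_def surj)
      also have "\<dots> = g (?B x)" using T_conj[OF u, of "bas i" 0 b] uniD(8)[OF u] by (metis comp_apply)
      finally have e: "(?A \<circ> ?B') v = g (?B x)" .
      show "veq ((?A \<circ> ?B') v) v" "ff ((?A \<circ> ?B') v) ((?A \<circ> ?B') v) - ff v v \<in> \<Gamma>"
        unfolding e using g B(1) v by (auto simp: cu_def)
    qed
    moreover have "?A = (?A \<circ> ?B') \<circ> ?B" using inv by (simp add: comp_assoc)
    ultimately show "uc.rel ?A ?B" unfolding uc.rel_def using A B by blast
  next
    fix b assume "b \<in> \<Lambda>" "T (bas i) 0 b \<in> UC"
    then show "b \<in> \<Gamma>" by (rule UC_long[OF i])
  qed
  then show ?thesis using u c cu_ff[OF g] by (auto simp: good_def)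
qed

end

section \<open>The level of a normalized group\<close>

context hyperbolic
begin

text \<open>The relation entails membership in \<open>EE\<close>, so the reflexive case of
  \<open>rel_T_bas\<close> at level (R, \<Lambda>) suffices.\<close>

lemma T_bas_EE:
  assumes "i \<in> Om n" "z \<in> VV" "hh (bas i) z = 0" "b - ff z z \<in> \<Lambda>"
  shows "T (bas i) z b \<in> EE"
proof -
  have "bar (th i) * (th i * z (- i)) = 0" using assms by (simp add: hh_bas_left del: th_bar_left)
  then have "z (- i) = 0" by simp
  then have "top.uc.rel (T (bas i) z b) (T (bas i) z b)"
    using assms by (intro top.uc.rel_T_bas) (auto simp: top.qcong_def)
  then show ?thesis by (rule top.uc.rel_EE)
qed

lemma T_two_EE:
  assumes "k \<in> Om n" "l \<in> Om n" "k \<noteq> - l" "u \<in> VV" "hh (two k \<alpha> l \<beta>) u = 0" "b - ff u u \<in> \<Lambda>"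
  shows "T (two k \<alpha> l \<beta>) u b \<in> EE"
proof -
  have "top.uc.rel (T (two k \<alpha> l \<beta>) u b) (T (two k \<alpha> l \<beta>) u b)"
    using assms by (intro top.uc.rel_T_two) (auto simp: top.qcong_def)
  then show ?thesis by (rule top.uc.rel_EE)
qed

lemma th_th_minus: "i \<in> Om n \<Longrightarrow> th i * th (- i) = lam" "i \<in> Om n \<Longrightarrow> th (- i) * th i = lam"
  by (auto simp: th_def Om_def)

end

section \<open>The form ideal of elementary parameters in N\<close>

context normalized
begin

lemma N_cancel_left: "X \<in> N \<Longrightarrow> X \<circ> Y \<in> N \<Longrightarrow> Y \<in> N"
  using N_inv[of X] N_comp by (metis comp_assoc id_comp)

lemma N_cancel_right: "Y \<in> N \<Longrightarrow> X \<circ> Y \<in> N \<Longrightarrow> X \<in> N"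
  using N_inv[of Y] N_comp by (metis comp_assoc comp_id)

lemma N_conj: 
  assumes "g \<in> EE" "X \<in> N" "g \<circ> X = Y \<circ> g" shows "Y \<in> N"
proof -
  obtain \<nu> where "\<nu> \<in> N" "g \<circ> X = \<nu> \<circ> g" using N_norm assms by blast
  moreover obtain g' where "g \<circ> g' = id" using EE_inv assms(1) by blast
  ultimately have "Y = \<nu>" using assms(3) by (metis comp_assoc comp_id)
  then show ?thesis using \<open>\<nu> \<in> N\<close> by simp
qed

definition level_I :: "'a set" where
  "level_I = {s. \<forall>i\<in>Om n. \<forall>k\<in>Om n. k \<noteq> i \<longrightarrow> k \<noteq> - i \<longrightarrow> T (bas i) (scl s (bas k)) 0 \<in> N}"

definition level_G :: "'a set" where
  "level_G = {b \<in> \<Lambda>. \<forall>i\<in>Om n. T (bas i) 0 b \<in> N}"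

lemma N_short_move:
  assumes "i \<in> Om n" "k \<in> Om n" "k \<noteq> i" "k \<noteq> - i" and m: "m \<in> Om n" "m \<noteq> i" "m \<noteq> - i" "m \<noteq> k" "m \<noteq> - k"
    and "T (bas i) (scl s (bas k)) 0 \<in> N"
  shows "T (bas i) (scl (s * t) (bas m)) 0 \<in> N"
proof -
  define r where "r = - (lam * bar (th (- k)) * t)"
  let ?g = "T (bas (- k)) (scl r (bas m)) 0"
  have g: "?g \<in> EE" using assms by (intro EE_short1) auto
  have "bar lam * th (- k) * r = - t"
    by (simp add: r_def mult.assoc mult.left_commute[of "th (- k)" lam])
  then have gk: "?g (bas k) = bas k + scl t (bas m)"
    using assms hh_bas_opp[of "- k"] by (simp add: T_def hh_bas_bas scl_minus)
  have gi: "?g (bas i) = bas i"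
    using assms by (simp add: T_def hh_bas_bas)
  have "T (bas i) (scl s (bas k) + scl (s * t) (bas m)) 0 \<in> N"
  proof (rule N_conj[OF g assms(10)])
    show "?g \<circ> T (bas i) (scl s (bas k)) 0 = T (bas i) (scl s (bas k) + scl (s * t) (bas m)) 0 \<circ> ?g"
      using T_conj[OF EE_uni[OF g], of "bas i" "scl s (bas k)" 0]
      unfolding uniD(2)[OF EE_uni[OF g]] gk gi by (simp add: scl_add_right)
  qed
  moreover have "T (bas i) (scl s (bas k) + scl (s * t) (bas m)) 0
      = T (bas i) (scl s (bas k)) 0 \<circ> T (bas i) (scl (s * t) (bas m)) 0"
    using assms by (subst T_comp) (auto simp: hh_bas_bas)
  ultimately show ?thesis using N_cancel_left assms(10) by metis
qed

lemma N_short_left: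
  assumes "i \<in> Om n" "k \<in> Om n" "k \<noteq> i" "k \<noteq> - i" and m: "m \<in> Om n" "m \<noteq> i" "m \<noteq> - i"
    and "T (bas i) (scl s (bas k)) 0 \<in> N"
  shows "T (bas i) (scl (s * t) (bas m)) 0 \<in> N"
proof -
  obtain l where l: "l \<in> Om n" "l \<noteq> i" "l \<noteq> - i" "l \<noteq> k" "l \<noteq> - k" using ex_Om by blast
  show ?thesis
  proof (cases "m = k \<or> m = - k")
    case True
    have "T (bas i) (scl (s * 1) (bas l)) 0 \<in> N" using assms l by (intro N_short_move[of i k l])
    then show ?thesis using assms l True N_short_move[of i l m s t] by auto
  next
    case False
    then show ?thesis using assms by (intro N_short_move[of i k m]) auto
  qed
qed

lemma N_short_swap:
  assumes "i \<in> Om n" "k \<in> Om n" "k \<noteq> i" "k \<noteq> - i" and m: "m \<in> Om n" "m \<noteq> k" "m \<noteq> - k"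
    and "T (bas i) (scl s (bas k)) 0 \<in> N"
  shows "T (bas k) (scl (bar s * t) (bas m)) 0 \<in> N"
proof -
  have "T (bas k) (scl (- (lam * bar s)) (bas i)) 0 \<in> N"
    using assms(8) unfolding T_scl_bas[of "bas i" s k] .
  then have "T (bas k) (scl (- (lam * bar s) * (- bar lam * t)) (bas m)) 0 \<in> N"
    using assms by (intro N_short_left[of k i m]) auto
  moreover have "- (lam * bar s) * (- bar lam * t) = (lam * bar lam) * (bar s * t)" by (simp only: mult_ac minus_mult_minus)
  ultimately show ?thesis by simp
qed

text \<open>The route leads from i over a spare l to i' and then to k'. Direction and vector are
  exchanged twice, so the two applications of bar cancel.\<close>

lemma N_short_all:
  assumes "i \<in> Om n" "k \<in> Om n" "k \<noteq> i" "k \<noteq> - i" and i': "i' \<in> Om n" "k' \<in> Om n" "k' \<noteq> i'" "k' \<noteq> - i'"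
    and "T (bas i) (scl s (bas k)) 0 \<in> N"
  shows "T (bas i') (scl (s * t) (bas k')) 0 \<in> N"
proof -
  obtain l where l: "l \<in> Om n" "l \<noteq> i" "l \<noteq> - i" "l \<noteq> i'" "l \<noteq> - i'" using ex_Om by blast
  have "T (bas i) (scl (s * 1) (bas l)) 0 \<in> N" using assms l by (intro N_short_left[of i k l])
  then have "T (bas l) (scl (bar (s * 1) * 1) (bas i')) 0 \<in> N"
    using assms l by (intro N_short_swap[of i l i']) auto
  then have "T (bas i') (scl (bar (bar (s * 1) * 1) * t) (bas k')) 0 \<in> N"
    using assms l by (intro N_short_swap[of l i' k']) auto
  then show ?thesis by simp
qed

lemma level_I_I:
  assumes "i \<in> Om n" "k \<in> Om n" "k \<noteq> i" "k \<noteq> - i" "T (bas i) (scl s (bas k)) 0 \<in> N"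
  shows "s * t \<in> level_I" "s \<in> level_I" "bar s \<in> level_I"
proof -
  show *: "s * t \<in> level_I" for t
    unfolding level_I_def using assms N_short_all[of i k _ _ s t] by auto
  show "s \<in> level_I" using *[of 1] by simp
  obtain m where m: "m \<in> Om n" "m \<noteq> k" "m \<noteq> - k" using ex_Om by blast
  then have "T (bas k) (scl (bar s * 1) (bas m)) 0 \<in> N" using assms by (intro N_short_swap[of i k m])
  then show "bar s \<in> level_I"
    unfolding level_I_def using assms m N_short_all[of k m _ _ "bar s" 1] by auto
qed

lemma level_I_D: "s \<in> level_I \<Longrightarrow> i \<in> Om n \<Longrightarrow> k \<in> Om n \<Longrightarrow> k \<noteq> i \<Longrightarrow> k \<noteq> - i \<Longrightarrow> T (bas i) (scl s (bas k)) 0 \<in> N"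
  by (simp add: level_I_def)

lemma ex_valid: "\<exists>i\<in>Om n. \<exists>k\<in>Om n. k \<noteq> i \<and> k \<noteq> - i"
  using ex_Om by metis

lemma level_I_add: "s \<in> level_I \<Longrightarrow> t \<in> level_I \<Longrightarrow> s + t \<in> level_I"
  unfolding level_I_def
proof (intro CollectI ballI impI)
  fix i k assume *: "s \<in> {s. \<forall>i\<in>Om n. \<forall>k\<in>Om n. k \<noteq> i \<longrightarrow> k \<noteq> - i \<longrightarrow> T (bas i) (scl s (bas k)) 0 \<in> N}"
    "t \<in> {s. \<forall>i\<in>Om n. \<forall>k\<in>Om n. k \<noteq> i \<longrightarrow> k \<noteq> - i \<longrightarrow> T (bas i) (scl s (bas k)) 0 \<in> N}"
    "i \<in> Om n" "k \<in> Om n" "k \<noteq> i" "k \<noteq> - i"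
  then have "T (bas i) (scl s (bas k)) 0 \<circ> T (bas i) (scl t (bas k)) 0 \<in> N" by (blast intro: N_comp)
  then show "T (bas i) (scl (s + t) (bas k)) 0 \<in> N"
    using * by (simp add: T_comp hh_bas_bas scl_add)
qed

lemma level_I_mult: "s \<in> level_I \<Longrightarrow> s * t \<in> level_I" "s \<in> level_I \<Longrightarrow> t * s \<in> level_I"
  and level_I_bar: "s \<in> level_I \<Longrightarrow> bar s \<in> level_I"
  using ex_valid level_I_D level_I_I by (metis mult.commute)+

lemma level_I_0: "0 \<in> level_I"
  by (simp add: level_I_def N_id)

lemma level_I_minus: "s \<in> level_I \<Longrightarrow> - s \<in> level_I"
  using level_I_mult(1)[of s "- 1"] by simp

lemma N_radical_step:
  assumes i: "i \<in> Om n" and z: "hh (bas i) z = 0" and X: "T (bas i) z a \<in> N"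
    and g: "g \<in> EE" "g (bas i) = bas i"
  shows "T (bas i) (g z - z) (- hh (g z - z) z) \<in> N"
proof -
  have u: "uni g" using g EE_uni by blast
  have gz: "hh (bas i) (g z) = 0" using uniD(3)[OF u, of "bas i" z] g z by simp
  have "T (bas i) (g z) a \<in> N"
    using N_conj[OF g(1) X] T_conj[OF u, of "bas i" z a] g by simp
  moreover have "T (bas i) (g z) a = T (bas i) (g z - z) (- hh (g z - z) z) \<circ> T (bas i) z a"
    using z gz by (subst T_comp) simp_all
  ultimately show ?thesis using X N_cancel_right by metis
qed

text \<open>Each step replaces z by g z - z for an elementary g fixing \<open>bas i\<close>. The
  first leaves only coordinates at \<open>m\<close> and \<open>- k\<close>, with z_k at
  \<open>m\<close>; the second moves z_k to \<open>- k\<close> and deletes everything else, leaving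
  a short root element.\<close>

lemma N_radical:
  assumes i: "i \<in> Om n" and z: "hh (bas i) z = 0" and X: "T (bas i) z a \<in> N"
    and k: "k \<in> Om n" "k \<noteq> i" "k \<noteq> - i"
  shows "z k \<in> level_I"
proof -
  obtain m where m: "m \<in> Om n" "m \<noteq> i" "m \<noteq> - i" "m \<noteq> k" "m \<noteq> - k" using ex_Om by blast
  define g where "g = T (bas m) (scl (th (- k)) (bas (- k))) 0"
  define g' where "g' = T (bas (- k)) (scl (th (- m)) (bas (- m))) 0"
  have g: "g \<in> EE" "g' \<in> EE" unfolding g_def g'_def using m k by (auto intro!: EE_short1)
  have gi: "g (bas i) = bas i" "g' (bas i) = bas i"
    using i k m by (auto simp: g_def g'_def T_def hh_bas_bas)
  define z' where "z' = g z - z"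
  have z': "z' = two m (z k) (- k) (- (bar lam * th (- k) * th m * z (- m)))"
    using k m by (auto simp: fun_eq_iff z'_def g_def T_def hh_bas_left two_apply bas_apply algebra_simps)
  have N1: "T (bas i) z' (- hh z' z) \<in> N"
    unfolding z'_def using i z X g(1) gi(1) by (rule N_radical_step)
  have hz': "hh (bas i) z' = 0" using i k m by (simp add: hh_bas_left z' two_apply)
  have e: "g' z' - z' = scl (z k) (bas (- k))"
    using k m Om_nonzero[OF k(1)] by (auto simp: fun_eq_iff g'_def T_def hh_bas_left z' two_apply bas_apply)
  have "hh (scl (z k) (bas (- k))) z' = 0"
    using k m Om_nonzero[OF k(1)] by (simp add: hh_bas_left z' two_apply)
  then have "T (bas i) (scl (z k) (bas (- k))) 0 \<in> N"
    using N_radical_step[OF i hz' N1 g(2) gi(2)] unfolding e by simp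
  then show ?thesis using i k by (intro level_I_I(2)[of i "- k"]) auto
qed

lemma long_split:
  assumes "i \<in> Om n" "m \<in> Om n" "m \<noteq> i" "m \<noteq> - i" "b \<in> \<Lambda>"
  shows "T (bas i + scl \<rho> (bas m)) 0 b = T (bas i) 0 b \<circ>
    (T (bas m) 0 (\<rho> * bar \<rho> * b) \<circ> T (bas i) (scl (b * \<rho>) (bas m)) 0)"
proof -
  have "T (bas i + scl \<rho> (bas m)) 0 b = T (bas i) 0 b \<circ> T (scl \<rho> (bas m)) 0 b \<circ> T (bas i) (scl b (scl \<rho> (bas m))) 0"
    using assms by (intro T_split) (auto simp: hh_bas_bas Lam_skew)
  then show ?thesis by (simp add: T_scale comp_assoc)
qed

text \<open>Conjugation carries \<open>bas i\<close> to \<open>bas i + scl \<rho> (bas m)\<close>,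
  and \<open>long_split\<close> leaves a long root factor at \<open>m\<close> times a short one. For
  \<rho> = 1 the product is one transvection along \<open>bas m\<close> whose coordinate at
  \<open>i\<close> is b, so \<open>N_radical\<close> gives b in \<open>level_I\<close>. Then the
  short factor is in N for every \<rho>, and the long one separates.\<close>

lemma N_long_move:
  assumes i: "i \<in> Om n" "m \<in> Om n" "m \<noteq> i" "m \<noteq> - i" and b: "b \<in> \<Lambda>" and X: "T (bas i) 0 b \<in> N"
  shows "b \<in> level_I" "T (bas m) 0 (\<rho> * bar \<rho> * b) \<in> N"
proof -
  have *: "T (bas m) 0 (\<rho> * bar \<rho> * b) \<circ> T (bas i) (scl (b * \<rho>) (bas m)) 0 \<in> N" for \<rho>
  proof -
    let ?g = "T (bas m) (scl (th (- i) * bar \<rho>) (bas (- i))) 0"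
    have g: "?g \<in> EE" using i by (intro EE_short1) auto
    have gi: "?g (bas i) = bas i + scl \<rho> (bas m)"
      using i hh_bas_opp[of "- i"] by (simp add: T_def hh_bas_bas mult_ac)
    have "T (bas i + scl \<rho> (bas m)) 0 b \<in> N"
      using T_conj[OF EE_uni[OF g], of "bas i" 0 b] unfolding gi uniD(8)[OF EE_uni[OF g]]
      by (rule N_conj[OF g X])
    then show ?thesis unfolding long_split[OF i b] using X by (blast intro: N_cancel_left)
  qed
  have "T (bas m) 0 (1 * bar 1 * b) \<circ> T (bas i) (scl (b * 1) (bas m)) 0
      = T (bas m) (scl (- (lam * bar b)) (bas i)) b"
    using i unfolding T_scl_bas[of "bas i" "b * 1" m] by (subst T_comp) (auto simp: hh_bas_bas)
  then have "T (bas m) (scl (- (lam * bar b)) (bas i)) b \<in> N" using *[of 1] by simp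
  then have "scl (- (lam * bar b)) (bas i) i \<in> level_I"
    using i by (intro N_radical[of m "scl (- (lam * bar b)) (bas i)" b i]) (auto simp: hh_bas_bas)
  then show bI: "b \<in> level_I" using b by (simp add: bas_apply Lam_skew)
  have "T (bas i) (scl (b * \<rho>) (bas m)) 0 \<in> N"
    using i bI by (intro level_I_D level_I_mult) auto
  then show "T (bas m) 0 (\<rho> * bar \<rho> * b) \<in> N" using * N_cancel_right by blast
qed

text \<open>Two moves through a spare index reach every m, including \<open>i\<close> and
  \<open>- i\<close>.\<close>

lemma N_long_all:
  assumes i: "i \<in> Om n" and b: "b \<in> \<Lambda>" and X: "T (bas i) 0 b \<in> N"
  shows "b \<in> level_I" "\<rho> * b * bar \<rho> \<in> level_G"
proof -
  obtain l where l: "l \<in> Om n" "l \<noteq> i" "l \<noteq> - i" using ex_Om by blast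
  show "b \<in> level_I" using i l b X N_long_move(1)[of i l] by blast
  have L: "\<rho> * b * bar \<rho> \<in> \<Lambda>" using b by (rule Lam_conj)
  have "T (bas m) 0 (\<rho> * b * bar \<rho>) \<in> N" if m: "m \<in> Om n" for m
  proof -
    obtain l where l: "l \<in> Om n" "l \<noteq> i" "l \<noteq> - i" "l \<noteq> m" "l \<noteq> - m" using ex_Om by blast
    have "T (bas l) 0 (1 * bar 1 * b) \<in> N" using i l b X by (intro N_long_move(2)[of i l])
    then have "T (bas l) 0 b \<in> N" by simp
    then have "T (bas m) 0 (\<rho> * bar \<rho> * b) \<in> N" using l m b by (intro N_long_move(2)[of l m]) auto
    then show ?thesis by (simp add: mult_ac)
  qed
  then show "\<rho> * b * bar \<rho> \<in> level_G" using L by (simp add: level_G_def)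
qed

lemma level_G_I: "i \<in> Om n \<Longrightarrow> b \<in> \<Lambda> \<Longrightarrow> T (bas i) 0 b \<in> N \<Longrightarrow> b \<in> level_G"
  using N_long_all(2)[of i b 1] by simp

lemma level_G_add:
  assumes "b \<in> level_G" "c \<in> level_G" shows "b + c \<in> level_G"
proof -
  have "T (bas i) 0 (b + c) = T (bas i) 0 b \<circ> T (bas i) 0 c" for i by (simp add: T_comp)
  then show ?thesis using assms N_comp Lam_add by (simp add: level_G_def)
qed

lemma level_G_minus:
  assumes b: "b \<in> level_G" shows "- b \<in> level_G"
proof -
  have "T (bas i) 0 b \<circ> T (bas i) 0 (- b) \<in> N" for i using N_id by (simp add: T_comp)
  then have "T (bas i) 0 (- b) \<in> N" if "i \<in> Om n" for i
    using b that N_cancel_left unfolding level_G_def by blast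
  then show ?thesis using b Lam_minus by (simp add: level_G_def)
qed

lemma level_G_skew:
  assumes c: "c \<in> level_I" shows "skew c \<in> level_G"
proof -
  obtain i k where ik: "i \<in> Om n" "k \<in> Om n" "k \<noteq> i" "k \<noteq> - i" using ex_valid by blast
  define x y where "x = scl (bar c * th k) (bas k)" and "y = scl 1 (bas (- k) :: int \<Rightarrow> 'a)"
  have xN: "T (bas i) x 0 \<in> N" unfolding x_def using c ik by (intro level_I_D level_I_mult level_I_bar)
  have xy: "T (bas i) x 0 \<in> EE" "T (bas i) y 0 \<in> EE"
    unfolding x_def y_def using ik by (auto intro!: EE_short1 simp del: scl_simps)
  have "hh x y = c" using ik by (simp add: x_def y_def hh_bas_opp mult.assoc)
  moreover have "hh y x = lam * bar (hh x y)" by (rule hh_swap)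
  moreover have "hh (bas i) x = 0" "hh (bas i) y = 0" using ik by (auto simp: x_def y_def hh_bas_bas)
  ultimately have "T (bas i) 0 (skew c) \<circ> (T (bas i) y 0 \<circ> T (bas i) x 0) = T (bas i) x 0 \<circ> T (bas i) y 0"
    by (simp add: T_comp skew_def add.commute)
  then have "T (bas i) 0 (skew c) \<in> N" by (rule N_commutator[OF xN xy])
  then show ?thesis using ik by (intro level_G_I) auto
qed

text \<open>Here the short root element \<open>?g\<close> is itself in N, so conjugating
  \<open>?h\<close> by it changes nothing modulo N, and the extra factors of
  \<open>long_split\<close> must lie in N.\<close>

lemma level_G_conj_I:
  assumes r: "r \<in> level_I" and y: "y \<in> \<Lambda>" shows "r * y * bar r \<in> level_G"
proof -
  obtain i m where i: "i \<in> Om n" "m \<in> Om n" "m \<noteq> i" "m \<noteq> - i" using ex_valid by blast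
  let ?g = "T (bas m) (scl (th (- i) * bar r) (bas (- i))) 0" and ?h = "T (bas i) 0 y"
  have gN: "?g \<in> N" using r i by (intro level_I_D level_I_mult level_I_bar) auto
  have gE: "?g \<in> EE" using i by (intro EE_short1) auto
  have h: "?h \<in> EE" using i y by (intro EE_long1)
  have gi: "?g (bas i) = bas i + scl r (bas m)"
    using i hh_bas_opp[of "- i"] by (simp add: T_def hh_bas_bas mult_ac)
  have "rel (T (bas i + scl r (bas m)) 0 y) ?h"
  proof (rule rel_conj)
    show "rel ?g id" using gN gE by (simp add: rel_id_iff)
    show "rel ?h ?h" using h by (rule rel_refl)
    show "?g \<circ> ?h = T (bas i + scl r (bas m)) 0 y \<circ> ?g"
      using T_conj[OF EE_uni[OF gE], of "bas i" 0 y] unfolding gi uniD(8)[OF EE_uni[OF gE]] .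
  qed simp
  then have "rel (?h \<circ> (T (bas m) 0 (r * bar r * y) \<circ> T (bas i) (scl (y * r) (bas m)) 0)) (?h \<circ> id)"
    unfolding long_split[OF i y] by simp
  then have "rel (T (bas m) 0 (r * bar r * y) \<circ> T (bas i) (scl (y * r) (bas m)) 0) id"
    by (rule rel_cancel_left) (rule rel_refl[OF h])
  then have "T (bas m) 0 (r * bar r * y) \<circ> T (bas i) (scl (y * r) (bas m)) 0 \<in> N"
    by (simp add: rel_id_iff)
  moreover have "T (bas i) (scl (y * r) (bas m)) 0 \<in> N" using r i by (intro level_I_D level_I_mult)
  ultimately have "T (bas m) 0 (r * bar r * y) \<in> N" by (blast intro: N_cancel_right)
  moreover have "r * y * bar r \<in> \<Lambda>" using y by (rule Lam_conj)
  ultimately show ?thesis using i by (intro level_G_I[of m]) (auto simp: mult_ac)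
qed

lemma level_form_ideal: "form_ideal bar lam \<Lambda> level_I level_G"
proof -
  have "b \<in> level_G" if "b \<in> group_closure {x * y * bar x |x y. x \<in> level_I \<and> y \<in> \<Lambda>}" for b
    using that
  proof (induction rule: group_closure.induct)
    case (base s)
    then show ?case using level_G_conj_I level_G_add[OF level_G_skew level_G_minus[OF level_G_skew], of 0 0] level_I_0 by auto
  next
    case (diff s t)
    then show ?case using level_G_add[OF _ level_G_minus, of s t] by simp
  qed
  moreover have "c - lam * bar c \<in> level_G" if "c \<in> level_I" for c
    using level_G_skew[OF that] by (simp add: skew_def)
  ultimately have "Gam_min bar lam \<Lambda> level_I \<subseteq> level_G"
    unfolding Gam_min_def using level_G_add by blast
  moreover have "0 \<in> level_G" using level_G_skew[OF level_I_0] by simp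
  moreover have "b \<in> level_I \<and> b \<in> \<Lambda> \<and> (\<forall>x. x * b * bar x \<in> level_G)" if "b \<in> level_G" for b
    using that N_long_all[of _ b] ex_Om unfolding level_G_def by blast
  moreover have "bar ` level_I = level_I"
    using level_I_bar by (metis bar_bar image_eqI image_subsetI subsetI subset_antisym)
  ultimately show ?thesis
    using level_I_0 level_I_add level_I_minus level_I_mult level_G_add level_G_minus
    by (auto simp: form_ideal_def two_sided_ideal_def add_subgroup_def Gam_max_def)
qed

end

locale unitary_normalized = normalized +
  assumes N_uni: "\<nu> \<in> N \<Longrightarrow> uni \<nu>"

sublocale unitary_normalized \<subseteq> lv: relative n bar lam \<Lambda> level_I level_G N
proof unfold_locales
  show "form_ideal bar lam \<Lambda> level_I level_G" by (rule level_form_ideal)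
qed (simp_all add: level_I_D level_G_def)

context level
begin

lemma uni_sum: "uni g \<Longrightarrow> g (\<Sum>k\<in>A. f k) = (\<Sum>k\<in>A. g (f k))"
proof (induction A rule: infinite_finite_induct)
  case (insert k A)
  show ?case unfolding sum.insert[OF insert.hyps] uniD(1)[OF insert.prems] insert.IH[OF insert.prems] ..
qed (simp_all only: sum.infinite sum.empty uniD not_False_eq_True)

lemma uni_I:
  assumes "uni g" "y \<in> VV" "\<And>k. y k \<in> I" shows "g y k \<in> I"
proof -
  have "g y k = (\<Sum>j\<in>Om n. y j * g (bas j) k)"
    by (subst VV_sum[OF assms(2)]) (simp add: uni_sum[OF assms(1)] uniD(2)[OF assms(1)] sum_fun_apply)
  then show ?thesis using assms by (auto intro: I_sum I_mult)
qed

lemma scalar_comp: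
  assumes g: "uni g" "scalar g c" and L: "\<And>i. i \<in> Om n \<Longrightarrow> veq (L (bas i)) (bas i)" "\<And>i. i \<in> Om n \<Longrightarrow> L (bas i) \<in> VV"
  shows "scalar (g \<circ> L) c"
  unfolding scalar_def
proof
  fix i assume i: "i \<in> Om n"
  have "veq (g (L (bas i))) (g (bas i))"
    using uni_I[OF g(1), of "L (bas i) - bas i"] i L[OF i] by (simp add: veq_def uniD(7)[OF g(1)])
  then show "veq ((g \<circ> L) (bas i)) (scl c (bas i))"
    using g(2) i veq_trans by (auto simp: scalar_def)
qed

end

section \<open>Columns of the elements of N\<close>

context unitary_normalized
begin

text \<open>\<open>\<sigma>' \<circ> \<tau> \<circ> \<sigma>\<close> fixes \<open>bas i\<close> and differs from \<open>\<tau>\<close> by a factor in \<open>N\<close>, so both sides are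
  conjugates of \<open>T (bas i) z b\<close> by maps that are congruent modulo \<open>N\<close>.\<close>

lemma stabilizer_rel:
  assumes \<sigma>: "\<sigma> \<in> N" "\<sigma>' \<in> N" "\<sigma>' \<circ> \<sigma> = id" and \<tau>: "\<tau> \<in> EE" "\<tau> (\<sigma> (bas i)) = \<sigma> (bas i)"
    and i: "i \<in> Om n" and z: "z \<in> VV" "hh (bas i) z = 0" "b - ff z z \<in> \<Lambda>"
  shows "rel (T (bas i) (\<sigma>' (\<tau> (\<sigma> z))) b) (T (\<tau> (bas i)) (\<tau> z) b)"
proof -
  define \<eta> where "\<eta> = \<sigma>' \<circ> \<tau> \<circ> \<sigma>"
  obtain \<tau>' where \<tau>': "\<tau>' \<in> EE" "\<tau>' \<circ> \<tau> = id" "\<tau> \<circ> \<tau>' = id" using EE_inv \<tau> by blast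
  have u\<tau>: "uni \<tau>" using \<tau> EE_uni by blast
  have u: "uni \<eta>" unfolding \<eta>_def by (rule uni_comp[OF uni_comp[OF N_uni[OF \<sigma>(2)] u\<tau>] N_uni[OF \<sigma>(1)]])
  have \<eta>i: "\<eta> (bas i) = bas i" using \<tau>(2) \<sigma>(3) by (simp add: \<eta>_def) (metis comp_apply id_apply)
  let ?T0 = "T (bas i) z b" and ?T1 = "T (bas i) (\<eta> z) b" and ?T2 = "T (\<tau> (bas i)) (\<tau> z) b"
  have T0: "?T0 \<in> EE" using i z by (intro T_bas_EE)
  have "hh (bas i) (\<eta> z) = 0" using uniD(3)[OF u, of "bas i" z] \<eta>i z by simp
  moreover have "b - ff (\<eta> z) (\<eta> z) \<in> \<Lambda>"
    using Lam_diff[OF z(3) uniD(4)[OF u, of z]] by simp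
  ultimately have T1: "?T1 \<in> EE" using i z uniD(5)[OF u] by (intro T_bas_EE) auto
  have t2: "\<tau> \<circ> ?T0 = ?T2 \<circ> \<tau>" using T_conj[OF u\<tau>, of "bas i" z b] .
  then have "?T2 = \<tau> \<circ> ?T0 \<circ> \<tau>'" using \<tau>'(3) by (metis comp_assoc comp_id)
  then have T2: "?T2 \<in> EE" using \<tau> T0 \<tau>' by (auto intro: EE_comp)
  have t1: "\<eta> \<circ> ?T0 = ?T1 \<circ> \<eta>" using T_conj[OF u, of "bas i" z b] \<eta>i by simp
  obtain \<nu> where \<nu>: "\<nu> \<in> N" "\<tau> \<circ> \<sigma> = \<nu> \<circ> \<tau>" using N_norm \<tau>(1) \<sigma>(1) by blast
  define \<rho> where "\<rho> = \<sigma>' \<circ> \<nu>"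
  have \<rho>: "\<rho> \<in> N" unfolding \<rho>_def using \<sigma> \<nu> by (intro N_comp)
  have \<eta>: "\<eta> = \<rho> \<circ> \<tau>" unfolding \<eta>_def \<rho>_def using \<nu> by (simp add: comp_assoc)
  have "(?T1 \<circ> \<rho>) \<circ> \<tau> = (\<rho> \<circ> ?T2) \<circ> \<tau>"
    using t1 t2 unfolding \<eta> by (metis comp_assoc)
  then have "?T1 \<circ> \<rho> = \<rho> \<circ> ?T2" using \<tau>'(3) by (metis comp_assoc comp_id)
  moreover obtain \<mu> where \<mu>: "\<mu> \<in> N" "?T1 \<circ> \<rho> = \<mu> \<circ> ?T1" using N_norm[OF T1 \<rho>] by blast
  moreover obtain \<mu>' where \<mu>': "\<mu>' \<in> N" "\<mu>' \<circ> \<mu> = id" using N_inv[OF \<mu>(1)] by blast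
  ultimately have "?T1 = (\<mu>' \<circ> \<rho>) \<circ> ?T2" by (metis comp_assoc id_comp)
  then have "rel ?T1 ?T2" unfolding rel_def using T1 T2 N_comp[OF \<mu>'(1) \<rho>] by blast
  then show ?thesis by (simp add: \<eta>_def)
qed

lemma rel_conj1:
  assumes "g \<in> EE" "rel A B" "g \<circ> A = A' \<circ> g" "g \<circ> B = B' \<circ> g"
  shows "rel A' B'"
  using rel_conj[OF rel_refl[OF assms(1)] assms(2-4)] .

text \<open>\<open>stabilizer_rel\<close> compares a transvection along \<open>bas i\<close> with
  one along its image under \<tau>. Two conjugations by maps fixing \<open>bas i\<close> remove the
  unknown vector \<open>v\<close> and leave a transvection in N with a unit multiple of \<alpha>
  among its coordinates.\<close>

lemma stabilizer_coeff:
  assumes \<sigma>: "\<sigma> \<in> N" and \<tau>: "\<tau> \<in> EE" "\<tau> (\<sigma> (bas i)) = \<sigma> (bas i)"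
    and i: "i \<in> Om n" and a: "a \<in> Om n" "a \<noteq> i" "a \<noteq> - i" and c: "c \<in> Om n" "c \<noteq> i" "c \<noteq> - i" "c \<noteq> a" "c \<noteq> - a"
    and \<tau>c: "\<tau> (bas c) = bas c"
    and \<tau>i: "\<tau> (bas i) = bas i + scl \<alpha> (bas a) + scl \<beta> (bas c) + scl \<delta> (bas (- i))"
    and \<delta>: "\<delta> \<in> level_I"
  shows "\<alpha> \<in> level_I"
proof -
  obtain \<sigma>' where \<sigma>': "\<sigma>' \<in> N" "\<sigma>' \<circ> \<sigma> = id" using N_inv[OF \<sigma>] by blast
  define v where "v = \<sigma>' (\<tau> (\<sigma> (bas c)))"
  have r1: "rel (T (bas i) v 0) (T (\<tau> (bas i)) (bas c) 0)"
    using stabilizer_rel[OF \<sigma> \<sigma>' \<tau> i, of "bas c" 0] i c by (simp add: v_def \<tau>c hh_bas_bas)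
  have u: "uni \<sigma>" "uni \<sigma>'" "uni \<tau>" using N_uni \<sigma> \<sigma>' \<tau> EE_uni by auto
  have "v = \<sigma>' (\<tau> (\<sigma> (bas c)))" "bas i = \<sigma>' (\<tau> (\<sigma> (bas i)))"
    using \<sigma>'(2) \<tau>(2) by (simp add: v_def, metis comp_apply id_apply)
  then have v0: "hh (bas i) v = 0"
    using uniD(3)[OF u(1), of "bas i" "bas c"] uniD(3)[OF u(2), of "\<tau> (\<sigma> (bas i))" "\<tau> (\<sigma> (bas c))"]
      uniD(3)[OF u(3), of "\<sigma> (bas i)" "\<sigma> (bas c)"] i c by (simp add: hh_bas_bas)
  \<comment> \<open>Conjugation by g multiplies the left side of r1 by Z and the right side by D, so
    Z and D agree modulo N. The vector d sees only the coordinates \<alpha> and \<delta> of the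
    image of \<open>bas i\<close>, and its \<delta> part gives an element of N.\<close>
  define g where "g = T (bas i) (scl 1 (bas (- a))) 0"
  have g: "g \<in> EE" unfolding g_def using i a by (intro EE_short1) auto
  have ug: "uni g" using g EE_uni by blast
  have gi: "g (bas i) = bas i" "g (bas c) = bas c"
    using i a c by (auto simp: g_def T_def hh_bas_bas)
  define \<mu> where "\<mu> = hh (bas (- a)) v"
  have gv: "g v = v + scl \<mu> (bas i)" using v0 by (simp add: g_def T_def \<mu>_def)
  define w where "w = \<tau> (bas i)"
  define d where "d = scl (th (- a) * \<alpha>) (bas i) - scl (bar lam * th i * \<delta>) (bas (- a))"
  have gw: "g w = w + d"
    using i a c Om_nonzero[OF i] Om_nonzero[OF a(1)]
    by (auto simp: fun_eq_iff g_def T_def w_def \<tau>i d_def hh_bas_left bas_apply algebra_simps)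
  define Z where "Z = T (bas i) 0 (skew \<mu>)"
  have e1: "T (bas i) (g v) 0 = Z \<circ> T (bas i) v 0"
    unfolding gv Z_def using v0 by (simp add: T_comp T_self skew_def)
  have "rel (T (bas i) (g v) 0) (T (g w) (bas c) 0)"
    using rel_conj1[OF g r1, of "T (bas i) (g v) 0" "T (g w) (bas c) 0"]
      T_conj[OF ug, of "bas i" v 0] T_conj[OF ug, of w "bas c" 0] by (simp add: gi w_def)
  moreover have cw: "hh (bas c) w = 0"
    using uniD(3)[OF u(3), of "bas c" "bas i"] i c by (simp add: w_def \<tau>c hh_bas_bas)
  have cd: "hh (bas c) d = 0" using i a c by (auto simp: d_def hh_bas_bas)
  define b1 where "b1 = - hh d w"
  define D where "D = T (bas c) (scl (- lam) d) b1"
  have "T (g w) (bas c) 0 = D \<circ> T w (bas c) 0"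
    unfolding D_def T_sym[of _ "bas c"] gw b1_def using cw cd
    by (subst T_comp) (simp_all add: scl_add_right mult_ac add.commute[of "scl (- lam) d"])
  ultimately have "rel (Z \<circ> T (bas i) v 0) (D \<circ> T w (bas c) 0)" by (simp add: e1)
  then have ZD: "rel Z D" using r1 unfolding w_def by (rule rel_cancel_right)
  define r where "r = - (lam * th (- a) * \<alpha>)"
  define D1 where "D1 = T (bas c) (scl r (bas i)) b1"
  have dd: "scl (- lam) d = scl (th i * \<delta>) (bas (- a)) + scl r (bas i)"
    by (auto simp: fun_eq_iff d_def r_def algebra_simps)
  let ?t = "\<lambda>x. T (bas c) (scl x (bas (- a))) 0"
  have Dt: "D = ?t (th i * \<delta>) \<circ> D1"
    unfolding D_def D1_def dd using i a c by (subst T_comp) (auto simp: hh_bas_bas)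
  have tN: "?t (th i * \<delta>) \<in> N"
    using \<delta> a c by (intro level_I_D level_I_mult) auto
  have b1: "b1 + lam * bar b1 = 0"
  proof -
    have "hh w w = 0" unfolding w_def uniD(3)[OF u(3)] by simp
    moreover have "hh (w + d) (w + d) = 0"
      unfolding gw[symmetric] uniD(3)[OF ug] by (simp add: \<open>hh w w = 0\<close>)
    moreover have "hh d d = 0" using i a by (auto simp: d_def hh_bas_bas hh_bas_left bas_apply)
    ultimately have "hh d w + hh w d = 0" by (simp add: add.commute)
    then show ?thesis using hh_swap[of w d] by (simp add: b1_def minus_unique add.commute)
  qed
  have D1: "D1 \<in> EE"
  proof -
    have "?t (- (th i * \<delta>)) \<circ> ?t (th i * \<delta>) = id"
      using a c by (subst T_comp) (auto simp: hh_bas_bas simp flip: scl_add)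
    then have "D1 = ?t (- (th i * \<delta>)) \<circ> D" unfolding Dt by (metis comp_assoc id_comp)
    moreover have "?t (- (th i * \<delta>)) \<in> EE" using a c by (intro EE_short1) auto
    ultimately show ?thesis using rel_EE(2)[OF ZD] EE_comp by metis
  qed
  have "rel D D1" unfolding rel_def using tN Dt D1 rel_EE(2)[OF ZD] by blast
  then have ZD1: "rel Z D1" using ZD by (blast intro: rel_trans)
  define m where "m = th (- c)"
  \<comment> \<open>g2 fixes \<open>bas i\<close>, hence commutes with Z, but moves
    \<open>bas c\<close>. As Z and D1 agree modulo N, the factors that \<open>T_split\<close> adds
    to D1 lie in N.\<close>
  define g2 where "g2 = T (bas a) (scl 1 (bas (- c))) 0"
  have g2: "g2 \<in> EE" unfolding g2_def using a c by (intro EE_short1) auto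
  have ug2: "uni g2" using g2 EE_uni by blast
  have g2i: "g2 (bas i) = bas i" "g2 (bas c) = bas c + scl m (bas a)"
    using i a c hh_bas_opp[of "- c"] by (auto simp: g2_def T_def hh_bas_bas m_def)
  have "rel Z (T (bas c + scl m (bas a)) (scl r (bas i)) b1)"
  proof (rule rel_conj1[OF g2 ZD1])
    show "g2 \<circ> Z = Z \<circ> g2" using T_conj[OF ug2, of "bas i" 0 "skew \<mu>"] by (simp add: Z_def g2i uniD(8)[OF ug2])
    show "g2 \<circ> D1 = T (bas c + scl m (bas a)) (scl r (bas i)) b1 \<circ> g2"
      using T_conj[OF ug2, of "bas c" "scl r (bas i)" b1] by (simp add: D1_def g2i uniD(2)[OF ug2])
  qed
  moreover have "T (bas c + scl m (bas a)) (scl r (bas i)) b1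
      = D1 \<circ> T (scl m (bas a)) (scl r (bas i)) b1 \<circ> T (bas c) (scl b1 (scl m (bas a))) 0"
    unfolding D1_def using i a c b1 by (intro T_split) (auto simp: hh_bas_bas)
  ultimately have "rel (D1 \<circ> (T (scl m (bas a)) (scl r (bas i)) b1 \<circ> T (bas c) (scl b1 (scl m (bas a))) 0)) (D1 \<circ> id)"
    using ZD1 rel_sym rel_trans by (metis comp_assoc comp_id)
  then have "rel (T (scl m (bas a)) (scl r (bas i)) b1 \<circ> T (bas c) (scl b1 (scl m (bas a))) 0) id"
    by (rule rel_cancel_left) (rule rel_refl[OF D1])
  moreover define k where "k = - (lam * bar (b1 * m))"
  have "T (bas c) (scl b1 (scl m (bas a))) 0 = T (bas a) (scl k (bas c)) 0"
    unfolding scl_simps k_def T_scl_bas[of "bas c" "b1 * m" a] ..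
  moreover have "T (bas a) (scl (bar m * r) (bas i)) (m * bar m * b1) \<circ> T (bas a) (scl k (bas c)) 0
      = T (bas a) (scl (bar m * r) (bas i) + scl k (bas c)) (m * bar m * b1)"
    using i a c by (subst T_comp) (auto simp: hh_bas_bas)
  ultimately have "T (bas a) (scl (bar m * r) (bas i) + scl k (bas c)) (m * bar m * b1) \<in> N"
    unfolding T_scale by (simp add: rel_id_iff)
  then have "(scl (bar m * r) (bas i) + scl k (bas c)) i \<in> level_I"
    using i a c by (intro N_radical[of a "scl (bar m * r) (bas i) + scl k (bas c)" "m * bar m * b1" i])
      (auto simp: hh_bas_bas)
  then have "bar m * r \<in> level_I" using c by (simp add: bas_apply)
  then have "- (bar lam * bar (th (- a)) * (m * (bar m * r))) \<in> level_I"
    by (intro level_I_minus[OF level_I_mult(2)[OF level_I_mult(2)]])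
  moreover have "- (bar lam * bar (th (- a)) * (m * (bar m * r))) = (bar lam * lam) * ((bar (th (- a)) * th (- a)) * \<alpha>)"
    by (simp add: m_def r_def) (simp add: mult_ac)
  ultimately show ?thesis by simp
qed

lemma column_N: "\<sigma> \<in> N \<Longrightarrow> i \<in> Om n \<Longrightarrow> column (\<sigma> (bas i))"
  by (simp add: column_uni column_bas N_uni)

lemma level_I_th: "th i * x \<in> level_I \<Longrightarrow> x \<in> level_I" "bar (th i) * x \<in> level_I \<Longrightarrow> x \<in> level_I"
  using level_I_mult(2)[of "th i * x" "bar (th i)"] level_I_mult(2)[of "bar (th i) * x" "th i"] by simp_all

lemma koszul_EE:
  assumes u: "column u" and k: "k \<in> Om n" "l \<in> Om n" "k \<noteq> - l" "k' \<in> Om n" "l' \<in> Om n" "k' \<noteq> - l'"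
    and "k \<noteq> - k'" "k \<noteq> - l'" "l \<noteq> - k'" "l \<noteq> - l'"
  shows "T (koszul u k l) (koszul u k' l') 0 \<in> EE" "T (koszul u k l) (koszul u k' l') 0 u = u"
proof -
  have "hh (koszul u k l) (koszul u k' l') = 0"
    using assms unfolding koszul_def by (auto simp: hh_two_left two_apply)
  then show "T (koszul u k l) (koszul u k' l') 0 \<in> EE"
    using k unfolding koszul_def by (intro T_two_EE) (auto simp flip: koszul_def)
  show "T (koszul u k l) (koszul u k' l') 0 u = u" by (simp add: T_def)
qed

text \<open>\<tau> is built from Koszul vectors, so it fixes u, and it moves \<open>bas i\<close>
  only by a multiple of \<open>koszul u l m\<close>. Both coordinates of that multiple are extracted
  by \<open>stabilizer_coeff\<close>, with \<open>l\<close> and \<open>m\<close> in either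
  role.\<close>

lemma phi_prod:
  assumes \<sigma>: "\<sigma> \<in> N" and i: "i \<in> Om n" and l: "l \<in> Om n" "l \<noteq> i" "l \<noteq> - i"
    and m: "m \<in> Om n" "m \<noteq> i" "m \<noteq> - i" "m \<noteq> l" "m \<noteq> - l"
  defines "u \<equiv> \<sigma> (bas i)"
  shows "phi u m * bar (phi u l) \<in> level_I" "phi u l * bar (phi u l) \<in> level_I"
proof -
  have u: "column u" unfolding u_def using \<sigma> i by (rule column_N)
  define \<tau> where "\<tau> = T (koszul u (- i) l) (koszul u l m) 0"
  have \<tau>: "\<tau> \<in> EE" "\<tau> (\<sigma> (bas i)) = \<sigma> (bas i)"
    unfolding \<tau>_def u_def[symmetric] using u i l m Om_nonzero[OF l(1)] by (auto intro!: koszul_EE)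
  have \<tau>l: "\<tau> (bas l) = bas l" and \<tau>m: "\<tau> (bas m) = bas m"
    using i l m Om_nonzero[OF l(1)] Om_nonzero[OF m(1)]
    by (auto simp: \<tau>_def T_def koszul_def hh_two_left bas_apply)
  define c where "c = bar lam * th (- i) * bar (phi u l)"
  have "hh (koszul u (- i) l) (bas i) = bar (phi u l) * th (- i)" "hh (koszul u l m) (bas i) = 0"
    using i l m by (auto simp: koszul_def hh_two_left bas_apply)
  then have \<tau>i: "\<tau> (bas i) = bas i + scl (- (c * phi u m)) (bas l) + scl (c * phi u l) (bas m) + scl 0 (bas (- i))"
    by (auto simp: fun_eq_iff \<tau>_def T_def c_def) (auto simp: koszul_def two_def algebra_simps)
  then have \<tau>i': "\<tau> (bas i) = bas i + scl (c * phi u l) (bas m) + scl (- (c * phi u m)) (bas l) + scl 0 (bas (- i))"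
    by (simp add: add_ac)
  have "- (c * phi u m) \<in> level_I"
    by (rule stabilizer_coeff[OF \<sigma> \<tau> i l m \<tau>m \<tau>i level_I_0])
  moreover have "c * phi u l \<in> level_I"
    by (rule stabilizer_coeff[OF \<sigma> \<tau> i m(1-3) l _ _ \<tau>l \<tau>i' level_I_0]) (use m in auto)
  ultimately have "lam * bar (th (- i)) * - (- (c * phi u m)) \<in> level_I" "lam * bar (th (- i)) * (c * phi u l) \<in> level_I"
    by (blast intro: level_I_minus level_I_mult)+
  moreover have "lam * bar (th (- i)) * (c * x) = (lam * bar lam) * ((bar (th (- i)) * th (- i)) * (x * bar (phi u l)))" for x
    by (simp only: c_def mult_ac)
  ultimately show "phi u m * bar (phi u l) \<in> level_I" "phi u l * bar (phi u l) \<in> level_I" by simp_all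
qed

text \<open>Now \<tau> also gives \<open>bas i\<close> a coordinate \<delta> at \<open>- i\<close>,
  but \<delta> is a combination of products already covered by \<open>phi_prod\<close>.\<close>

lemma phi_prod_diag:
  assumes \<sigma>: "\<sigma> \<in> N" and i: "i \<in> Om n" and c: "c \<in> Om n" "c \<noteq> i" "c \<noteq> - i"
  defines "u \<equiv> \<sigma> (bas i)"
  shows "phi u (- i) * bar (phi u c) \<in> level_I"
proof -
  obtain a where a: "a \<in> Om n" "a \<noteq> i" "a \<noteq> - i" "a \<noteq> c" "a \<noteq> - c" using ex_Om by blast
  have u: "column u" unfolding u_def using \<sigma> i by (rule column_N)
  define \<tau> where "\<tau> = T (koszul u a (- i)) (koszul u (- i) c) 0"
  have \<tau>: "\<tau> \<in> EE" "\<tau> (\<sigma> (bas i)) = \<sigma> (bas i)"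
    unfolding \<tau>_def u_def[symmetric] using u i a c Om_nonzero[OF i] by (auto intro!: koszul_EE)
  have \<tau>c: "\<tau> (bas c) = bas c"
    using i a c Om_nonzero[OF c(1)] by (auto simp: \<tau>_def T_def koszul_def hh_two_left bas_apply)
  define x where "x = th (- i)"
  define \<delta> where "\<delta> = - (x * bar (phi u c) * phi u a) + bar lam * x * bar (phi u a) * phi u c"
  have "hh (koszul u a (- i)) (bas i) = - (bar (phi u a) * x)" "hh (koszul u (- i) c) (bas i) = bar (phi u c) * x"
    using i a c by (auto simp: koszul_def hh_two_left bas_apply x_def)
  then have \<tau>i: "\<tau> (bas i) = bas i + scl (x * (phi u (- i) * bar (phi u c))) (bas a)
      + scl (- (bar lam * x * bar (phi u a) * phi u (- i))) (bas c) + scl \<delta> (bas (- i))"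
    by (auto simp: fun_eq_iff \<tau>_def T_def \<delta>_def) (auto simp: koszul_def two_def algebra_simps)
  have "phi u a * bar (phi u c) \<in> level_I" "phi u c * bar (phi u a) \<in> level_I"
    unfolding u_def using phi_prod(1)[OF \<sigma> i] a c by auto
  then have "- (x * (phi u a * bar (phi u c))) + (bar lam * x) * (phi u c * bar (phi u a)) \<in> level_I"
    by (intro level_I_add[OF level_I_minus[OF level_I_mult(2)] level_I_mult(2)])
  then have "\<delta> \<in> level_I" by (simp add: \<delta>_def mult_ac)
  then have "x * (phi u (- i) * bar (phi u c)) \<in> level_I"
    using stabilizer_coeff[OF \<sigma> \<tau> i a(1-3) c _ _ \<tau>c \<tau>i] a by auto
  then show ?thesis unfolding x_def by (rule level_I_th)
qed

lemma coord_prod: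
  assumes \<sigma>: "\<sigma> \<in> N" and i: "i \<in> Om n" and p: "p \<in> Om n" "p \<noteq> i" "p \<noteq> - i"
    and q: "q \<in> Om n" "q \<noteq> i" "q \<noteq> - i" "q \<noteq> - p"
  shows "bar (\<sigma> (bas i) p) * \<sigma> (bas i) q \<in> level_I"
proof -
  let ?u = "\<sigma> (bas i)"
  have "phi ?u (- p) * bar (phi ?u (- q)) \<in> level_I"
  proof (cases "p = q")
    case True
    obtain m where m: "m \<in> Om n" "m \<noteq> i" "m \<noteq> - i" "m \<noteq> - q" "m \<noteq> - (- q)" using ex_Om by fastforce
    then show ?thesis unfolding True using phi_prod(2)[OF \<sigma> i, of "- q" m] q by auto
  next
    case False
    then show ?thesis using phi_prod(1)[OF \<sigma> i, of "- q" "- p"] p q by auto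
  qed
  then have "th p * (bar (th q) * (bar (?u p) * ?u q)) \<in> level_I"
    using p q by (simp add: phi_opp mult_ac)
  then show ?thesis using level_I_th by blast
qed

lemma coord_prod_diag:
  assumes \<sigma>: "\<sigma> \<in> N" and i: "i \<in> Om n" and q: "q \<in> Om n" "q \<noteq> i" "q \<noteq> - i"
  shows "bar (\<sigma> (bas i) i) * \<sigma> (bas i) q \<in> level_I"
proof -
  let ?u = "\<sigma> (bas i)"
  have "phi ?u (- i) * bar (phi ?u (- q)) \<in> level_I"
    using phi_prod_diag[OF \<sigma> i, of "- q"] q by auto
  then have "th i * (bar (th q) * (bar (?u i) * ?u q)) \<in> level_I"
    using i q by (simp add: phi_opp mult_ac)
  then show ?thesis using level_I_th by blast
qed

lemma conj_column:
  assumes \<sigma>: "\<sigma> \<in> N" and \<epsilon>: "\<epsilon> \<in> EE"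
  obtains \<sigma>2 where "\<sigma>2 \<in> N" "\<And>v. \<sigma>2 (\<epsilon> v) = \<epsilon> (\<sigma> v)"
  using N_norm[OF \<epsilon> \<sigma>] by (metis comp_apply)

lemma level_I_cancel: "x + y \<in> level_I \<Longrightarrow> x \<in> level_I \<Longrightarrow> y \<in> level_I"
  using level_I_add[of "x + y" "- x"] level_I_minus[of x] by simp

text \<open>\<epsilon> fixes \<open>bas i\<close>, so the conjugate of \<sigma> has i-th column
  \<open>\<epsilon> ?u\<close>. Its coordinate at \<open>- l\<close> contains u_-i, and
  \<open>coord_prod\<close> applies to the conjugate.\<close>

lemma coord_prod_opp:
  assumes \<sigma>: "\<sigma> \<in> N" and i: "i \<in> Om n" and q: "q \<in> Om n" "q \<noteq> i" "q \<noteq> - i"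
  shows "bar (\<sigma> (bas i) (- i)) * \<sigma> (bas i) q \<in> level_I"
proof -
  let ?u = "\<sigma> (bas i)"
  obtain l where l: "l \<in> Om n" "l \<noteq> i" "l \<noteq> - i" "l \<noteq> q" "l \<noteq> - q" using ex_Om by blast
  define \<epsilon> where "\<epsilon> = T (bas i) (scl (lam * bar (th i)) (bas (- l))) 0"
  have \<epsilon>: "\<epsilon> \<in> EE" unfolding \<epsilon>_def using i l by (intro EE_short1) auto
  have \<epsilon>i: "\<epsilon> (bas i) = bas i" using i l by (auto simp: \<epsilon>_def T_def hh_bas_bas)
  obtain \<sigma>2 where \<sigma>2: "\<sigma>2 \<in> N" "\<sigma>2 (bas i) = \<epsilon> ?u" using conj_column[OF \<sigma> \<epsilon>] \<epsilon>i by metis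
  have "\<epsilon> ?u q = ?u q" "\<epsilon> ?u (- l) = ?u (- l) - ?u (- i)"
    using i l q by (auto simp: \<epsilon>_def T_def hh_bas_left bas_apply mult.assoc mult.left_commute[of "th i"] mult.commute[of _ lam])
  then have "bar (?u (- l) - ?u (- i)) * ?u q \<in> level_I"
    using coord_prod[OF \<sigma>2(1) i, of "- l" q] \<sigma>2(2) l q by auto
  then have "bar (?u (- l)) * ?u q + - (bar (?u (- i)) * ?u q) \<in> level_I" by (simp add: algebra_simps)
  moreover have "bar (?u (- l)) * ?u q \<in> level_I" using coord_prod[OF \<sigma> i, of "- l" q] l q by auto
  ultimately have "- (bar (?u (- i)) * ?u q) \<in> level_I" by (rule level_I_cancel)
  then show ?thesis using level_I_minus by fastforce
qed

lemma is_ideal_level_I: "is_ideal level_I"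
  by (simp add: is_ideal_def level_I_0 level_I_add level_I_mult)

lemma coord_unimodular:
  assumes \<sigma>: "\<sigma> \<in> N" and i: "i \<in> Om n" and "\<And>j. j \<in> Om n \<Longrightarrow> bar (\<sigma> (bas i) j) * c \<in> level_I"
  shows "c \<in> level_I"
proof (rule unimodular[OF column_N[OF \<sigma> i] is_ideal_level_I])
  fix k assume k: "k \<in> Om n"
  then have "th (- k) * (bar (\<sigma> (bas i) (- k)) * c) \<in> level_I" using level_I_mult(2)[OF assms(3)[of "- k"], of "th (- k)"] by simp
  then show "c * phi (\<sigma> (bas i)) k \<in> level_I" using k phi_opp[of "- k"] by (simp add: mult_ac)
qed

text \<open>Tested against bar(u_j), only j = -k is new. Conjugation by an \<epsilon> fixing
  \<open>bas i\<close> mixes u_l into position -k and u_k into position -l; in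
  \<open>coord_prod\<close> for these positions, multiplied by bar(u_-k), all other terms are
  known.\<close>

lemma coord_prod_neg:
  assumes \<sigma>: "\<sigma> \<in> N" and i: "i \<in> Om n" and k: "k \<in> Om n" "k \<noteq> i" "k \<noteq> - i"
  shows "bar (\<sigma> (bas i) (- k)) * \<sigma> (bas i) k \<in> level_I"
proof (rule coord_unimodular[OF \<sigma> i])
  let ?u = "\<sigma> (bas i)"
  fix j assume j: "j \<in> Om n"
  show "bar (?u j) * (bar (?u (- k)) * ?u k) \<in> level_I"
  proof (cases "j = - k")
    case False
    then have "bar (?u j) * ?u k \<in> level_I"
      using coord_prod[OF \<sigma> i j _ _ k] coord_prod_diag[OF \<sigma> i k] coord_prod_opp[OF \<sigma> i k]
      by (cases "j = i"; cases "j = - i") auto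
    then have "bar (?u (- k)) * (bar (?u j) * ?u k) \<in> level_I" by (rule level_I_mult)
    then show ?thesis by (simp add: mult_ac)
  next
    case True
    obtain l where l: "l \<in> Om n" "l \<noteq> i" "l \<noteq> - i" "l \<noteq> k" "l \<noteq> - k" using ex_Om by blast
    define \<epsilon> where "\<epsilon> = T (bas (- k)) (scl (th (- l)) (bas (- l))) 0"
    have \<epsilon>: "\<epsilon> \<in> EE" unfolding \<epsilon>_def using k l by (intro EE_short1) auto
    have \<epsilon>i: "\<epsilon> (bas i) = bas i" using i k l by (auto simp: \<epsilon>_def T_def hh_bas_bas)
    obtain \<sigma>2 where \<sigma>2: "\<sigma>2 \<in> N" "\<sigma>2 (bas i) = \<epsilon> ?u" using conj_column[OF \<sigma> \<epsilon>] \<epsilon>i by metis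
    define \<kappa> where "\<kappa> = bar lam * th (- l) * th (- k)"
    have "\<epsilon> ?u (- k) = ?u (- k) + ?u l" "\<epsilon> ?u (- l) = ?u (- l) - \<kappa> * ?u k"
      using k l by (auto simp: \<epsilon>_def T_def hh_bas_left bas_apply \<kappa>_def mult.assoc mult.left_commute[of _ "th (- l)"])
    then have "bar (?u (- k) + ?u l) * (?u (- l) - \<kappa> * ?u k) \<in> level_I"
      using coord_prod[OF \<sigma>2(1) i, of "- k" "- l"] \<sigma>2(2) k l by auto
    then have a: "bar (?u (- k)) * (bar (?u (- k) + ?u l) * (?u (- l) - \<kappa> * ?u k)) \<in> level_I"
      by (rule level_I_mult)
    have b: "bar (?u (- k)) * ?u (- l) \<in> level_I" "bar (?u l) * ?u k \<in> level_I"
      using coord_prod[OF \<sigma> i, of "- k" "- l"] coord_prod[OF \<sigma> i, of l k] k l by auto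
    have "(bar (?u (- k)) + bar (?u l)) * (bar (?u (- k)) * ?u (- l))
        + - (\<kappa> * bar (?u (- k)) * (bar (?u l) * ?u k)) \<in> level_I"
      by (intro level_I_add[OF level_I_mult(2) level_I_minus[OF level_I_mult(2)]] b)
    moreover have "(bar (?u (- k)) + bar (?u l)) * (bar (?u (- k)) * ?u (- l))
        + - (\<kappa> * bar (?u (- k)) * (bar (?u l) * ?u k)) + - (\<kappa> * (bar (?u (- k)) * (bar (?u (- k)) * ?u k)))
        = bar (?u (- k)) * (bar (?u (- k) + ?u l) * (?u (- l) - \<kappa> * ?u k))"
      by (simp add: algebra_simps)
    ultimately have "- (\<kappa> * (bar (?u (- k)) * (bar (?u (- k)) * ?u k))) \<in> level_I"
      using a level_I_cancel by metis
    then have "(lam * bar (th (- l)) * bar (th (- k))) * - (- (\<kappa> * (bar (?u (- k)) * (bar (?u (- k)) * ?u k)))) \<in> level_I"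
      by (rule level_I_mult(2)[OF level_I_minus])
    moreover have "(lam * bar (th (- l)) * bar (th (- k))) * (\<kappa> * y)
        = (lam * bar lam) * ((th (- l) * bar (th (- l))) * ((th (- k) * bar (th (- k))) * y))" for y
      by (simp only: \<kappa>_def mult_ac)
    ultimately show ?thesis using True by simp
  qed
qed

lemma off_diag1:
  assumes \<sigma>: "\<sigma> \<in> N" and i: "i \<in> Om n" and k: "k \<in> Om n" "k \<noteq> i" "k \<noteq> - i"
  shows "\<sigma> (bas i) k \<in> level_I"
proof (rule coord_unimodular[OF \<sigma> i])
  fix j assume j: "j \<in> Om n"
  show "bar (\<sigma> (bas i) j) * \<sigma> (bas i) k \<in> level_I"
    using coord_prod[OF \<sigma> i j _ _ k] coord_prod_diag[OF \<sigma> i k] coord_prod_opp[OF \<sigma> i k] coord_prod_neg[OF \<sigma> i k]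
    by (cases "j = i"; cases "j = - i"; cases "j = - k") auto
qed

lemma off_diag:
  assumes \<sigma>: "\<sigma> \<in> N" and i: "i \<in> Om n" and k: "k \<in> Om n" "k \<noteq> i"
  shows "\<sigma> (bas i) k \<in> level_I"
proof (cases "k = - i")
  case True
  let ?u = "\<sigma> (bas i)"
  obtain l where l: "l \<in> Om n" "l \<noteq> i" "l \<noteq> - i" using ex_Om by blast
  define \<epsilon> where "\<epsilon> = T (bas i) (scl (lam * bar (th i)) (bas (- l))) 0"
  have \<epsilon>: "\<epsilon> \<in> EE" unfolding \<epsilon>_def using i l by (intro EE_short1) auto
  have \<epsilon>i: "\<epsilon> (bas i) = bas i" using i l by (auto simp: \<epsilon>_def T_def hh_bas_bas)
  obtain \<sigma>2 where \<sigma>2: "\<sigma>2 \<in> N" "\<sigma>2 (bas i) = \<epsilon> ?u" using conj_column[OF \<sigma> \<epsilon>] \<epsilon>i by metis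
  have "\<epsilon> ?u (- l) = ?u (- l) + - ?u (- i)"
    using i l by (auto simp: \<epsilon>_def T_def hh_bas_left bas_apply mult.assoc mult.left_commute[of "th i"] mult.commute[of _ lam])
  then have "?u (- l) + - ?u (- i) \<in> level_I"
    using off_diag1[OF \<sigma>2(1) i, of "- l"] \<sigma>2(2) l by auto
  moreover have "?u (- l) \<in> level_I" using off_diag1[OF \<sigma> i, of "- l"] l by auto
  ultimately have "- ?u (- i) \<in> level_I" by (rule level_I_cancel)
  then show ?thesis using True level_I_minus by fastforce
qed (use assms off_diag1 in blast)

lemma N_scalar:
  assumes \<sigma>: "\<sigma> \<in> N" shows "\<exists>c. lv.scalar \<sigma> c"
proof (rule lv.scalarI)
  show "\<sigma> (bas i) k \<in> level_I" if "i \<in> Om n" "k \<in> Om n" "k \<noteq> i" for i k using off_diag[OF \<sigma> that] .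
  show "\<sigma> (bas i) \<in> VV" if "i \<in> Om n" for i using uniD(5)[OF N_uni[OF \<sigma>]] that by simp
  fix i j assume ij: "i \<in> Om n" "j \<in> Om n" "j \<noteq> i" "j \<noteq> - i"
  \<comment> \<open>As \<epsilon> carries \<open>bas i - bas j\<close> to \<open>bas i\<close> and
    adds coordinate i to coordinate j, an off-diagonal entry of the conjugate contains the
    difference of the two diagonal entries.\<close>
  define \<epsilon> where "\<epsilon> = T (bas j) (scl (th (- i)) (bas (- i))) 0"
  have \<epsilon>: "\<epsilon> \<in> EE" unfolding \<epsilon>_def using ij by (intro EE_short1) auto
  have e: "\<epsilon> (bas i - bas j) = bas i"
    using ij hh_bas_opp[of "- i"] by (auto simp: \<epsilon>_def T_def hh_bas_bas)
  obtain \<sigma>2 where \<sigma>2: "\<sigma>2 \<in> N" "\<And>v. \<sigma>2 (\<epsilon> v) = \<epsilon> (\<sigma> v)" using conj_column[OF \<sigma> \<epsilon>] by metis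
  have "\<sigma>2 (bas i) = \<epsilon> (\<sigma> (bas i) - \<sigma> (bas j))"
    using \<sigma>2(2)[of "bas i - bas j"] unfolding e uniD(7)[OF N_uni[OF \<sigma>]] .
  moreover have "\<epsilon> w j = w j + w i" for w
    using ij by (auto simp: \<epsilon>_def T_def hh_bas_left bas_apply)
  ultimately have "\<sigma>2 (bas i) j = (\<sigma> (bas i) j - \<sigma> (bas j) i) + (\<sigma> (bas i) i - \<sigma> (bas j) j)" by simp
  then have "(\<sigma> (bas i) j - \<sigma> (bas j) i) + (\<sigma> (bas i) i - \<sigma> (bas j) j) \<in> level_I"
    using off_diag[OF \<sigma>2(1) ij(1-3)] by simp
  moreover have "\<sigma> (bas i) j - \<sigma> (bas j) i \<in> level_I"
    using off_diag[OF \<sigma>] ij by (intro lv.I_diff) auto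
  ultimately show "\<sigma> (bas i) i - \<sigma> (bas j) j \<in> level_I" by (rule level_I_cancel)
qed

text \<open>The corrected column is \<open>?u - scl \<beta> ?v\<close>. Since h(u,v) =
  \<open>th i\<close> and \<open>\<beta> * th i = f\<close>, the cross terms contribute -f up to
  \<open>skew\<close> of an element of \<open>level_I\<close>.\<close>

lemma ff_long_correct:
  assumes \<sigma>: "\<sigma> \<in> N" and i: "i \<in> Om n"
  defines "f \<equiv> ff (\<sigma> (bas i)) (\<sigma> (bas i))"
  shows "f \<in> \<Lambda>" "f \<in> level_I"
    "ff (\<sigma> (T (bas (- i)) 0 f (bas i))) (\<sigma> (T (bas (- i)) 0 f (bas i))) \<in> level_G"
proof -
  note u = N_uni[OF \<sigma>]
  obtain c where c: "lv.scalar \<sigma> c" using N_scalar[OF \<sigma>] by blast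
  let ?u = "\<sigma> (bas i)" and ?v = "\<sigma> (bas (- i))"
  show fL: "f \<in> \<Lambda>" using uniD(4)[OF u, of "bas i"] by (simp add: f_def)
  have "ff ?u ?u - ff (scl c (bas i)) (scl c (bas i)) \<in> level_I"
    using c i by (intro lv.ff_veq) (auto simp: lv.scalar_def)
  then show fI: "f \<in> level_I" by (simp add: f_def)
  have vL: "ff ?v ?v \<in> \<Lambda>" using uniD(4)[OF u, of "bas (- i)"] by simp
  define \<beta> where "\<beta> = bar lam * th (- i) * f"
  have \<beta>I: "\<beta> \<in> level_I" unfolding \<beta>_def using fI by (rule level_I_mult)
  have "T (bas (- i)) 0 f (bas i) = bas i - scl \<beta> (bas (- i))"
    using i hh_bas_opp[of "- i"] by (simp add: T_def \<beta>_def mult_ac)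
  then have w: "\<sigma> (T (bas (- i)) 0 f (bas i)) = ?u - scl \<beta> ?v"
    by (simp only: uniD[OF u])
  have "hh ?u ?v = th i" unfolding uniD(3)[OF u] using i by (rule hh_bas_opp)
  then have uv: "ff ?u ?v = th i - lam * bar (ff ?v ?u)" using ff_swap_add[of ?u ?v] by simp
  have "\<beta> * th i = (bar lam * f) * (th i * th (- i))" by (simp add: \<beta>_def mult_ac)
  then have "\<beta> * th i = f" using i by (simp add: th_th_minus mult.commute[of _ lam])
  then have "ff (?u - scl \<beta> ?v) (?u - scl \<beta> ?v) = \<beta> * ff ?v ?v * bar \<beta> - skew (bar \<beta> * ff ?v ?u)"
    by (simp add: uv skew_def f_def algebra_simps)
  moreover have "skew (bar \<beta> * ff ?v ?u) \<in> level_G" using \<beta>I by (intro level_G_skew level_I_mult level_I_bar)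
  ultimately show "ff (\<sigma> (T (bas (- i)) 0 f (bas i))) (\<sigma> (T (bas (- i)) 0 f (bas i))) \<in> level_G"
    unfolding w using level_G_conj_I[OF \<beta>I vL] by (simp add: lv.Gam_diff)
qed

lemma T_long_veq:
  assumes "j \<in> Om n" "b \<in> level_I" "v \<in> VV"
  shows "lv.veq (T (bas j) 0 b v) v" "T (bas j) 0 b v \<in> VV"
proof -
  have "T (bas j) 0 b v k - v k = b * - (bar lam * hh (bas j) v * bas j k)" for k
    by (simp add: T_def mult_ac)
  then show "lv.veq (T (bas j) 0 b v) v" using assms(2) by (simp only: lv.veq_def level_I_mult(1) simp_thms)
  show "T (bas j) 0 b v \<in> VV" using assms by (simp add: T_def)
qed

text \<open>The long root elements \<open>L1\<close> and \<open>L2\<close> are chosen so that \<open>f\<close> takes values in \<open>level_G\<close> on two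
  columns of \<open>\<kappa> = \<sigma> L1 L2\<close>. Hence \<open>\<kappa>\<close>, and with it \<open>L1 L2\<close>, commutes modulo \<open>N\<close> with a
  short root element, and this commutator isolates the parameter of \<open>L1\<close>.\<close>

lemma N_ff:
  assumes \<sigma>: "\<sigma> \<in> N" and i: "i \<in> Om n"
  shows "ff (\<sigma> (bas i)) (\<sigma> (bas i)) \<in> level_G"
proof -
  note u = N_uni[OF \<sigma>]
  obtain c where c: "lv.scalar \<sigma> c" using N_scalar[OF \<sigma>] by blast
  obtain j where j: "j \<in> Om n" "j \<noteq> i" "j \<noteq> - i" using ex_Om by blast
  have j': "- j \<in> Om n" using j by simp
  define b1 b2 where "b1 = ff (\<sigma> (bas i)) (\<sigma> (bas i))" and "b2 = ff (\<sigma> (bas (- j))) (\<sigma> (bas (- j)))"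
  have b: "b1 \<in> \<Lambda>" "b1 \<in> level_I" "b2 \<in> \<Lambda>" "b2 \<in> level_I"
    unfolding b1_def b2_def using ff_long_correct[OF \<sigma> i] ff_long_correct[OF \<sigma> j'] by auto
  define L1 L2 where "L1 = T (bas (- i)) 0 b1" and "L2 = T (bas j) 0 b2"
  have L: "L1 \<in> EE" "L2 \<in> EE" unfolding L1_def L2_def using i j b by (auto intro: EE_long1)
  have uL: "uni L1" "uni L2" using L EE_uni by auto
  define \<beta>1 \<beta>2 where "\<beta>1 = bar lam * th (- i) * b1" and "\<beta>2 = bar lam * th j * b2"
  have Li: "L1 (bas i) = bas i - scl \<beta>1 (bas (- i))" "L2 (bas i) = bas i"
    "L2 (bas (- j)) = bas (- j) - scl \<beta>2 (bas j)" "L1 (bas (- j) - scl \<beta>2 (bas j)) = bas (- j) - scl \<beta>2 (bas j)"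
    "L1 (bas (- j)) = bas (- j)"
    using i j hh_bas_opp[of "- i"] by (auto simp: L1_def L2_def \<beta>1_def \<beta>2_def T_def hh_bas_bas mult_ac)
  define \<kappa> where "\<kappa> = \<sigma> \<circ> (L1 \<circ> L2)"
  have \<kappa>u: "uni \<kappa>" unfolding \<kappa>_def using u uL by (intro uni_comp)
  have \<kappa>s: "lv.scalar \<kappa> c"
    unfolding \<kappa>_def
  proof (rule lv.scalar_comp[OF u c])
    fix k assume k: "k \<in> Om n"
    have V: "L2 (bas k) \<in> VV" "lv.veq (L2 (bas k)) (bas k)"
      unfolding L2_def using T_long_veq[of j b2 "bas k"] j b k by auto
    show "(L1 \<circ> L2) (bas k) \<in> VV" "lv.veq ((L1 \<circ> L2) (bas k)) (bas k)"
      using T_long_veq[of "- i" b1 "L2 (bas k)"] V i b lv.veq_trans[OF _ V(2)] by (auto simp: L1_def)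
  qed
  have \<kappa>f: "ff (\<kappa> (bas i)) (\<kappa> (bas i)) \<in> level_G" "ff (\<kappa> (bas (- j))) (\<kappa> (bas (- j))) \<in> level_G"
    using ff_long_correct(3)[OF \<sigma> i] ff_long_correct(3)[OF \<sigma> j'] Li
    by (simp_all add: \<kappa>_def L1_def[symmetric] L2_def[symmetric] flip: b1_def b2_def)
  define T0 where "T0 = T (bas i) (bas (- j)) 0"
  have T0: "T0 \<in> EE" unfolding T0_def using EE_short1[of i "- j" 1] i j by auto
  have "rel (T (\<kappa> (bas i)) (scl 1 (\<kappa> (bas (- j)))) 0) (T (bas i) (scl 1 (bas (- j))) 0)"
    using \<kappa>u \<kappa>s i j \<kappa>f by (intro lv.rel_column_short) auto
  then obtain \<nu> where \<nu>: "\<nu> \<in> N" "T (\<kappa> (bas i)) (\<kappa> (bas (- j))) 0 = \<nu> \<circ> T0"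
    unfolding rel_def T0_def by auto
  have "\<kappa> \<circ> T0 = \<nu> \<circ> T0 \<circ> \<kappa>" using T_conj[OF \<kappa>u, of "bas i" "bas (- j)" 0] \<nu> by (simp add: T0_def)
  then have k: "\<sigma> \<circ> (L1 \<circ> L2 \<circ> T0) = \<nu> \<circ> (T0 \<circ> \<sigma>) \<circ> (L1 \<circ> L2)" by (simp add: \<kappa>_def comp_assoc)
  obtain \<nu>2 where \<nu>2: "\<nu>2 \<in> N" "T0 \<circ> \<sigma> = \<nu>2 \<circ> T0" using N_norm[OF T0 \<sigma>] by blast
  obtain \<sigma>' where \<sigma>': "\<sigma>' \<in> N" "\<sigma>' \<circ> \<sigma> = id" using N_inv[OF \<sigma>] by blast
  have "L1 \<circ> L2 \<circ> T0 = \<sigma>' \<circ> (\<sigma> \<circ> (L1 \<circ> L2 \<circ> T0))" using \<sigma>'(2) by (simp flip: comp_assoc)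
  also have "\<dots> = (\<sigma>' \<circ> (\<nu> \<circ> \<nu>2)) \<circ> (T0 \<circ> (L1 \<circ> L2))" unfolding k \<nu>2(2) by (simp add: comp_assoc)
  finally have "rel (L1 \<circ> L2 \<circ> T0) (T0 \<circ> (L1 \<circ> L2))"
    unfolding rel_def using T0 L \<sigma>' \<nu> \<nu>2 by (blast intro: EE_comp N_comp)
  \<comment> \<open>M2 is T0 conjugated by L2, and M1 below is T0 conjugated by the inverse of L1;
    the congruence becomes one between M2 and M1.\<close>
  moreover define M2 where "M2 = T (bas i) (bas (- j) - scl \<beta>2 (bas j)) 0"
  moreover have "L2 \<circ> T0 = M2 \<circ> L2"
    using T_conj[OF uL(2), of "bas i" "bas (- j)" 0] by (simp add: T0_def M2_def Li)
  ultimately have "rel ((L1 \<circ> M2) \<circ> L2) ((T0 \<circ> L1) \<circ> L2)" by (simp add: comp_assoc)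
  then have r: "rel (L1 \<circ> M2) (T0 \<circ> L1)" by (rule rel_cancel_right) (rule rel_refl[OF L(2)])
  define L1' where "L1' = T (bas (- i)) 0 (- b1)"
  have L1': "L1' \<in> EE" "L1 \<circ> L1' = id" unfolding L1_def L1'_def using i b
    by (auto intro: EE_long1 Lam_minus simp: T_comp)
  define M1 where "M1 = T (bas i + scl \<beta>1 (bas (- i))) (bas (- j)) 0"
  have "L1' (bas i) = bas i + scl \<beta>1 (bas (- i))" "L1' (bas (- j)) = bas (- j)"
    using i j hh_bas_opp[of "- i"] by (auto simp: L1'_def \<beta>1_def T_def hh_bas_bas mult_ac scl_minus)
  then have "L1' \<circ> T0 = M1 \<circ> L1'"
    using T_conj[OF EE_uni[OF L1'(1)], of "bas i" "bas (- j)" 0] by (simp add: T0_def M1_def)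
  then have "L1 \<circ> (L1' \<circ> T0) \<circ> L1 = L1 \<circ> M1 \<circ> (L1' \<circ> L1)" by (simp add: comp_assoc)
  moreover have "L1' \<circ> L1 = id" unfolding L1_def L1'_def by (simp add: T_comp)
  ultimately have "T0 \<circ> L1 = L1 \<circ> M1" using L1'(2) by (simp flip: comp_assoc)
  then have "rel (L1 \<circ> M2) (L1 \<circ> M1)" using r by simp
  then have M: "rel M2 M1" by (rule rel_cancel_left) (rule rel_refl[OF L(1)])
  have b1e: "- (bar \<beta>1 * th (- i)) = b1"
  proof -
    have "bar \<beta>1 * th (- i) = (lam * bar b1) * (bar (th (- i)) * th (- i))" by (simp add: \<beta>1_def mult_ac)
    then show ?thesis using b by (simp add: Lam_skew)
  qed
  have b2e: "bar \<beta>2 * th j = - b2"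
  proof -
    have "bar \<beta>2 * th j = (lam * bar b2) * (bar (th j) * th j)" by (simp add: \<beta>2_def mult_ac)
    then show ?thesis using b by (simp add: Lam_skew)
  qed
  have "\<beta>1 \<in> level_I" "\<beta>2 \<in> level_I" unfolding \<beta>1_def \<beta>2_def using b by (blast intro: level_I_mult)+
  \<comment> \<open>Up to short root elements with parameters in \<open>level_I\<close>, M2 and M1
    are T0 multiplied by these long root elements, which sit at different indices.\<close>
  define Z2 Z1 where "Z2 = T (bas i) 0 (- b2)" and "Z1 = T (bas (- j)) 0 b1"
  have Z: "Z2 \<in> EE" "Z1 \<in> EE" unfolding Z1_def Z2_def using i j b by (auto intro: EE_long1 Lam_minus)
  have "M2 = Z2 \<circ> (T (bas i) (scl (- \<beta>2) (bas j)) 0 \<circ> T0)"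
    unfolding M2_def Z2_def T0_def using i j b2e
    by (simp add: T_comp hh_bas_bas scl_minus algebra_simps)
  moreover have "rel (T (bas i) (scl (- \<beta>2) (bas j)) 0) id"
    using i j \<open>\<beta>2 \<in> level_I\<close> by (auto simp: rel_id_iff intro!: EE_short1 level_I_D level_I_minus)
  ultimately have M2: "rel M2 (Z2 \<circ> T0)"
    using rel_comp[OF rel_refl[OF Z(1)] rel_comp[OF _ rel_refl[OF T0]]] by fastforce
  have "M1 = T (bas (- j)) (scl (- lam) (bas i) + scl (- lam * \<beta>1) (bas (- i))) 0"
    unfolding M1_def T_sym[of _ "bas (- j)"] by (simp add: scl_add_right)
  also have "\<dots> = Z1 \<circ> (T (bas (- j)) (scl (- lam * \<beta>1) (bas (- i))) 0 \<circ> T (bas (- j)) (scl (- lam) (bas i)) 0)"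
    unfolding Z1_def using i j b1e hh_bas_opp[of "- i"]
    by (simp add: T_comp hh_bas_bas algebra_simps lam_cancel flip: b1e)
  also have "T (bas (- j)) (scl (- lam) (bas i)) 0 = T0" unfolding T0_def by (rule T_sym[symmetric])
  finally have "M1 = Z1 \<circ> (T (bas (- j)) (scl (- lam * \<beta>1) (bas (- i))) 0 \<circ> T0)" .
  moreover have "rel (T (bas (- j)) (scl (- lam * \<beta>1) (bas (- i))) 0) id"
    using i j \<open>\<beta>1 \<in> level_I\<close> by (auto simp: rel_id_iff intro!: EE_short1 level_I_D level_I_mult level_I_minus)
  ultimately have "rel M1 (Z1 \<circ> T0)"
    using rel_comp[OF rel_refl[OF Z(2)] rel_comp[OF _ rel_refl[OF T0]]] by fastforce
  then have "rel (Z2 \<circ> T0) (Z1 \<circ> T0)" using M M2 by (blast intro: rel_trans rel_sym)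
  then have Z21: "rel Z2 Z1" by (rule rel_cancel_right) (rule rel_refl[OF T0])
  obtain m where m: "m \<in> Om n" "m \<noteq> i" "m \<noteq> - i" "m \<noteq> j" "m \<noteq> - j" using ex_Om by blast
  \<comment> \<open>g fixes \<open>bas i\<close>, hence commutes with Z2, but moves
    \<open>bas (- j)\<close>. So Z1 and its conjugate agree modulo N, and the factors that
    \<open>long_split\<close> adds lie in N.\<close>
  define g where "g = T (bas m) (scl (th j) (bas j)) 0"
  have g: "g \<in> EE" unfolding g_def using j m by (intro EE_short1) auto
  have gi: "g (bas i) = bas i" "g (bas (- j)) = bas (- j) + scl 1 (bas m)"
    using i j m by (auto simp: g_def T_def hh_bas_bas)
  define Y where "Y = T (bas (- j) + scl 1 (bas m)) 0 b1"
  have "rel Z2 Y"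
  proof (rule rel_conj1[OF g Z21])
    show "g \<circ> Z2 = Z2 \<circ> g" using T_conj[OF EE_uni[OF g], of "bas i" 0 "- b2"]
      unfolding Z2_def gi uniD(8)[OF EE_uni[OF g]] .
    show "g \<circ> Z1 = Y \<circ> g" using T_conj[OF EE_uni[OF g], of "bas (- j)" 0 b1]
      unfolding Z1_def Y_def gi uniD(8)[OF EE_uni[OF g]] .
  qed
  then have "rel Y (Z1 \<circ> id)" using Z21 by (auto intro: rel_trans rel_sym)
  moreover have "Y = Z1 \<circ> (T (bas m) 0 (1 * bar 1 * b1) \<circ> T (bas (- j)) (scl (b1 * 1) (bas m)) 0)"
    unfolding Y_def Z1_def using j m b by (intro long_split) auto
  ultimately have "rel (T (bas m) 0 b1 \<circ> T (bas (- j)) (scl b1 (bas m)) 0) id"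
    using rel_cancel_left[OF _ rel_refl[OF Z(2)]] by simp
  then have "T (bas m) 0 b1 \<circ> T (bas (- j)) (scl b1 (bas m)) 0 \<in> N" by (simp add: rel_id_iff)
  moreover have "T (bas (- j)) (scl b1 (bas m)) 0 \<in> N" using b j m by (intro level_I_D) auto
  ultimately have "T (bas m) 0 b1 \<in> N" by (blast intro: N_cancel_right)
  then show ?thesis using m b level_G_I by (auto simp: b1_def)
qed

lemma N_good:
  assumes \<sigma>: "\<sigma> \<in> N" shows "lv.good \<sigma>"
proof -
  note u = N_uni[OF \<sigma>]
  obtain c where c: "lv.scalar \<sigma> c" using N_scalar[OF \<sigma>] by blast
  obtain \<sigma>' where \<sigma>': "\<sigma>' \<in> N" "\<sigma> \<circ> \<sigma>' = id" using N_inv[OF \<sigma>] by blast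
  have "\<sigma> (bas i) i * b * bar (\<sigma> (bas i) i) - b \<in> level_G" if i: "i \<in> Om n" and b: "b \<in> \<Lambda>" for i b
  proof (rule lv.norm_one_mod_Gam[OF u c i N_ff[OF \<sigma> i] _ level_G_I[OF i] b])
    fix b assume b: "b \<in> \<Lambda>"
    let ?A = "T (\<sigma> (bas i)) 0 b" and ?B = "T (bas i) 0 b"
    have B: "?B \<in> EE" using i b by (rule EE_long1)
    have A: "?A \<in> EE" using rel_EE(1)[OF lv.rel_column_long[OF u c i N_ff[OF \<sigma> i] b]] .
    have "\<sigma> \<circ> ?B = ?A \<circ> \<sigma>" using T_conj[OF u, of "bas i" 0 b] unfolding uniD(8)[OF u] .
    moreover obtain \<mu> where \<mu>: "\<mu> \<in> N" "?B \<circ> \<sigma>' = \<mu> \<circ> ?B" using N_norm[OF B \<sigma>'(1)] by blast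
    ultimately have "?A = (\<sigma> \<circ> \<mu>) \<circ> ?B" using \<sigma>'(2) by (metis comp_assoc comp_id)
    then show "rel ?A ?B" unfolding rel_def using A B N_comp[OF \<sigma> \<mu>(1)] by blast
  qed
  then show ?thesis using u c N_ff[OF \<sigma>] by (auto simp: lv.good_def)
qed

end

section \<open>Matrices\<close>

definition idx :: "nat \<Rightarrow> nat \<Rightarrow> int" where
  "idx n p = (if p < n then int p + 1 else int p - 2 * int n)"

lemma pos_less: "i \<in> Om n \<Longrightarrow> pos n i < 2 * n"
  by (auto simp: pos_def Om_def)

lemma idx_pos: "i \<in> Om n \<Longrightarrow> idx n (pos n i) = i"
  by (auto simp: idx_def pos_def Om_def)

lemma pos_idx: "p < 2 * n \<Longrightarrow> pos n (idx n p) = p"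
  by (auto simp: idx_def pos_def)

lemma idx_Om: "p < 2 * n \<Longrightarrow> idx n p \<in> Om n"
  by (auto simp: idx_def Om_def)

lemma pos_eq_iff: "i \<in> Om n \<Longrightarrow> p < 2 * n \<Longrightarrow> p = pos n i \<longleftrightarrow> idx n p = i"
  using pos_idx idx_pos by metis

definition tv :: "nat \<Rightarrow> (int \<Rightarrow> 'a) \<Rightarrow> 'a vec" where
  "tv n w = vec (2 * n) (\<lambda>p. w (idx n p))"

lemma tv_carrier [simp]: "tv n w \<in> carrier_vec (2 * n)"
  by (simp add: tv_def)

lemma dim_tv [simp]: "dim_vec (tv n w) = 2 * n"
  by (simp add: tv_def)

lemma tv_index: "p < 2 * n \<Longrightarrow> tv n w $ p = w (idx n p)"
  by (simp add: tv_def)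

lemma mult_tv_index:
  "A \<in> carrier_mat (2 * n) (2 * n) \<Longrightarrow> p < 2 * n \<Longrightarrow>
    (A *\<^sub>v tv n w) $ p = (\<Sum>q<2 * n. A $$ (p, q) * w (idx n q))"
  by (auto simp: scalar_prod_def tv_index atLeast0LessThan intro!: sum.cong)

lemma mat_unit_carrier [simp]: "mat_unit n i j \<in> carrier_mat (2 * n) (2 * n)"
  by (simp add: mat_unit_def)

lemma dim_mat_unit [simp]: "dim_row (mat_unit n i j) = 2 * n" "dim_col (mat_unit n i j) = 2 * n"
  by (simp_all add: mat_unit_def)

lemma elem_short_I:
  "i \<in> Om n \<Longrightarrow> j \<in> Om n \<Longrightarrow> i \<noteq> j \<Longrightarrow> i \<noteq> - j \<Longrightarrow> x \<in> I \<Longrightarrow>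
    T_short n bar lam i j x \<in> elem_transvections n bar lam I \<Gamma>"
  unfolding elem_transvections_def by blast

lemma elem_long_I:
  "i \<in> Om n \<Longrightarrow> y \<in> \<Gamma> \<Longrightarrow>
    T_long n i (lam_pow bar lam (- ((eps i + 1) div 2)) * y) \<in> elem_transvections n bar lam I \<Gamma>"
  unfolding elem_transvections_def by blast

text \<open>Coordinates outside \<open>Om n\<close> are left alone, so that the identity matrix acts as the identity map.\<close>

definition act :: "nat \<Rightarrow> 'a::comm_ring_1 mat \<Rightarrow> (int \<Rightarrow> 'a) \<Rightarrow> int \<Rightarrow> 'a" where
  "act n \<sigma> w = (\<lambda>k. if k \<in> Om n then (\<sigma> *\<^sub>v tv n w) $ pos n k else w k)"

lemma tv_act: "\<sigma> \<in> carrier_mat (2 * n) (2 * n) \<Longrightarrow> tv n (act n \<sigma> w) = \<sigma> *\<^sub>v tv n w"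
  by (intro eq_vecI) (auto simp: tv_index act_def idx_Om pos_idx)

lemma act_one: "act n (1\<^sub>m (2 * n)) = id"
  by (auto simp: fun_eq_iff act_def tv_index pos_less idx_pos)

lemma act_mult:
  assumes "\<sigma> \<in> carrier_mat (2 * n) (2 * n)" "\<tau> \<in> carrier_mat (2 * n) (2 * n)"
  shows "act n (\<sigma> * \<tau>) = act n \<sigma> \<circ> act n \<tau>"
proof -
  have "act n (\<sigma> * \<tau>) w k = act n \<sigma> (act n \<tau> w) k" for w k
    using assms by (simp add: act_def[of n "\<sigma> * \<tau>"] act_def[of n \<sigma>] tv_act assoc_mult_mat_vec)
      (simp add: act_def)
  then show ?thesis by (auto simp: fun_eq_iff)
qed

lemma act_bas:
  fixes \<sigma> :: "'a::comm_ring_1 mat"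
  assumes "\<sigma> \<in> carrier_mat (2 * n) (2 * n)" "p < 2 * n" "q < 2 * n"
  shows "act n \<sigma> (bas (idx n q)) (idx n p) = \<sigma> $$ (p, q)"
proof -
  have "tv n (bas (idx n q) :: int \<Rightarrow> 'a) = unit_vec (2 * n) q"
    using assms by (intro eq_vecI) (auto simp: tv_def bas_def unit_vec_def, metis pos_idx)
  then show ?thesis using assms by (simp add: act_def idx_Om pos_idx)
qed

lemma act_inj:
  assumes "\<sigma> \<in> carrier_mat (2 * n) (2 * n)" "\<tau> \<in> carrier_mat (2 * n) (2 * n)" "act n \<sigma> = act n \<tau>"
  shows "\<sigma> = \<tau>"
  using assms(1,2) act_bas[OF assms(1)] act_bas[OF assms(2)] assms(3) by (intro eq_matI) auto

section \<open>The matrix group and its elementary subgroup acting on coordinate functions\<close>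

context hyperbolic
begin

abbreviation UG :: "'a mat monoid" where "UG \<equiv> unitary_group n bar lam \<Lambda>"

lemma block_mult:
  assumes p: "p < 2 * n"
  shows "(four_block_mat (0\<^sub>m n n) (skew_one n) (c \<cdot>\<^sub>m skew_one n) (0\<^sub>m n n) *\<^sub>v tv n w) $ p
    = (if p < n then w (- idx n p) else c * w (- idx n p))"
proof -
  define M where "M = four_block_mat (0\<^sub>m n n) (skew_one n) (c \<cdot>\<^sub>m skew_one n) (0\<^sub>m n n)"
  \<comment> \<open>With positions counted from 0, this reversal of positions is negation of
    indices.\<close>
  define q where "q = 2 * n - 1 - p"
  have q: "q < 2 * n" "idx n q = - idx n p" using p by (auto simp: q_def idx_def)
  have S: "skew_one n \<in> carrier_mat n n" by (simp add: skew_one_def)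
  have M: "M \<in> carrier_mat (2 * n) (2 * n)" unfolding M_def mult_2 using S by (intro four_block_carrier_mat) auto
  have entry: "M $$ (p, j) = (if j = q then if p < n then 1 else c else 0)" if "j < 2 * n" for j
    using p that S by (auto simp: M_def skew_one_def q_def)
  have "(M *\<^sub>v tv n w) $ p = (\<Sum>j<2 * n. M $$ (p, j) * w (idx n j))"
    using M p by (rule mult_tv_index)
  also have "\<dots> = (\<Sum>j<2 * n. if j = q then (if p < n then 1 else c) * w (idx n j) else 0)"
    by (intro sum.cong) (auto simp: entry)
  also have "\<dots> = (if p < n then 1 else c) * w (- idx n p)" using q by simp
  finally show ?thesis by (simp add: M_def)
qed

lemma sum_idx: "(\<Sum>p<2 * n. g (idx n p)) = (\<Sum>k = 1..int n. g k + g (- k))"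
proof -
  have "(\<Sum>p<2 * n. g (idx n p)) = (\<Sum>k\<in>Om n. g k)"
    by (rule sum.reindex_bij_witness[of _ "pos n" "idx n"]) (auto simp: pos_idx idx_pos pos_less idx_Om)
  also have "\<dots> = (\<Sum>k = 1..int n. g k) + (\<Sum>k = - int n..-1. g k)"
    unfolding Om_def by (rule sum.union_disjoint) auto
  also have "(\<Sum>k = - int n..-1. g k) = (\<Sum>k = 1..int n. g (- k))"
    by (rule sum.reindex_bij_witness[of _ uminus uminus]) auto
  finally show ?thesis by (simp add: sum.distrib)
qed

text \<open>The scalar c = lam gives h, and c = 0 gives f.\<close>

lemma form_block:
  "map_vec bar (tv n v) \<bullet> (four_block_mat (0\<^sub>m n n) (skew_one n) (c \<cdot>\<^sub>m skew_one n) (0\<^sub>m n n) *\<^sub>v tv n w)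
    = ff v w + c * bar (ff w v)"
proof -
  have "dim_row (skew_one n) = n" by (simp add: skew_one_def)
  then have "map_vec bar (tv n v) \<bullet> (four_block_mat (0\<^sub>m n n) (skew_one n) (c \<cdot>\<^sub>m skew_one n) (0\<^sub>m n n) *\<^sub>v tv n w)
      = (\<Sum>p<2 * n. bar (v (idx n p)) * (if p < n then w (- idx n p) else c * w (- idx n p)))"
    unfolding scalar_prod_def
    by (intro sum.cong) (auto simp: tv_index block_mult simp del: index_mult_mat_vec)
  also have "\<dots> = (\<Sum>p<2 * n. (\<lambda>k. bar (v k) * (if k > 0 then w (- k) else c * w (- k))) (idx n p))"
    by (intro sum.cong) (auto simp: idx_def)
  also have "\<dots> = (\<Sum>k = 1..int n. bar (v k) * w (- k) + c * (bar (v (- k)) * w k))"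
    by (subst sum_idx) (auto intro!: sum.cong)
  also have "\<dots> = ff v w + c * bar (ff w v)"
    by (simp add: ff_def sum.distrib sum_distrib_left bar_sum mult.commute)
  finally show ?thesis .
qed

lemma form_h_tv: "form_h n bar lam (tv n v) (tv n w) = hh v w"
  unfolding form_h_def form_block hh_def ..

lemma form_f_tv: "form_f n bar (tv n v) (tv n w) = ff v w"
proof -
  have "(0 :: 'a) \<cdot>\<^sub>m skew_one n = 0\<^sub>m n n" by (auto simp: skew_one_def)
  then show ?thesis using form_block[of v 0 w] by (simp add: form_f_def)
qed

lemma tv_surj:
  assumes "v \<in> carrier_vec (2 * n)" obtains w where "w \<in> VV" "v = tv n w"
proof
  let ?w = "\<lambda>k. if k \<in> Om n then v $ pos n k else 0"
  show "?w \<in> VV" by (simp add: VV_def)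
  show "v = tv n ?w" using assms by (intro eq_vecI) (auto simp: tv_index idx_Om pos_idx tv_def)
qed

lemma form_q_eq_iff:
  "form_q n bar \<Lambda> (tv n v) = form_q n bar \<Lambda> (tv n w) \<longleftrightarrow> ff v v - ff w w \<in> \<Lambda>"
proof
  assume "form_q n bar \<Lambda> (tv n v) = form_q n bar \<Lambda> (tv n w)"
  moreover have "ff v v \<in> form_q n bar \<Lambda> (tv n v)"
    unfolding form_q_def form_f_tv using Lam_0 by (auto intro: exI[of _ 0])
  ultimately show "ff v v - ff w w \<in> \<Lambda>" by (auto simp: form_q_def form_f_tv)
next
  assume d: "ff v v - ff w w \<in> \<Lambda>"
  have "\<exists>a'. x + a = y + a' \<and> a' \<in> \<Lambda>" if "x - y \<in> \<Lambda>" "a \<in> \<Lambda>" for x y a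
    using that Lam_add by (intro exI[of _ "x - y + a"]) auto
  from this[OF d] this[OF Lam_minus[OF d, unfolded minus_diff_eq]]
  show "form_q n bar \<Lambda> (tv n v) = form_q n bar \<Lambda> (tv n w)"
    unfolding form_q_def form_f_tv by blast
qed

lemma act_lin:
  assumes "\<sigma> \<in> carrier_mat (2 * n) (2 * n)"
  shows "act n \<sigma> (v + w) = act n \<sigma> v + act n \<sigma> w" "act n \<sigma> (scl s v) = scl s (act n \<sigma> v)"
    "v \<in> VV \<Longrightarrow> act n \<sigma> v \<in> VV"
proof -
  have "tv n (v + w) = tv n v + tv n w" "tv n (scl s v) = s \<cdot>\<^sub>v tv n v"
    by (auto simp: tv_def)
  moreover have "\<sigma> *\<^sub>v (s \<cdot>\<^sub>v tv n v) = s \<cdot>\<^sub>v (\<sigma> *\<^sub>v tv n v)"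
    using assms by (intro eq_vecI) (auto simp: scalar_prod_def sum_distrib_left mult_ac)
  ultimately show "act n \<sigma> (v + w) = act n \<sigma> v + act n \<sigma> w" "act n \<sigma> (scl s v) = scl s (act n \<sigma> v)"
    using assms by (auto simp: fun_eq_iff act_def mult_add_distrib_mat_vec[OF assms tv_carrier tv_carrier] pos_less)
  show "v \<in> VV \<Longrightarrow> act n \<sigma> v \<in> VV" by (simp add: VV_def act_def)
qed

lemma GL_carrier: "carrier (GL (2 * n)) = {\<sigma> \<in> carrier_mat (2 * n) (2 * n). \<exists>\<tau> \<in> carrier_mat (2 * n) (2 * n).
    \<tau> * \<sigma> = 1\<^sub>m (2 * n) \<and> \<sigma> * \<tau> = (1\<^sub>m (2 * n) :: 'a mat)}"
  by (auto simp: GL_def units_of_def Units_def ring_mat_simps)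

lemma UG_carrier: "\<sigma> \<in> carrier UG \<longleftrightarrow> \<sigma> \<in> carrier (GL (2 * n)) \<and> uni (act n \<sigma>)"
proof
  assume \<sigma>: "\<sigma> \<in> carrier UG"
  then have GL: "\<sigma> \<in> carrier (GL (2 * n))" by (simp add: unitary_group_def)
  then have c: "\<sigma> \<in> carrier_mat (2 * n) (2 * n)" by (simp add: GL_carrier)
  have "hh (act n \<sigma> v) (act n \<sigma> w) = hh v w" for v w
    using \<sigma> c unfolding form_h_tv[symmetric] tv_act[OF c] by (simp add: unitary_group_def)
  moreover have "ff (act n \<sigma> v) (act n \<sigma> v) - ff v v \<in> \<Lambda>" for v
    using \<sigma> c unfolding form_q_eq_iff[symmetric] tv_act[OF c] by (simp add: unitary_group_def)
  ultimately show "\<sigma> \<in> carrier (GL (2 * n)) \<and> uni (act n \<sigma>)"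
    using GL act_lin[OF c] by (simp add: uni_def)
next
  assume *: "\<sigma> \<in> carrier (GL (2 * n)) \<and> uni (act n \<sigma>)"
  then have c: "\<sigma> \<in> carrier_mat (2 * n) (2 * n)" by (simp add: GL_carrier)
  have "form_h n bar lam (\<sigma> *\<^sub>v u) (\<sigma> *\<^sub>v v) = form_h n bar lam u v"
    if "u \<in> carrier_vec (2 * n)" "v \<in> carrier_vec (2 * n)" for u v
    using * tv_surj[OF that(1)] tv_surj[OF that(2)] by (metis form_h_tv tv_act[OF c] uniD(3))
  moreover have "form_q n bar \<Lambda> (\<sigma> *\<^sub>v v) = form_q n bar \<Lambda> v" if "v \<in> carrier_vec (2 * n)" for v
    using * tv_surj[OF that] by (metis form_q_eq_iff tv_act[OF c] uniD(4))
  ultimately show "\<sigma> \<in> carrier UG" using * by (simp add: unitary_group_def)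
qed

lemma UG_carrier_mat: "\<sigma> \<in> carrier UG \<Longrightarrow> \<sigma> \<in> carrier_mat (2 * n) (2 * n)"
  by (simp add: UG_carrier GL_carrier)

lemma UG_ops: "\<sigma> \<otimes>\<^bsub>UG\<^esub> \<tau> = \<sigma> * \<tau>" "\<one>\<^bsub>UG\<^esub> = 1\<^sub>m (2 * n)"
  by (simp_all add: unitary_group_def GL_def units_of_def ring_mat_simps)

lemma UG_group: "group UG"
proof (rule groupI)
  fix x y assume xy: "x \<in> carrier UG" "y \<in> carrier UG"
  then have c: "x \<in> carrier_mat (2 * n) (2 * n)" "y \<in> carrier_mat (2 * n) (2 * n)" by (auto intro: UG_carrier_mat)
  have "group (GL (2 * n) :: 'a mat monoid)"
    unfolding GL_def using ring_mat[where ?'a = 'a, of "2 * n" "()"] by (intro monoid.units_group) (simp add: ring_def)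
  then have "x \<otimes>\<^bsub>GL (2 * n)\<^esub> y \<in> carrier (GL (2 * n))"
    using xy by (intro monoid.m_closed) (auto simp: UG_carrier group.is_monoid)
  then have "x * y \<in> carrier (GL (2 * n))" by (simp add: GL_def units_of_def ring_mat_simps)
  then show "x \<otimes>\<^bsub>UG\<^esub> y \<in> carrier UG"
    using xy by (simp add: UG_carrier UG_ops act_mult[OF c] uni_comp)
next
  show "\<one>\<^bsub>UG\<^esub> \<in> carrier UG"
    by (auto simp: UG_carrier UG_ops GL_carrier act_one uni_id intro!: bexI[of _ "1\<^sub>m (2 * n)"])
next
  fix x y z assume "x \<in> carrier UG" "y \<in> carrier UG" "z \<in> carrier UG"
  then show "x \<otimes>\<^bsub>UG\<^esub> y \<otimes>\<^bsub>UG\<^esub> z = x \<otimes>\<^bsub>UG\<^esub> (y \<otimes>\<^bsub>UG\<^esub> z)"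
    unfolding UG_ops by (intro assoc_mult_mat[OF UG_carrier_mat UG_carrier_mat UG_carrier_mat])
next
  fix x assume x: "x \<in> carrier UG"
  then show "\<one>\<^bsub>UG\<^esub> \<otimes>\<^bsub>UG\<^esub> x = x" using UG_carrier_mat[OF x] by (simp add: UG_ops)
  obtain y where y: "y \<in> carrier_mat (2 * n) (2 * n)" "y * x = 1\<^sub>m (2 * n)" "x * y = 1\<^sub>m (2 * n)"
    using x by (auto simp: UG_carrier GL_carrier)
  have u: "uni (act n x)" using x by (simp add: UG_carrier)
  have xy: "act n x (act n y v) = v" for v
    using act_mult[OF UG_carrier_mat[OF x] y(1)] y(3) by (simp add: act_one) (metis comp_apply id_apply)
  have "uni (act n y)"
    unfolding uni_def
    using act_lin[OF y(1)] uniD(3)[OF u, of "act n y v" "act n y w" for v w]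
      Lam_minus[OF uniD(4)[OF u, of "act n y v" for v]] by (auto simp: xy)
  then have "y \<in> carrier UG" using x y by (auto simp: UG_carrier GL_carrier)
  then show "\<exists>y\<in>carrier UG. y \<otimes>\<^bsub>UG\<^esub> x = \<one>\<^bsub>UG\<^esub>" using y by (auto simp: UG_ops)
qed

lemma act_UG_mult: "\<sigma> \<in> carrier UG \<Longrightarrow> \<tau> \<in> carrier UG \<Longrightarrow> act n (\<sigma> \<otimes>\<^bsub>UG\<^esub> \<tau>) = act n \<sigma> \<circ> act n \<tau>"
  by (simp add: UG_ops act_mult UG_carrier_mat)

lemma act_UG_inv:
  assumes "\<sigma> \<in> carrier UG"
  shows "act n (inv\<^bsub>UG\<^esub> \<sigma>) \<circ> act n \<sigma> = id" "act n \<sigma> \<circ> act n (inv\<^bsub>UG\<^esub> \<sigma>) = id"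
proof -
  interpret group UG by (rule UG_group)
  show "act n (inv\<^bsub>UG\<^esub> \<sigma>) \<circ> act n \<sigma> = id" "act n \<sigma> \<circ> act n (inv\<^bsub>UG\<^esub> \<sigma>) = id"
    using assms act_UG_mult[of "inv\<^bsub>UG\<^esub> \<sigma>" \<sigma>] act_UG_mult[of \<sigma> "inv\<^bsub>UG\<^esub> \<sigma>"]
    by (simp_all add: act_one UG_ops(2))
qed

lemma act_UG_inj: "\<sigma> \<in> carrier UG \<Longrightarrow> \<tau> \<in> carrier UG \<Longrightarrow> act n \<sigma> = act n \<tau> \<Longrightarrow> \<sigma> = \<tau>"
  by (rule act_inj[OF UG_carrier_mat UG_carrier_mat])

lemma mat_unit_mult:
  assumes "i \<in> Om n" "j \<in> Om n" "p < 2 * n"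
  shows "((x \<cdot>\<^sub>m mat_unit n i j) *\<^sub>v tv n w) $ p = (if p = pos n i then x * w j else 0)"
proof -
  have "((x \<cdot>\<^sub>m mat_unit n i j) *\<^sub>v tv n w) $ p = (\<Sum>q<2 * n. (x \<cdot>\<^sub>m mat_unit n i j) $$ (p, q) * w (idx n q))"
    using assms by (intro mult_tv_index) auto
  also have "\<dots> = (\<Sum>q<2 * n. if q = pos n j then (if p = pos n i then x * w (idx n q) else 0) else 0)"
    using assms by (intro sum.cong) (auto simp: mat_unit_def)
  finally show ?thesis using assms by (simp add: pos_less idx_pos)
qed

lemma act_T_short:
  assumes ij: "i \<in> Om n" "j \<in> Om n"
  shows "act n (T_short n bar lam i j x) = T (bas i) (scl (th (- j) * bar x) (bas (- j))) 0"
proof -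
  \<comment> \<open>The exponent is -1, 0 or 1; \<open>th\<close> encodes the signs of the indices,
    so one product covers all four cases.\<close>
  have pow: "lam_pow bar lam ((eps j - eps i) div 2) = bar lam * th (- j) * th i"
    using Om_nonzero[OF ij(1)] Om_nonzero[OF ij(2)] by (auto simp: lam_pow_def eps_def th_def)
  have "act n (T_short n bar lam i j x) w k = T (bas i) (scl (th (- j) * bar x) (bas (- j))) 0 w k" for w k
  proof (cases "k \<in> Om n")
    case True
    let ?A = "x \<cdot>\<^sub>m mat_unit n i j" and ?B = "(lam_pow bar lam ((eps j - eps i) div 2) * bar x) \<cdot>\<^sub>m mat_unit n (- j) (- i)"
    have d: "?A \<in> carrier_mat (2 * n) (2 * n)" "?B \<in> carrier_mat (2 * n) (2 * n)" by simp_all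
    have "T_short n bar lam i j x *\<^sub>v tv n w = tv n w + ?A *\<^sub>v tv n w - ?B *\<^sub>v tv n w"
      unfolding T_short_def
      by (simp add: minus_mult_distrib_mat_vec[OF _ d(2) tv_carrier] add_mult_distrib_mat_vec[OF one_carrier_mat d(1) tv_carrier])
    then have "act n (T_short n bar lam i j x) w k
        = w k + (if k = i then x * w j else 0) - (if k = - j then lam_pow bar lam ((eps j - eps i) div 2) * bar x * w (- i) else 0)"
      using True ij d by (simp add: act_def pos_less tv_index idx_pos mat_unit_mult pos_eq_iff
        del: index_mult_mat_vec)
    then show ?thesis unfolding pow
      using ij hh_bas_left[of "- j" w] by (simp add: T_def hh_bas_left bas_apply mult.assoc th_cancel)
  next
    case False
    then show ?thesis using ij by (auto simp: act_def T_def bas_apply)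
  qed
  then show ?thesis by (simp add: fun_eq_iff)
qed

text \<open>The scalar of \<open>T\<close> enters with a minus sign, hence \<open>- y\<close>; the
  form parameters are closed under negation.\<close>

lemma act_T_long:
  assumes i: "i \<in> Om n"
  shows "act n (T_long n i (lam_pow bar lam (- ((eps i + 1) div 2)) * y)) = T (bas i) 0 (- y)"
proof -
  have pow: "lam_pow bar lam (- ((eps i + 1) div 2)) = bar lam * th i"
    using Om_nonzero[OF i] by (auto simp: lam_pow_def eps_def th_def)
  have "act n (T_long n i (bar lam * th i * y)) w k = T (bas i) 0 (- y) w k" for w k
  proof (cases "k \<in> Om n")
    case True
    let ?A = "(bar lam * th i * y) \<cdot>\<^sub>m mat_unit n i (- i)"
    have d: "?A \<in> carrier_mat (2 * n) (2 * n)" by simp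
    have "T_long n i (bar lam * th i * y) *\<^sub>v tv n w = tv n w + ?A *\<^sub>v tv n w"
      unfolding T_long_def by (simp add: add_mult_distrib_mat_vec[OF one_carrier_mat d tv_carrier])
    then have "act n (T_long n i (bar lam * th i * y)) w k = w k + (if k = i then bar lam * th i * y * w (- i) else 0)"
      using True i d by (simp add: act_def pos_less tv_index idx_pos mat_unit_mult pos_eq_iff
        del: index_mult_mat_vec)
    then show ?thesis using i by (simp add: T_def hh_bas_left bas_apply mult_ac)
  next
    case False
    then show ?thesis using i by (auto simp: act_def T_def bas_apply)
  qed
  then show ?thesis unfolding pow by (simp add: fun_eq_iff)
qed

lemma T_short_carrier [simp]: "T_short n bar lam i j x \<in> carrier_mat (2 * n) (2 * n)"
  unfolding T_short_def by (rule minus_carrier_mat) simp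

lemma T_long_carrier [simp]: "T_long n i y \<in> carrier_mat (2 * n) (2 * n)"
  unfolding T_long_def by (rule add_carrier_mat) simp

lemma UG_I:
  assumes "\<sigma> \<in> carrier_mat (2 * n) (2 * n)" "\<tau> \<in> carrier_mat (2 * n) (2 * n)"
    and "act n \<sigma> \<circ> act n \<tau> = id" "act n \<tau> \<circ> act n \<sigma> = id" "uni (act n \<sigma>)"
  shows "\<sigma> \<in> carrier UG"
proof -
  have "\<sigma> * \<tau> = 1\<^sub>m (2 * n)" "\<tau> * \<sigma> = 1\<^sub>m (2 * n)"
    using assms by (auto intro!: act_inj[of _ n] simp: act_mult act_one)
  then show ?thesis using assms by (auto simp: UG_carrier GL_carrier)
qed

lemma T_short_UG:
  assumes "i \<in> Om n" "j \<in> Om n" "i \<noteq> j" "i \<noteq> - j"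
  shows "T_short n bar lam i j x \<in> carrier UG" "act n (T_short n bar lam i j x) \<in> EE"
proof -
  show E: "act n (T_short n bar lam i j x) \<in> EE"
    unfolding act_T_short[OF assms(1,2)] using assms by (intro EE_short1) auto
  show "T_short n bar lam i j x \<in> carrier UG"
    by (rule UG_I[of _ "T_short n bar lam i j (- x)"])
      (use E EE_uni assms in \<open>auto simp: act_T_short T_comp hh_bas_bas simp flip: scl_add\<close>)
qed

lemma T_long_UG:
  assumes "i \<in> Om n" "y \<in> \<Lambda>"
  defines "t \<equiv> \<lambda>y. T_long n i (lam_pow bar lam (- ((eps i + 1) div 2)) * y)"
  shows "t y \<in> carrier UG" "act n (t y) \<in> EE"
proof -
  show E: "act n (t y) \<in> EE"
    unfolding t_def act_T_long[OF assms(1)] using assms by (intro EE_long1 Lam_minus)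
  have "act n (t y) \<circ> act n (t (- y)) = id" "act n (t (- y)) \<circ> act n (t y) = id"
    unfolding t_def act_T_long[OF assms(1)] by (simp_all add: T_comp)
  then show "t y \<in> carrier UG"
    using E EE_uni by (intro UG_I[of _ "t (- y)"]) (auto simp: t_def)
qed

lemma elem_transvections_UG:
  assumes "t \<in> elem_transvections n bar lam I \<Gamma>" "\<Gamma> \<subseteq> \<Lambda>"
  shows "t \<in> carrier UG" "act n t \<in> EE"
  using assms T_short_UG T_long_UG unfolding elem_transvections_def by auto

lemma EU_subgroup: "subgroup (EU n bar lam \<Lambda>) UG"
  unfolding EU_def using elem_transvections_UG by (intro group.generate_is_subgroup[OF UG_group]) auto

lemma EU_carrier: "\<epsilon> \<in> EU n bar lam \<Lambda> \<Longrightarrow> \<epsilon> \<in> carrier UG"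
  using subgroup.subset[OF EU_subgroup] by blast

lemma EE_inv_eq:
  assumes "g \<in> EE" "g' \<circ> g = id" shows "g' \<in> EE"
proof -
  obtain d where "d \<in> EE" "g \<circ> d = id" using EE_inv[OF assms(1)] by blast
  then have "g' = d" using assms(2) by (metis comp_assoc comp_id id_comp)
  then show ?thesis using \<open>d \<in> EE\<close> by simp
qed

lemma act_EU: "\<epsilon> \<in> EU n bar lam \<Lambda> \<Longrightarrow> act n \<epsilon> \<in> EE"
  unfolding EU_def
proof (induction rule: generate.induct)
  case one
  show ?case unfolding UG_ops act_one by (rule EE_id)
next
  case (incl h)
  then show ?case by (rule elem_transvections_UG) simp
next
  case (inv h)
  then show ?case
    using elem_transvections_UG[OF inv] act_UG_inv(1)[of h] by (auto intro: EE_inv_eq)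
next
  case (eng h1 h2)
  then have c: "h1 \<in> carrier UG" "h2 \<in> carrier UG" using EU_carrier by (auto simp: EU_def)
  show ?case unfolding act_UG_mult[OF c] using eng by (intro EE_comp)
qed

lemma EE_act: "g \<in> EE \<Longrightarrow> \<exists>\<epsilon>\<in>EU n bar lam \<Lambda>. g = act n \<epsilon>"
proof (induction rule: EE.induct)
  case EE_id
  have "\<one>\<^bsub>UG\<^esub> \<in> EU n bar lam \<Lambda>" using EU_subgroup by (rule subgroup.one_closed)
  then show ?case by (intro bexI[of _ "\<one>\<^bsub>UG\<^esub>"]) (simp_all add: act_one UG_ops)
next
  case (EE_short g i k s)
  then obtain \<epsilon> where \<epsilon>: "\<epsilon> \<in> EU n bar lam \<Lambda>" "g = act n \<epsilon>" by blast
  let ?t = "T_short n bar lam i (- k) (bar (bar (th k) * s))"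
  have "?t \<in> EU n bar lam \<Lambda>"
    unfolding EU_def using EE_short by (intro generate.incl elem_short_I) auto
  moreover from this have "act n (?t \<otimes>\<^bsub>UG\<^esub> \<epsilon>) = T (bas i) (scl s (bas k)) 0 \<circ> g"
    using EE_short \<epsilon> EU_carrier by (simp add: act_UG_mult act_T_short)
  ultimately show ?case using \<epsilon>(1) subgroup.m_closed[OF EU_subgroup] by metis
next
  case (EE_long g i b)
  then obtain \<epsilon> where \<epsilon>: "\<epsilon> \<in> EU n bar lam \<Lambda>" "g = act n \<epsilon>" by blast
  let ?t = "T_long n i (lam_pow bar lam (- ((eps i + 1) div 2)) * (- b))"
  have "?t \<in> EU n bar lam \<Lambda>"
    unfolding EU_def using EE_long Lam_minus by (intro generate.incl elem_long_I) auto
  moreover from this have "act n (?t \<otimes>\<^bsub>UG\<^esub> \<epsilon>) = T (bas i) 0 b \<circ> g"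
    using EE_long \<epsilon> EU_carrier act_T_long[OF EE_long(2), of "- b"] by (simp add: act_UG_mult)
  ultimately show ?case using \<epsilon>(1) subgroup.m_closed[OF EU_subgroup] by metis
qed

text \<open>The normalizer asks for conjugates equal to H. Inclusion for all elements of K is enough
  because K contains inverses.\<close>

lemma normalizer_iff:
  assumes H: "subgroup H UG" and K: "subgroup K UG"
  shows "K \<subseteq> normalizer UG H \<longleftrightarrow> (\<forall>k\<in>K. \<forall>h\<in>H. k \<otimes>\<^bsub>UG\<^esub> h \<otimes>\<^bsub>UG\<^esub> inv\<^bsub>UG\<^esub> k \<in> H)"
proof -
  interpret group UG by (rule UG_group)
  note Hc = subgroup.subset[OF H] and Kc = subgroup.subset[OF K]
  have N: "k \<in> normalizer UG H \<longleftrightarrow> k \<in> carrier UG \<and> {k \<otimes>\<^bsub>UG\<^esub> h \<otimes>\<^bsub>UG\<^esub> inv\<^bsub>UG\<^esub> k | h. h \<in> H} = H" for k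
    using Hc by (auto simp: normalizer_def stabilizer_def l_coset_def r_coset_def)
  show ?thesis
  proof (intro iffI ballI subsetI)
    fix k h assume "K \<subseteq> normalizer UG H" "k \<in> K" "h \<in> H"
    then show "k \<otimes>\<^bsub>UG\<^esub> h \<otimes>\<^bsub>UG\<^esub> inv\<^bsub>UG\<^esub> k \<in> H" using N[of k] by blast
  next
    fix k assume *: "\<forall>k\<in>K. \<forall>h\<in>H. k \<otimes>\<^bsub>UG\<^esub> h \<otimes>\<^bsub>UG\<^esub> inv\<^bsub>UG\<^esub> k \<in> H" and k: "k \<in> K"
    have kc: "k \<in> carrier UG" using k Kc by blast
    have "h \<in> {k \<otimes>\<^bsub>UG\<^esub> h \<otimes>\<^bsub>UG\<^esub> inv\<^bsub>UG\<^esub> k | h. h \<in> H}" if h: "h \<in> H" for h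
    proof -
      have ik: "inv\<^bsub>UG\<^esub> k \<in> K" using K k by (rule subgroup.m_inv_closed)
      have hc: "h \<in> carrier UG" using h Hc by blast
      have "inv\<^bsub>UG\<^esub> k \<otimes>\<^bsub>UG\<^esub> h \<otimes>\<^bsub>UG\<^esub> k \<in> H" using *[rule_format, OF ik h] kc by simp
      moreover have "k \<otimes>\<^bsub>UG\<^esub> (inv\<^bsub>UG\<^esub> k \<otimes>\<^bsub>UG\<^esub> h \<otimes>\<^bsub>UG\<^esub> k) \<otimes>\<^bsub>UG\<^esub> inv\<^bsub>UG\<^esub> k = h"
        using kc hc by (simp add: m_assoc) (simp add: m_assoc[symmetric])
      ultimately show ?thesis by (intro CollectI exI[of _ "inv\<^bsub>UG\<^esub> k \<otimes>\<^bsub>UG\<^esub> h \<otimes>\<^bsub>UG\<^esub> k"]) simp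
    qed
    then show "k \<in> normalizer UG H" unfolding N using * k kc by auto
  qed
qed

end

section \<open>Relative elementary groups and congruence conditions for matrices\<close>

context level
begin

lemma elem_N:
  assumes "i \<in> Om n" "k \<in> Om n" "k \<noteq> i" "k \<noteq> - i" "s \<in> I"
  shows "\<exists>t\<in>elem_transvections n bar lam I \<Gamma>. act n t = T (bas i) (scl s (bas k)) 0"
proof -
  let ?x = "bar (bar (th k) * s)"
  have "T_short n bar lam i (- k) ?x \<in> elem_transvections n bar lam I \<Gamma>"
    using assms by (intro elem_short_I I_bar I_mult) auto
  then show ?thesis using assms by (intro bexI) (auto simp: act_T_short)
qed

lemma elem_N_long:
  assumes "i \<in> Om n" "b \<in> \<Gamma>"
  shows "\<exists>t\<in>elem_transvections n bar lam I \<Gamma>. act n t = T (bas i) 0 b"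
proof -
  have "T_long n i (lam_pow bar lam (- ((eps i + 1) div 2)) * - b) \<in> elem_transvections n bar lam I \<Gamma>"
    using assms Gam_minus by (intro elem_long_I) auto
  then show ?thesis using assms act_T_long[of i "- b"] by (intro bexI) auto
qed

lemma elem_transvections_act:
  assumes "t \<in> elem_transvections n bar lam I \<Gamma>"
  shows "(\<exists>i k s. i \<in> Om n \<and> k \<in> Om n \<and> k \<noteq> i \<and> k \<noteq> - i \<and> s \<in> I \<and> act n t = T (bas i) (scl s (bas k)) 0) \<or>
    (\<exists>i b. i \<in> Om n \<and> b \<in> \<Gamma> \<and> act n t = T (bas i) 0 b)"
  using assms unfolding elem_transvections_def
proof (elim UnE CollectE exE conjE)
  fix i j x assume "t = T_short n bar lam i j x" "i \<in> Om n" "j \<in> Om n" "i \<noteq> j" "i \<noteq> - j" "x \<in> I"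
  then show ?thesis
    by (intro disjI1 exI[of _ i] exI[of _ "- j"] exI[of _ "th (- j) * bar x"]) (auto simp: act_T_short intro: I_mult I_bar)
next
  fix i y assume "t = T_long n i y" "i \<in> Om n" "y \<in> (\<lambda>g. lam_pow bar lam (- ((eps i + 1) div 2)) * g) ` \<Gamma>"
  then obtain g where "g \<in> \<Gamma>" "t = T_long n i (lam_pow bar lam (- ((eps i + 1) div 2)) * g)" by blast
  then show ?thesis using \<open>i \<in> Om n\<close> Gam_minus act_T_long by blast
qed

lemma CU_iff:
  assumes \<sigma>: "\<sigma> \<in> carrier UG"
  shows "\<sigma> \<in> CU n bar lam \<Lambda> I \<Gamma> \<longleftrightarrow> cu (act n \<sigma>)"
proof -
  interpret group UG by (rule UG_group)
  have u: "uni (act n \<sigma>)" using \<sigma> by (simp add: UG_carrier)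
  have U: "\<rho> \<in> U_cong n bar lam \<Lambda> I \<Gamma> \<longleftrightarrow> (\<forall>v. veq (act n \<rho> v) v \<and> ff (act n \<rho> v) (act n \<rho> v) - ff v v \<in> \<Gamma>)"
    if \<rho>: "\<rho> \<in> carrier UG" for \<rho>
  proof -
    have c: "\<rho> \<in> carrier_mat (2 * n) (2 * n)" using \<rho> by (rule UG_carrier_mat)
    have u: "uni (act n \<rho>)" using \<rho> by (simp add: UG_carrier)
    have "(\<forall>k<2 * n. \<forall>l<2 * n. (\<rho> - 1\<^sub>m (2 * n)) $$ (k, l) \<in> I) \<longleftrightarrow> (\<forall>v. veq (act n \<rho> v) v)"
    proof
      assume *: "\<forall>k<2 * n. \<forall>l<2 * n. (\<rho> - 1\<^sub>m (2 * n)) $$ (k, l) \<in> I"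
      have b: "act n \<rho> (bas j) k - bas j k \<in> I" if j: "j \<in> Om n" for j k
      proof (cases "k \<in> Om n")
        case True
        then show ?thesis using *[rule_format, of "pos n k" "pos n j"] act_bas[OF c, of "pos n k" "pos n j"] j c
          by (simp add: pos_less idx_pos bas_apply pos_eq_iff split: if_splits)
      qed (simp add: act_def)
      show "\<forall>v. veq (act n \<rho> v) v"
        unfolding veq_def
      proof (intro allI)
        fix v' :: "int \<Rightarrow> 'a" and k
        \<comment> \<open>Coordinates outside \<open>Om n\<close> are left alone by
          \<open>act\<close> and cancel in the difference, so the expansion in basis vectors may be
          applied to the truncated vector.\<close>
        define v where "v = (\<lambda>k. if k \<in> Om n then v' k else 0)"
        have v: "v \<in> VV" by (simp add: v_def VV_def)
        have "tv n v' = tv n v" by (intro eq_vecI) (auto simp: tv_index idx_Om v_def)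
        then have "act n \<rho> v' k - v' k = act n \<rho> v k - v k" by (simp add: act_def v_def)
        also have "\<dots> = (\<Sum>j\<in>Om n. v j * (act n \<rho> (bas j) k - bas j k))"
          by (subst (1 2) VV_sum[OF v])
            (simp add: uni_sum[OF u] uniD(2)[OF u] sum_fun_apply right_diff_distrib sum_subtractf)
        finally show "act n \<rho> v' k - v' k \<in> I" using b by (auto intro: I_sum I_mult)
      qed
    next
      assume *: "\<forall>v. veq (act n \<rho> v) v"
      show "\<forall>k<2 * n. \<forall>l<2 * n. (\<rho> - 1\<^sub>m (2 * n)) $$ (k, l) \<in> I"
      proof (intro allI impI)
        fix k l assume kl: "k < 2 * n" "l < 2 * n"
        then have d: "act n \<rho> (bas (idx n l)) (idx n k) - bas (idx n l) (idx n k) \<in> I"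
          using * idx_Om[of l n] by (simp add: veq_def)
        show "(\<rho> - 1\<^sub>m (2 * n)) $$ (k, l) \<in> I"
        proof -
          have "idx n k = idx n l \<longleftrightarrow> k = l" using pos_idx[OF kl(1)] pos_idx[OF kl(2)] by metis
          then have "bas (idx n l) (idx n k) = (1\<^sub>m (2 * n) :: 'a mat) $$ (k, l)"
            using kl by (simp add: bas_apply)
          moreover have "(\<rho> - 1\<^sub>m (2 * n)) $$ (k, l) = \<rho> $$ (k, l) - 1\<^sub>m (2 * n) $$ (k, l)" using kl by simp
          ultimately show ?thesis using d unfolding act_bas[OF c kl] by (simp only:)
        qed
      qed
    qed
    moreover have "(\<forall>v\<in>carrier_vec (2 * n). form_f n bar (\<rho> *\<^sub>v v) (\<rho> *\<^sub>v v) - form_f n bar v v \<in> \<Gamma>)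
        \<longleftrightarrow> (\<forall>v. ff (act n \<rho> v) (act n \<rho> v) - ff v v \<in> \<Gamma>)"
    proof (intro iffI allI ballI)
      fix v assume *: "\<forall>v\<in>carrier_vec (2 * n). form_f n bar (\<rho> *\<^sub>v v) (\<rho> *\<^sub>v v) - form_f n bar v v \<in> \<Gamma>"
      show "ff (act n \<rho> v) (act n \<rho> v) - ff v v \<in> \<Gamma>"
        unfolding form_f_tv[symmetric] tv_act[OF c] using * by simp
    next
      fix v :: "'a vec" assume *: "\<forall>v. ff (act n \<rho> v) (act n \<rho> v) - ff v v \<in> \<Gamma>" and v: "v \<in> carrier_vec (2 * n)"
      obtain w where w: "v = tv n w" using tv_surj[OF v] by blast
      show "form_f n bar (\<rho> *\<^sub>v v) (\<rho> *\<^sub>v v) - form_f n bar v v \<in> \<Gamma>"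
        unfolding w tv_act[OF c, symmetric] form_f_tv using * by blast
    qed
    ultimately show ?thesis using \<rho> by (auto simp: U_cong_def)
  qed
  have comm: "group_commutator UG \<sigma> \<epsilon> \<in> carrier UG"
    and act_comm: "act n (group_commutator UG \<sigma> \<epsilon>) (act n \<epsilon> (act n \<sigma> x)) = act n \<sigma> (act n \<epsilon> x)"
    if \<epsilon>: "\<epsilon> \<in> EU n bar lam \<Lambda>" for \<epsilon> x
  proof -
    have ec: "\<epsilon> \<in> carrier UG" using \<epsilon> by (rule EU_carrier)
    show c: "group_commutator UG \<sigma> \<epsilon> \<in> carrier UG" using \<sigma> ec by (simp add: group_commutator_def)
    have "group_commutator UG \<sigma> \<epsilon> \<otimes>\<^bsub>UG\<^esub> (\<epsilon> \<otimes>\<^bsub>UG\<^esub> \<sigma>) = \<sigma> \<otimes>\<^bsub>UG\<^esub> \<epsilon>"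
    proof -
      have "inv\<^bsub>UG\<^esub> \<epsilon> \<otimes>\<^bsub>UG\<^esub> (\<epsilon> \<otimes>\<^bsub>UG\<^esub> \<sigma>) = \<sigma>" using \<sigma> ec by (simp add: m_assoc[symmetric])
      then show ?thesis using \<sigma> ec by (simp add: group_commutator_def m_assoc)
    qed
    then have "act n (group_commutator UG \<sigma> \<epsilon> \<otimes>\<^bsub>UG\<^esub> (\<epsilon> \<otimes>\<^bsub>UG\<^esub> \<sigma>)) x = act n (\<sigma> \<otimes>\<^bsub>UG\<^esub> \<epsilon>) x" by simp
    then show "act n (group_commutator UG \<sigma> \<epsilon>) (act n \<epsilon> (act n \<sigma> x)) = act n \<sigma> (act n \<epsilon> x)"
      using \<sigma> ec c by (simp add: act_UG_mult)
  qed
  show ?thesis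
  proof
    assume CU: "\<sigma> \<in> CU n bar lam \<Lambda> I \<Gamma>"
    show "cu (act n \<sigma>)"
      unfolding cu_def
    proof (intro conjI ballI u)
      fix \<epsilon>' assume "\<epsilon>' \<in> EE"
      then obtain \<epsilon> where \<epsilon>: "\<epsilon> \<in> EU n bar lam \<Lambda>" "\<epsilon>' = act n \<epsilon>" using EE_act by blast
      have "group_commutator UG \<sigma> \<epsilon> \<in> U_cong n bar lam \<Lambda> I \<Gamma>" using CU \<epsilon>(1) by (simp add: CU_def)
      then show "\<forall>v. veq (act n \<sigma> (\<epsilon>' v)) (\<epsilon>' (act n \<sigma> v)) \<and>
          ff (act n \<sigma> (\<epsilon>' v)) (act n \<sigma> (\<epsilon>' v)) - ff (\<epsilon>' (act n \<sigma> v)) (\<epsilon>' (act n \<sigma> v)) \<in> \<Gamma>"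
        unfolding U[OF comm[OF \<epsilon>(1)]] \<epsilon>(2) using act_comm[OF \<epsilon>(1)] by metis
    qed
  next
    assume cu: "cu (act n \<sigma>)"
    have "group_commutator UG \<sigma> \<epsilon> \<in> U_cong n bar lam \<Lambda> I \<Gamma>" if \<epsilon>: "\<epsilon> \<in> EU n bar lam \<Lambda>" for \<epsilon>
      unfolding U[OF comm[OF \<epsilon>]]
    proof
      fix v
      have ec: "\<epsilon> \<in> carrier UG" using \<epsilon> by (rule EU_carrier)
      \<comment> \<open>Both matrices are invertible, so every v is of the form in which
        \<open>cu\<close> is stated.\<close>
      define x where "x = act n (inv\<^bsub>UG\<^esub> \<sigma>) (act n (inv\<^bsub>UG\<^esub> \<epsilon>) v)"
      have v: "v = act n \<epsilon> (act n \<sigma> x)"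
        unfolding x_def using act_UG_inv(2)[OF \<sigma>] act_UG_inv(2)[OF ec] by (metis comp_apply id_apply)
      show "veq (act n (group_commutator UG \<sigma> \<epsilon>) v) v \<and>
          ff (act n (group_commutator UG \<sigma> \<epsilon>) v) (act n (group_commutator UG \<sigma> \<epsilon>) v) - ff v v \<in> \<Gamma>"
        using cu act_EU[OF \<epsilon>] unfolding v act_comm[OF \<epsilon>] cu_def by blast
    qed
    then show "\<sigma> \<in> CU n bar lam \<Lambda> I \<Gamma>" using \<sigma> by (simp add: CU_def)
  qed
qed

end

section \<open>Normal closures and the two directions of the sandwich\<close>

context hyperbolic
begin

lemma normalized_act:
  assumes H: "subgroup H UG"
    and norm: "\<And>\<epsilon> h. \<epsilon> \<in> EU n bar lam \<Lambda> \<Longrightarrow> h \<in> H \<Longrightarrow> \<epsilon> \<otimes>\<^bsub>UG\<^esub> h \<otimes>\<^bsub>UG\<^esub> inv\<^bsub>UG\<^esub> \<epsilon> \<in> H"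
  shows "normalized n bar lam \<Lambda> (act n ` H)"
proof -
  interpret group UG by (rule UG_group)
  note Hc = subgroup.mem_carrier[OF H]
  show ?thesis
  proof unfold_locales
    show "id \<in> act n ` H"
      using subgroup.one_closed[OF H] act_one[of n] unfolding UG_ops by (metis image_eqI)
  next
    fix \<nu> \<mu> assume "\<nu> \<in> act n ` H" "\<mu> \<in> act n ` H"
    then obtain a b where ab: "a \<in> H" "b \<in> H" "\<nu> = act n a" "\<mu> = act n b" by blast
    then show "\<nu> \<circ> \<mu> \<in> act n ` H"
      using act_UG_mult[OF Hc[OF ab(1)] Hc[OF ab(2)]] subgroup.m_closed[OF H ab(1,2)] by (metis image_eqI)
  next
    fix \<nu> assume "\<nu> \<in> act n ` H"
    then obtain a where a: "a \<in> H" "\<nu> = act n a" by blast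
    then show "\<exists>\<nu>'\<in>act n ` H. \<nu>' \<circ> \<nu> = id \<and> \<nu> \<circ> \<nu>' = id"
      using act_UG_inv[OF Hc[OF a(1)]] subgroup.m_inv_closed[OF H a(1)] by blast
  next
    fix g \<nu> assume "g \<in> EE" "\<nu> \<in> act n ` H"
    then obtain \<epsilon> a where a: "\<epsilon> \<in> EU n bar lam \<Lambda>" "g = act n \<epsilon>" "a \<in> H" "\<nu> = act n a" using EE_act by blast
    let ?c = "\<epsilon> \<otimes>\<^bsub>UG\<^esub> a \<otimes>\<^bsub>UG\<^esub> inv\<^bsub>UG\<^esub> \<epsilon>"
    have c: "\<epsilon> \<in> carrier UG" "a \<in> carrier UG" using a EU_carrier Hc by auto
    then have "?c \<otimes>\<^bsub>UG\<^esub> \<epsilon> = \<epsilon> \<otimes>\<^bsub>UG\<^esub> a" by (simp add: m_assoc)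
    then have "act n ?c \<circ> act n \<epsilon> = act n \<epsilon> \<circ> act n a"
      using c act_UG_mult[of ?c \<epsilon>] act_UG_mult[of \<epsilon> a] by simp
    then have "g \<circ> \<nu> = act n ?c \<circ> g" by (simp only: a(2,4))
    then show "\<exists>\<nu>'\<in>act n ` H. g \<circ> \<nu> = \<nu>' \<circ> g"
      by (intro bexI[of _ "act n ?c"] imageI norm a)
  qed
qed

lemma EU_rel_subset:
  assumes "N \<lhd> UG\<lparr>carrier := EU n bar lam \<Lambda>\<rparr>" "EU_ideal n bar lam \<Lambda> I \<Gamma> \<subseteq> N"
  shows "EU_rel n bar lam \<Lambda> I \<Gamma> \<subseteq> N"
  unfolding EU_rel_def using assms by (intro hull_minimal) auto

lemma normal_EU_iff:
  "N \<lhd> UG\<lparr>carrier := EU n bar lam \<Lambda>\<rparr> \<longleftrightarrow> subgroup N UG \<and> N \<subseteq> EU n bar lam \<Lambda> \<and>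
    (\<forall>\<epsilon>\<in>EU n bar lam \<Lambda>. \<forall>\<nu>\<in>N. \<epsilon> \<otimes>\<^bsub>UG\<^esub> \<nu> \<otimes>\<^bsub>UG\<^esub> inv\<^bsub>UG\<^esub> \<epsilon> \<in> N)"
proof -
  interpret group UG by (rule UG_group)
  let ?E = "UG\<lparr>carrier := EU n bar lam \<Lambda>\<rparr>"
  have E: "group ?E" using EU_subgroup by (rule subgroup_imp_group)
  have inv: "inv\<^bsub>?E\<^esub> \<epsilon> = inv\<^bsub>UG\<^esub> \<epsilon>" if "\<epsilon> \<in> EU n bar lam \<Lambda>" for \<epsilon>
    using m_inv_consistent[OF EU_subgroup that] .
  have "subgroup N ?E \<longleftrightarrow> subgroup N UG \<and> N \<subseteq> EU n bar lam \<Lambda>"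
    using subgroup.subset[of N ?E] incl_subgroup[OF EU_subgroup, of N] subgroup_incl[OF _ EU_subgroup, of N] by auto
  then show ?thesis
    unfolding group.normal_inv_iff[OF E] using inv by auto
qed

end

context level
begin

lemma EU_ideal_EU: "EU_ideal n bar lam \<Lambda> I \<Gamma> \<subseteq> EU n bar lam \<Lambda>"
proof -
  have "elem_transvections n bar lam I \<Gamma> \<subseteq> elem_transvections n bar lam UNIV \<Lambda>"
    unfolding elem_transvections_def using Gam_Lam by blast
  then show ?thesis unfolding EU_ideal_def EU_def by (rule group.mono_generate[OF UG_group])
qed

lemma EU_rel_normal: "EU_rel n bar lam \<Lambda> I \<Gamma> \<lhd> UG\<lparr>carrier := EU n bar lam \<Lambda>\<rparr>"
proof -
  interpret group UG by (rule UG_group)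
  let ?K = "{N. N \<lhd> UG\<lparr>carrier := EU n bar lam \<Lambda>\<rparr> \<and> EU_ideal n bar lam \<Lambda> I \<Gamma> \<subseteq> N}"
  \<comment> \<open>The hull is an intersection; this member keeps the family from being empty,
    which would make the intersection the whole type.\<close>
  have "EU n bar lam \<Lambda> \<in> ?K"
    using EU_subgroup EU_ideal_EU subgroup.m_closed[OF EU_subgroup] subgroup.m_inv_closed[OF EU_subgroup]
    by (simp add: normal_EU_iff)
  then have ne: "?K \<noteq> {}" and sub: "\<Inter>?K \<subseteq> EU n bar lam \<Lambda>" by blast+
  have "subgroup (\<Inter>?K) UG" using ne by (intro subgroups_Inter) (auto simp: normal_EU_iff)
  then show ?thesis unfolding EU_rel_def hull_def normal_EU_iff using sub by (auto simp: normal_EU_iff)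
qed

lemma relative_EU_rel: "relative n bar lam \<Lambda> I \<Gamma> (act n ` EU_rel n bar lam \<Lambda> I \<Gamma>)"
proof -
  let ?N = "EU_rel n bar lam \<Lambda> I \<Gamma>"
  have N: "subgroup ?N UG" "?N \<subseteq> EU n bar lam \<Lambda>"
    "\<And>\<epsilon> \<nu>. \<epsilon> \<in> EU n bar lam \<Lambda> \<Longrightarrow> \<nu> \<in> ?N \<Longrightarrow> \<epsilon> \<otimes>\<^bsub>UG\<^esub> \<nu> \<otimes>\<^bsub>UG\<^esub> inv\<^bsub>UG\<^esub> \<epsilon> \<in> ?N"
    using EU_rel_normal unfolding normal_EU_iff by auto
  have elem: "act n t \<in> act n ` ?N" if "t \<in> elem_transvections n bar lam I \<Gamma>" for t
  proof -
    have "t \<in> EU_ideal n bar lam \<Lambda> I \<Gamma>" unfolding EU_ideal_def using that by (rule generate.incl)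
    moreover have "EU_ideal n bar lam \<Lambda> I \<Gamma> \<subseteq> ?N" unfolding EU_rel_def by (rule hull_subset)
    ultimately have "t \<in> ?N" by blast
    then show ?thesis by blast
  qed
  interpret normalized n bar lam \<Lambda> "act n ` ?N" using N by (intro normalized_act)
  show ?thesis
  proof unfold_locales
    fix i k s assume "i \<in> Om n" "k \<in> Om n" "k \<noteq> i" "k \<noteq> - i" "s \<in> I"
    then show "T (bas i) (scl s (bas k)) 0 \<in> act n ` ?N" using elem_N elem by metis
  next
    fix i b assume "i \<in> Om n" "b \<in> \<Gamma>"
    then show "T (bas i) 0 b \<in> act n ` ?N" using elem_N_long elem by metis
  qed
qed

text \<open>From h \<epsilon> = \<nu> \<epsilon> h with \<nu> in the relative elementary group, the
  conjugate of h by \<epsilon> is \<nu>^-1 h, a product of two elements of H.\<close>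

lemma sandwich_normalized:
  assumes H: "subgroup H UG" and lower: "EU_rel n bar lam \<Lambda> I \<Gamma> \<subseteq> H" and upper: "H \<subseteq> CU n bar lam \<Lambda> I \<Gamma>"
    and \<epsilon>: "\<epsilon> \<in> EU n bar lam \<Lambda>" and h: "h \<in> H"
  shows "\<epsilon> \<otimes>\<^bsub>UG\<^esub> h \<otimes>\<^bsub>UG\<^esub> inv\<^bsub>UG\<^esub> \<epsilon> \<in> H"
proof -
  interpret group UG by (rule UG_group)
  interpret eu: relative n bar lam \<Lambda> I \<Gamma> "act n ` EU_rel n bar lam \<Lambda> I \<Gamma>" by (rule relative_EU_rel)
  have c: "\<epsilon> \<in> carrier UG" "h \<in> carrier UG" using \<epsilon> EU_carrier h subgroup.mem_carrier[OF H] by auto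
  have "cu (act n h)" using CU_iff[OF c(2)] upper h by blast
  moreover have "act n h (act n (inv\<^bsub>UG\<^esub> h) v) = v" for v using act_UG_inv(2)[OF c(2)] by (metis comp_apply id_apply)
  ultimately have "good (act n h)" by (rule cu_good)
  then obtain \<nu> where \<nu>: "\<nu> \<in> EU_rel n bar lam \<Lambda> I \<Gamma>" "act n h \<circ> act n \<epsilon> = act n \<nu> \<circ> act n \<epsilon> \<circ> act n h"
    using eu.good_commute[OF _ act_EU[OF \<epsilon>]] by blast
  have \<nu>H: "\<nu> \<in> H" using \<nu> lower by blast
  then have \<nu>c: "\<nu> \<in> carrier UG" using subgroup.mem_carrier[OF H] by blast
  have "act n (h \<otimes>\<^bsub>UG\<^esub> \<epsilon>) = act n (\<nu> \<otimes>\<^bsub>UG\<^esub> \<epsilon> \<otimes>\<^bsub>UG\<^esub> h)"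
    using c \<nu>c \<nu>(2) by (simp add: act_UG_mult)
  then have eq: "h \<otimes>\<^bsub>UG\<^esub> \<epsilon> = \<nu> \<otimes>\<^bsub>UG\<^esub> \<epsilon> \<otimes>\<^bsub>UG\<^esub> h" using c \<nu>c by (intro act_UG_inj) auto
  have "inv\<^bsub>UG\<^esub> \<nu> \<otimes>\<^bsub>UG\<^esub> (h \<otimes>\<^bsub>UG\<^esub> \<epsilon>) = \<epsilon> \<otimes>\<^bsub>UG\<^esub> h"
    unfolding eq using c \<nu>c by (simp add: m_assoc) (simp add: m_assoc[symmetric])
  then have "\<epsilon> \<otimes>\<^bsub>UG\<^esub> h \<otimes>\<^bsub>UG\<^esub> inv\<^bsub>UG\<^esub> \<epsilon> = inv\<^bsub>UG\<^esub> \<nu> \<otimes>\<^bsub>UG\<^esub> (h \<otimes>\<^bsub>UG\<^esub> \<epsilon>) \<otimes>\<^bsub>UG\<^esub> inv\<^bsub>UG\<^esub> \<epsilon>" by simp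
  also have "\<dots> = inv\<^bsub>UG\<^esub> \<nu> \<otimes>\<^bsub>UG\<^esub> h" using c \<nu>c by (simp add: m_assoc)
  finally show ?thesis using subgroup.m_closed[OF H subgroup.m_inv_closed[OF H \<nu>H] h] by simp
qed

end

context hyperbolic
begin

lemma normalized_sandwich:
  assumes H: "subgroup H UG"
    and norm: "\<And>\<epsilon> h. \<epsilon> \<in> EU n bar lam \<Lambda> \<Longrightarrow> h \<in> H \<Longrightarrow> \<epsilon> \<otimes>\<^bsub>UG\<^esub> h \<otimes>\<^bsub>UG\<^esub> inv\<^bsub>UG\<^esub> \<epsilon> \<in> H"
  shows "\<exists>I \<Gamma>. form_ideal bar lam \<Lambda> I \<Gamma> \<and> EU_rel n bar lam \<Lambda> I \<Gamma> \<subseteq> H \<and> H \<subseteq> CU n bar lam \<Lambda> I \<Gamma>"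
proof -
  interpret group UG by (rule UG_group)
  note Hc = subgroup.mem_carrier[OF H]
  interpret un: unitary_normalized n bar lam \<Lambda> "act n ` H"
    using normalized_act[OF assms] Hc
    by (intro unitary_normalized.intro unitary_normalized_axioms.intro) (auto simp: UG_carrier)
  let ?I = "un.level_I" and ?G = "un.level_G"
  have "t \<in> H" if t: "t \<in> elem_transvections n bar lam ?I ?G" for t
  proof -
    have tc: "t \<in> carrier UG" using t by (rule elem_transvections_UG) (auto simp: un.level_G_def)
    have "act n t \<in> act n ` H"
      using un.lv.elem_transvections_act[OF t] un.lv.N_short un.lv.N_long by auto
    then show "t \<in> H" using act_UG_inj[OF tc] Hc by blast
  qed
  then have "EU_ideal n bar lam \<Lambda> ?I ?G \<subseteq> H"
    unfolding EU_ideal_def by (intro generate_subgroup_incl[OF _ H]) blast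
  moreover have "H \<inter> EU n bar lam \<Lambda> \<lhd> UG\<lparr>carrier := EU n bar lam \<Lambda>\<rparr>"
    unfolding normal_EU_iff
    using norm subgroups_Inter_pair[OF H EU_subgroup] subgroup.m_closed[OF EU_subgroup] subgroup.m_inv_closed[OF EU_subgroup] by auto
  ultimately have "EU_rel n bar lam \<Lambda> ?I ?G \<subseteq> H \<inter> EU n bar lam \<Lambda>"
    using un.lv.EU_ideal_EU by (intro EU_rel_subset) auto
  moreover have "h \<in> CU n bar lam \<Lambda> ?I ?G" if "h \<in> H" for h
    using that Hc un.N_good un.lv.good_cu un.lv.CU_iff by blast
  ultimately show ?thesis using un.level_form_ideal by blast
qed

end

theorem corollary50:
  fixes n :: nat
    and bar :: "'a::comm_ring_1 \<Rightarrow> 'a"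
    and lam :: 'a
    and \<Lambda> :: "'a set"
    and H :: "'a mat set"
  assumes "n \<ge> 3"
    and "form_ring bar lam \<Lambda>"
    and "subgroup H (unitary_group n bar lam \<Lambda>)"
  shows "EU n bar lam \<Lambda> \<subseteq> normalizer (unitary_group n bar lam \<Lambda>) H \<longleftrightarrow>
    (\<exists>I \<Gamma>. form_ideal bar lam \<Lambda> I \<Gamma> \<and>
       EU_rel n bar lam \<Lambda> I \<Gamma> \<subseteq> H \<and> H \<subseteq> CU n bar lam \<Lambda> I \<Gamma>)"
proof -
  interpret hyperbolic n bar lam \<Lambda> using assms by unfold_locales
  show ?thesis
    unfolding normalizer_iff[OF assms(3) EU_subgroup]
  proof
    assume "\<forall>k\<in>EU n bar lam \<Lambda>. \<forall>h\<in>H. k \<otimes>\<^bsub>UG\<^esub> h \<otimes>\<^bsub>UG\<^esub> inv\<^bsub>UG\<^esub> k \<in> H"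
    then show "\<exists>I \<Gamma>. form_ideal bar lam \<Lambda> I \<Gamma> \<and> EU_rel n bar lam \<Lambda> I \<Gamma> \<subseteq> H \<and> H \<subseteq> CU n bar lam \<Lambda> I \<Gamma>"
      using normalized_sandwich[OF assms(3)] by blast
  next
    assume "\<exists>I \<Gamma>. form_ideal bar lam \<Lambda> I \<Gamma> \<and> EU_rel n bar lam \<Lambda> I \<Gamma> \<subseteq> H \<and> H \<subseteq> CU n bar lam \<Lambda> I \<Gamma>"
    then obtain I \<Gamma> where *: "form_ideal bar lam \<Lambda> I \<Gamma>" "EU_rel n bar lam \<Lambda> I \<Gamma> \<subseteq> H" "H \<subseteq> CU n bar lam \<Lambda> I \<Gamma>"
      by blast
    interpret level n bar lam \<Lambda> I \<Gamma> using *(1) by unfold_locales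
    show "\<forall>k\<in>EU n bar lam \<Lambda>. \<forall>h\<in>H. k \<otimes>\<^bsub>UG\<^esub> h \<otimes>\<^bsub>UG\<^esub> inv\<^bsub>UG\<^esub> k \<in> H"
      using sandwich_normalized[OF assms(3) *(2,3)] by blast
  qed
qed

end
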